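(* Let $X$ be a Banach space with the RMF property, $1<p<\infty$, and $\epsilon>0$. Then there is a constant $C<\infty$ such that $$\Big(\int_{\mathbf{R}^n}\mathbb{E}\Big\|\sum_{R\in\triangle}\varepsilon_R\,b_R(x)\langle u\rangle_R\Big\|_X^p\,dx\Big)^{1/p}\le C\,\|b\|_{\mathrm{Car}^{p+\epsilon}(\mathbf{R}^n)}\,\|u\|_{L^p(\mathbf{R}^n;X)}$$ for all $u\in L^p(\mathbf{R}^n;X)$ and all finitely non-zero sequences $b=(b_R)_{R\in\triangle}$ of measurable scalar-valued functions on $\mathbf{R}^n$ with $\operatorname{supp}b_R\subseteq R$. One may take $\epsilon=0$ if $X$ has (Rademacher) type $p$.
   Context: $\triangle=\bigcup_{k\in\mathbf{Z}}\triangle_{2^k}$ with $\triangle_{2^k}=\{2^k([0,1)^n+m):m\in\mathbf{Z}^n\}$ is the collection of dyadic cubes of $\mathbf{R}^n$; $\langle u\rangle_R=|R|^{-1}\int_Ru$. $(\varepsilon_R)_{R\in\triangle}$ (and $(\varepsilon_k)_{k\in\mathbf{Z}}$) are independent random variables taking values $\pm1$ with probability $1/2$; $\mathbb{E}$ is expectation. For $1\le q<\infty$, $$\|b\|_{\mathrm{Car}^q(\mathbf{R}^n)}=\sup_{S\in\triangle}\Big(\frac1{|S|}\int_S\mathbb{E}\Big|\sum_{R\in\triangle,R\subseteq S}\varepsilon_Rb_R(x)\Big|^q\,dx\Big)^{1/q}.$$ For $x\in Q\in\triangle_{2^k}$ let $A_{2^k}u(x)=\langle u\rangle_Q$, and $M_Ru(x)=\sup\{\mathbb{E}\|\sum_k\varepsilon_k\lambda_kA_{2^k}u(x)\|_X:(\lambda_k)_{k\in\mathbf{Z}}\text{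 finitely non-zero},\|\lambda\|_{\ell^2}\le1\}$. $X$ has RMF if $M_R$ is bounded from $L^2(\mathbf{R}^n;X)$ to $L^2(\mathbf{R}^n)$. $X$ has type $t\in[1,2]$ if $\mathbb{E}\|\sum_k\varepsilon_kx_k\|_X\le C(\sum_k\|x_k\|_X^t)^{1/t}$ for all finite sequences in $X$. *)

theory Defs
  imports "HOL-Probability.Probability"
begin

section \<open>Banach spaces over the scalar field\<close>

text \<open>
  The sort \<open>{real_normed_field, euclidean_space}\<close> contains both \<^typ>\<open>real\<close> and \<^typ>\<open>complex\<close>
  (and, by Gelfand--Mazur, nothing else up to isometric isomorphism). A Banach space over the scalar
  field \<open>'k\<close> is a type \<open>'x::banach\<close> together with a scalar multiplication \<open>sc\<close> by elements of \<open>'k\<close>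
  that extends the real one; for \<open>'k = real\<close> the only possibility is \<^term>\<open>scaleR\<close>.
\<close>

definition normed_space_over ::
    "('k::real_normed_field \<Rightarrow> 'x::real_normed_vector \<Rightarrow> 'x) \<Rightarrow> bool" where
  "normed_space_over sc \<longleftrightarrow>
     vector_space sc \<and>
     (\<forall>r x. sc (of_real r) x = r *\<^sub>R x) \<and>
     (\<forall>a x. norm (sc a x) = norm a * norm x)"

section \<open>Bochner integral in arbitrary Banach spaces\<close>

text \<open>
  The library's \<^const>\<open>has_bochner_integral\<close> is restricted to second countable spaces. Below, its
  Borel measurability condition is replaced by strong measurability, which makes the same definition
  work in nonseparable Banach spaces.
\<close>

definition strongly_measurable :: "'a measure \<Rightarrow> ('a \<Rightarrow> 'x::real_normed_vector) \<Rightarrow> bool" where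
  "strongly_measurable M f \<longleftrightarrow>
     (\<exists>s. (\<forall>i::nat. simple_function M (s i)) \<and> (AE x in M. (\<lambda>i. s i x) \<longlonglongrightarrow> f x))"

definition has_strong_bochner_integral ::
    "'a measure \<Rightarrow> ('a \<Rightarrow> 'x::real_normed_vector) \<Rightarrow> 'x \<Rightarrow> bool" where
  "has_strong_bochner_integral M f I \<longleftrightarrow>
     strongly_measurable M f \<and>
     (\<exists>s. (\<forall>i::nat. Bochner_Integration.simple_bochner_integrable M (s i)) \<and>
          (\<lambda>i. \<integral>\<^sup>+x. ennreal (norm (f x - s i x)) \<partial>M) \<longlonglongrightarrow> 0 \<and>
          (\<lambda>i. Bochner_Integration.simple_bochner_integral M (s i)) \<longlonglongrightarrow> I)"

definition strong_bochner_integral ::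
    "'a measure \<Rightarrow> ('a \<Rightarrow> 'x::real_normed_vector) \<Rightarrow> 'x" where
  "strong_bochner_integral M f = (THE I. has_strong_bochner_integral M f I)"

section \<open>Lebesgue spaces\<close>

definition enn_powr :: "ennreal \<Rightarrow> real \<Rightarrow> ennreal" where
  "enn_powr a r = (if a = \<infinity> then \<infinity> else ennreal (enn2real a powr r))"

definition Lp_norm :: "real \<Rightarrow> ('a::euclidean_space \<Rightarrow> ennreal) \<Rightarrow> ennreal" where
  "Lp_norm p f = enn_powr (\<integral>\<^sup>+x. enn_powr (f x) p \<partial>lebesgue) (1 / p)"

definition Lp_space :: "real \<Rightarrow> ('a::euclidean_space \<Rightarrow> 'x::real_normed_vector) set" where
  "Lp_space p =
     {u. strongly_measurable lebesgue u \<and> Lp_norm p (\<lambda>x. ennreal (norm (u x))) < \<infinity>}"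

section \<open>Dyadic cubes and averages\<close>

definition dyadic_cubes_at :: "int \<Rightarrow> (real ^ 'n::finite) set set" where
  "dyadic_cubes_at k =
     {(\<lambda>x. (2 powi k) *\<^sub>R (x + (\<chi> i. of_int (m $ i)))) ` {x. \<forall>i. 0 \<le> x $ i \<and> x $ i < 1}
      | m :: int ^ 'n. True}"

definition dyadic_cubes :: "(real ^ 'n::finite) set set" where
  "dyadic_cubes = (\<Union>k. dyadic_cubes_at k)"

definition average :: "(real ^ 'n::finite) set \<Rightarrow> (real ^ 'n \<Rightarrow> 'x::real_normed_vector) \<Rightarrow> 'x" where
  "average R u =
     (1 / measure lebesgue R) *\<^sub>R strong_bochner_integral lebesgue (\<lambda>x. indicator R x *\<^sub>R u x)"

definition dyadic_average ::
    "int \<Rightarrow> (real ^ 'n::finite \<Rightarrow> 'x::real_normed_vector) \<Rightarrow> real ^ 'n \<Rightarrow> 'x" where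
  "dyadic_average k u x = average (THE Q. Q \<in> dyadic_cubes_at k \<and> x \<in> Q) u"

section \<open>Random signs\<close>

text \<open>
  The coordinates \<open>\<epsilon> i\<close>, \<open>i \<in> I\<close>, of a point \<open>\<epsilon>\<close> of the product space below are independent random
  variables that take each of the values \<open>1\<close> and \<open>-1\<close> with probability \<open>1/2\<close>.
\<close>

definition random_signs :: "'i set \<Rightarrow> ('i \<Rightarrow> real) measure" where
  "random_signs I = Pi\<^sub>M I (\<lambda>_. measure_pmf (pmf_of_set {-1, 1}))"

section \<open>Carleson norm, type and RMF\<close>

text \<open>
  In this section, \<^const>\<open>sum\<close> is never applied to an infinite index set: sums of finitely non-zero
  families are taken over the indices of the non-zero members.
\<close>

definition Car_norm ::
    "real \<Rightarrow> ((real ^ 'n::finite) set \<Rightarrow> real ^ 'n \<Rightarrow> 'k::real_normed_vector) \<Rightarrow> ennreal" where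
  "Car_norm q b =
     (SUP S\<in>dyadic_cubes. enn_powr
        ((\<integral>\<^sup>+x\<in>S. (\<integral>\<^sup>+\<epsilon>. ennreal
             (norm (\<Sum>R | R \<in> dyadic_cubes \<and> R \<subseteq> S \<and> b R \<noteq> (\<lambda>_. 0). \<epsilon> R *\<^sub>R b R x) powr q)
           \<partial>random_signs dyadic_cubes) \<partial>lebesgue) / emeasure lebesgue S)
        (1 / q))"

definition rademacher_type :: "'x::real_normed_vector itself \<Rightarrow> real \<Rightarrow> bool" where
  "rademacher_type _ t \<longleftrightarrow>
     1 \<le> t \<and> t \<le> 2 \<and>
     (\<exists>C::real. \<forall>(N::nat) (x :: nat \<Rightarrow> 'x).
        (\<integral>\<^sup>+\<epsilon>. ennreal (norm (\<Sum>k<N. \<epsilon> k *\<^sub>R x k)) \<partial>random_signs UNIV)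
          \<le> ennreal (C * (\<Sum>k<N. norm (x k) powr t) powr (1 / t)))"

definition rademacher_maximal ::
    "('k::real_normed_field \<Rightarrow> 'x::real_normed_vector \<Rightarrow> 'x) \<Rightarrow>
     (real ^ 'n::finite \<Rightarrow> 'x) \<Rightarrow> real ^ 'n \<Rightarrow> ennreal" where
  "rademacher_maximal sc u x =
     (SUP l \<in> {l :: int \<Rightarrow> 'k. finite {k. l k \<noteq> 0} \<and> L2_set (\<lambda>k. norm (l k)) {k. l k \<noteq> 0} \<le> 1}.
        \<integral>\<^sup>+\<epsilon>. ennreal (norm (\<Sum>k | l k \<noteq> 0. \<epsilon> k *\<^sub>R sc (l k) (dyadic_average k u x)))
          \<partial>random_signs UNIV)"

definition RMF_property ::
    "('k::real_normed_field \<Rightarrow> 'x::real_normed_vector \<Rightarrow> 'x) \<Rightarrow> 'n::finite itself \<Rightarrow> bool" where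
  "RMF_property sc _ \<longleftrightarrow>
     (\<exists>C::real. \<forall>u :: real ^ 'n \<Rightarrow> 'x. u \<in> Lp_space 2 \<longrightarrow>
        Lp_norm 2 (rademacher_maximal sc u)
          \<le> ennreal C * Lp_norm 2 (\<lambda>x. ennreal (norm (u x))))"

section \<open>The embedding inequality\<close>

definition admissible_family ::
    "((real ^ 'n::finite) set \<Rightarrow> real ^ 'n \<Rightarrow> 'k::{real_normed_field, euclidean_space}) \<Rightarrow> bool" where
  "admissible_family b \<longleftrightarrow>
     finite {R \<in> dyadic_cubes. b R \<noteq> (\<lambda>_. 0)} \<and>
     (\<forall>R \<in> dyadic_cubes. b R \<in> borel_measurable lebesgue \<and> {x. b R x \<noteq> 0} \<subseteq> R)"

text \<open>The left-hand side of the embedding inequality.\<close>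

definition paraproduct_norm ::
    "('k::real_normed_field \<Rightarrow> 'x::real_normed_vector \<Rightarrow> 'x) \<Rightarrow> real \<Rightarrow>
     ((real ^ 'n::finite) set \<Rightarrow> real ^ 'n \<Rightarrow> 'k) \<Rightarrow> (real ^ 'n \<Rightarrow> 'x) \<Rightarrow> ennreal" where
  "paraproduct_norm sc p b u =
     enn_powr
       (\<integral>\<^sup>+x. (\<integral>\<^sup>+\<epsilon>. ennreal
            (norm (\<Sum>R | R \<in> dyadic_cubes \<and> b R \<noteq> (\<lambda>_. 0). \<epsilon> R *\<^sub>R sc (b R x) (average R u)) powr p)
          \<partial>random_signs dyadic_cubes) \<partial>lebesgue)
       (1 / p)"

end

theory Submission
  imports Defs
begin

text \<open>
  Write \<open>h = norm u\<close> and \<open>\<langle>h\<rangle>\<^sub>Q\<close> for its mean over \<open>Q\<close>, and let \<open>F\<close> be the finite set of cubes \<open>R\<close> with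
  \<open>b\<^sub>R \<noteq> 0\<close>. At a fixed point \<open>x\<close> only the cubes that contain \<open>x\<close> contribute, and they form a chain; the
  RMF property controls a Rademacher sum of averages of \<open>u\<close> over a chain by the \<open>\<ell>\<^sup>2\<close> norm of the
  coefficients, but with the maximal function of \<open>u\<close> in place of a number. The proof replaces this
  function by numbers, at the price of cutting the chain into pieces.

  For \<open>R \<subseteq> Q\<close> call the pair \<open>Q, R\<close> bad if some sum over the cubes between \<open>R\<close> and \<open>Q\<close> exceeds
  \<open>C \<langle>h\<rangle>\<^sub>Q\<close> times the \<open>\<ell>\<^sup>2\<close> norm of its coefficients. The bad cubes inside \<open>Q\<close> cover at most half of \<open>Q\<close>
  (\<open>local_weak_type\<close>). Indeed a Calderon--Zygmund decomposition discards a quarter of \<open>Q\<close> and replaces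
  \<open>u\<close> by its conditional expectation on a finite partition of \<open>Q\<close>, which is bounded by a multiple of
  \<open>\<langle>h\<rangle>\<^sub>Q\<close> and has the same averages over all cubes that remain; the \<open>L\<^sup>2\<close> bound of the Rademacher maximal
  function and Chebyshev's inequality do the rest. The local estimate costs only \<open>L\<^sup>1\<close> means of \<open>h\<close>,
  which is how an \<open>L\<^sup>2\<close> hypothesis leads to results on all \<open>L\<^sup>p\<close> with \<open>1 < p < \<infinity>\<close>.

  Selecting cubes greedily from the top, a new one as soon as the pair turns bad, yields a sparse
  family \<open>S\<close> of principal cubes and assigns to each \<open>R\<close> some \<open>Q \<supseteq> R\<close> in \<open>S\<close> such that the pair \<open>Q, R\<close> is
  good (\<open>principal_cubes\<close>). Grouping the sum by \<open>Q\<close>, the part that belongs to \<open>Q\<close> has expected norm at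
  most \<open>C \<langle>h\<rangle>\<^sub>Q F\<^sub>Q(x)\<close>, where \<open>F\<^sub>Q\<close> is the square function of the \<open>b\<^sub>R\<close> with \<open>R \<subseteq> Q\<close>; by Khintchine's
  inequality \<open>\<integral> F\<^sub>Q\<^sup>q\<close> is at most a constant times \<open>|Q|\<close> times the \<open>q\<close>-th power of the Carleson norm
  (\<open>sparse_domination\<close>).

  It remains to add up the parts. If \<open>X\<close> has type \<open>p\<close>, an independent second randomisation of the parts
  bounds the \<open>p\<close>-th moment of the sum by the sum of the \<open>p\<close>-th moments (\<open>type_decoupling\<close>), so that
  everything reduces to \<open>\<Sum>\<^sub>Q \<langle>h\<rangle>\<^sub>Q\<^sup>p |Q| \<le> C \<integral> h\<^sup>p\<close>, the classical Carleson embedding for a sparse family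
  (\<open>carleson_embedding\<close>). In general only the triangle inequality is available, and one has to bound the
  \<open>L\<^sup>p\<close> norm of \<open>f = \<Sum>\<^sub>Q \<langle>h\<rangle>\<^sub>Q F\<^sub>Q\<close>. Testing against \<open>g = f\<^sup>p\<^sup>-\<^sup>1\<close> and using Hoelder's inequality on each \<open>Q\<close>
  with some exponent \<open>q > p\<close> produces means of \<open>g\<^sup>q\<^sup>'\<close>, for which the scalar embedding applies again
  because \<open>q' < p'\<close> (\<open>sparse_sum_bound\<close>): this is where the \<open>\<epsilon>\<close> is lost.

  Both cases pass between \<open>p\<close>-th and first moments of Rademacher sums by Kahane's inequality, which is
  derived from a two-point hypercontractive estimate.
\<close>

section \<open>Averages over signs\<close>

definition signs :: "'i set \<Rightarrow> ('i \<Rightarrow> real) set" where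
  "signs J = PiE J (\<lambda>_. {-1, 1})"

text \<open>
  The expectation over independent signs indexed by a finite set \<open>J\<close> is a finite average; working with
  it instead of the product measure makes linearity, exchange of expectations and conditioning on one
  coordinate purely algebraic. The link to the measure is \<open>nn_integral_random_signs\<close> below.
\<close>

definition sign_mean :: "'i set \<Rightarrow> (('i \<Rightarrow> real) \<Rightarrow> real) \<Rightarrow> real" where
  "sign_mean J F = (\<Sum>s\<in>signs J. F s) / 2 ^ card J"

text \<open>
  The \<open>p\<close>-th moment of the Rademacher sum of a finite family. No \<open>p\<close>-th root is taken, because the
  moments are integrated over \<open>x\<close> afterwards.
\<close>

definition rad :: "real \<Rightarrow> 'i set \<Rightarrow> ('i \<Rightarrow> 'x::real_normed_vector) \<Rightarrow> real" where
  "rad p J x = sign_mean J (\<lambda>s. norm (\<Sum>i\<in>J. s i *\<^sub>R x i) powr p)"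

lemma finite_signs [simp]: "finite J \<Longrightarrow> finite (signs J)"
  unfolding signs_def by (rule finite_PiE) auto

lemma card_signs: "finite J \<Longrightarrow> card (signs J) = 2 ^ card J"
  unfolding signs_def by (subst card_PiE) (auto simp: card_insert_if numeral_2_eq_2)

lemma sign_mean_mono:
  "(\<And>s. s \<in> signs J \<Longrightarrow> F s \<le> G s) \<Longrightarrow> sign_mean J F \<le> sign_mean J G"
  unfolding sign_mean_def by (intro divide_right_mono sum_mono) auto

lemma sign_mean_cong:
  "(\<And>s. s \<in> signs J \<Longrightarrow> F s = G s) \<Longrightarrow> sign_mean J F = sign_mean J G"
  unfolding sign_mean_def by (metis (no_types, lifting) sum.cong)

lemma sign_mean_nonneg:
  "(\<And>s. s \<in> signs J \<Longrightarrow> 0 \<le> F s) \<Longrightarrow> 0 \<le> sign_mean J F"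
  unfolding sign_mean_def by (intro divide_nonneg_nonneg sum_nonneg) auto

lemma sign_mean_const [simp]: "finite J \<Longrightarrow> sign_mean J (\<lambda>_. c) = c"
  unfolding sign_mean_def by (simp add: card_signs)

lemma sign_mean_add: "sign_mean J (\<lambda>s. F s + G s) = sign_mean J F + sign_mean J G"
  unfolding sign_mean_def by (simp add: sum.distrib add_divide_distrib)

lemma sign_mean_cmult: "sign_mean J (\<lambda>s. c * F s) = c * sign_mean J F"
  unfolding sign_mean_def by (simp add: sum_distrib_left)

lemma sign_mean_sum: "sign_mean J (\<lambda>s. \<Sum>a\<in>A. F a s) = (\<Sum>a\<in>A. sign_mean J (F a))"
  unfolding sign_mean_def by (subst sum.swap) (simp add: sum_divide_distrib)

lemma sign_mean_swap:
  "sign_mean J (\<lambda>s. sign_mean K (\<lambda>t. F s t)) = sign_mean K (\<lambda>t. sign_mean J (\<lambda>s. F s t))"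
  unfolding sign_mean_def
  by (simp add: sum_divide_distrib[symmetric] sum.swap[of _ "signs J" "signs K"] divide_divide_eq_left mult.commute)

lemma sign_mean_insert:
  assumes "finite J" "j \<notin> J"
  shows "sign_mean (insert j J) F =
    (sign_mean J (\<lambda>s. F (s(j := 1))) + sign_mean J (\<lambda>s. F (s(j := -1)))) / 2"
proof -
  have inj: "inj_on (\<lambda>(y, g). g(j := y)) ({-1, 1::real} \<times> signs J)"
    using inj_combinator[OF assms(2), of "\<lambda>_. {-1, 1::real}"] by (simp add: signs_def)
  have "(\<Sum>s\<in>signs (insert j J). F s) = (\<Sum>(y, g)\<in>{-1, 1::real} \<times> signs J. F (g(j := y)))"
    unfolding signs_def PiE_insert_eq
    by (subst sum.reindex) (use inj in \<open>auto simp: signs_def case_prod_unfold\<close>)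
  also have "\<dots> = (\<Sum>y\<in>{-1, 1::real}. \<Sum>g\<in>signs J. F (g(j := y)))"
    by (simp add: sum.cartesian_product)
  finally show ?thesis
    using assms by (simp add: sign_mean_def field_simps)
qed

lemma sign_sum_insert:
  fixes x :: "'i \<Rightarrow> 'x::real_normed_vector"
  assumes "finite J" "j \<notin> J"
  shows "(\<Sum>i\<in>insert j J. (s(j := c)) i *\<^sub>R x i) = c *\<^sub>R x j + (\<Sum>i\<in>J. s i *\<^sub>R x i)"
proof -
  have "(\<Sum>i\<in>J. (s(j := c)) i *\<^sub>R x i) = (\<Sum>i\<in>J. s i *\<^sub>R x i)"
    using assms by (intro sum.cong) auto
  then show ?thesis using assms by simp
qed

section \<open>Hypercontractivity and Kahane's inequality\<close>

text \<open>
  The linear term is exact, so it cancels when the bounds for \<open>z\<close> and \<open>- z\<close> are added; the crude constant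
  in the quadratic term is later absorbed by shrinking \<open>z\<close>.
\<close>

lemma power_upper_quadratic:
  fixes z :: real
  assumes "\<bar>z\<bar> \<le> 1"
  shows "(1 + z) ^ N \<le> 1 + real N * z + 4 ^ N * z\<^sup>2"
proof (induction N)
  case 0
  then show ?case by simp
next
  case (Suc N)
  have z3: "z * z\<^sup>2 \<le> z\<^sup>2"
    using assms mult_right_mono[of z 1 "z\<^sup>2"] by auto
  have N4: "real N \<le> 4 ^ N"
    using of_nat_less_two_power[of N, where 'a=real] power_mono[of 2 "4::real" N] by linarith
  have "(1 + z) ^ Suc N \<le> (1 + z) * (1 + real N * z + 4 ^ N * z\<^sup>2)"
    using Suc assms by (simp add: mult_left_mono)
  also have "\<dots> = 1 + real (Suc N) * z + real N * z\<^sup>2 + 4 ^ N * z\<^sup>2 + 4 ^ N * (z * z\<^sup>2)"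
    by (simp add: algebra_simps power2_eq_square)
  also have "\<dots> \<le> 1 + real (Suc N) * z + 4 ^ N * z\<^sup>2 + 4 ^ N * z\<^sup>2 + 4 ^ N * z\<^sup>2"
    using N4 z3 by (intro add_mono mult_right_mono mult_left_mono) auto
  also have "\<dots> \<le> 1 + real (Suc N) * z + 4 ^ Suc N * z\<^sup>2"
    by simp
  finally show ?case .
qed

text \<open>
  The contraction \<open>r\<close> is chosen such that \<open>4 ^ (4 * q) * r\<^sup>2 = 1\<close>: the left-hand side is then at most
  \<open>1 + y\<^sup>2\<close> because the linear terms cancel. The mean on the right is at least \<open>1 + y\<^sup>2\<close> by Bernoulli's
  inequality, applied to the powers of \<open>(1 \<plusminus> y)\<^sup>2 = 1 + (y\<^sup>2 \<plusminus> 2 y)\<close>.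
\<close>

lemma two_point_unit:
  fixes y :: real
  assumes "\<bar>y\<bar> \<le> 1" "1 \<le> q"
  defines "r \<equiv> 1 / 4 ^ (2 * q)"
  shows "((1 + r * y) ^ (4 * q) + (1 - r * y) ^ (4 * q)) / 2
    \<le> (((1 + y) ^ (2 * q) + (1 - y) ^ (2 * q)) / 2)\<^sup>2"
proof -
  have r: "0 \<le> r" "r \<le> 1" by (auto simp: r_def)
  have ry: "\<bar>r * y\<bar> \<le> 1" "\<bar>- (r * y)\<bar> \<le> 1"
    using r assms(1) mult_mono[of r 1 "\<bar>y\<bar>" 1] by (auto simp: abs_mult)
  have "4 ^ (4 * q) * (r * y)\<^sup>2 = y\<^sup>2"
    by (simp add: r_def power_divide power_mult_distrib flip: power_mult)
  then have A: "((1 + r * y) ^ (4 * q) + (1 - r * y) ^ (4 * q)) / 2 \<le> 1 + y\<^sup>2"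
    using power_upper_quadratic[OF ry(1), of "4 * q"] power_upper_quadratic[OF ry(2), of "4 * q"]
    by simp
  have "1 + real q * (2 * y + y\<^sup>2) \<le> (1 + y) ^ (2 * q)"
  proof -
    have "-1 \<le> 2 * y + y\<^sup>2" using zero_le_power2[of "1 + y"] by (simp add: power2_eq_square algebra_simps)
    then have "1 + real q * (2 * y + y\<^sup>2) \<le> (1 + (2 * y + y\<^sup>2)) ^ q"
      using Bernoulli_inequality[of "2 * y + y\<^sup>2" q] by (simp add: mult.commute)
    also have "1 + (2 * y + y\<^sup>2) = (1 + y)\<^sup>2" by (simp add: power2_eq_square algebra_simps)
    finally show ?thesis by (simp add: power_mult)
  qed
  moreover have "1 + real q * (- 2 * y + y\<^sup>2) \<le> (1 - y) ^ (2 * q)"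
  proof -
    have "-1 \<le> - 2 * y + y\<^sup>2" using zero_le_power2[of "1 - y"] by (simp add: power2_eq_square algebra_simps)
    then have "1 + real q * (- 2 * y + y\<^sup>2) \<le> (1 + (- 2 * y + y\<^sup>2)) ^ q"
      using Bernoulli_inequality[of "- 2 * y + y\<^sup>2" q] by (simp add: mult.commute)
    also have "1 + (- 2 * y + y\<^sup>2) = (1 - y)\<^sup>2" by (simp add: power2_eq_square algebra_simps)
    finally show ?thesis by (simp add: power_mult)
  qed
  ultimately have "1 + real q * y\<^sup>2 \<le> ((1 + y) ^ (2 * q) + (1 - y) ^ (2 * q)) / 2"
    by (simp add: algebra_simps)
  moreover have "y\<^sup>2 \<le> real q * y\<^sup>2" using assms(2) mult_right_mono[of 1 "real q" "y\<^sup>2"] by simp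
  ultimately have B: "1 + y\<^sup>2 \<le> ((1 + y) ^ (2 * q) + (1 - y) ^ (2 * q)) / 2" by simp
  have "1 + y\<^sup>2 \<le> (1 + y\<^sup>2)\<^sup>2"
    using mult_right_mono[of 1 "1 + y\<^sup>2" "1 + y\<^sup>2"] by (simp add: power2_eq_square[of "1 + y\<^sup>2"])
  also have "\<dots> \<le> (((1 + y) ^ (2 * q) + (1 - y) ^ (2 * q)) / 2)\<^sup>2"
    using B by (intro power_mono) auto
  finally show ?thesis using A by simp
qed

lemma two_point_scalar:
  fixes a b :: real
  assumes "\<bar>b\<bar> \<le> a" "1 \<le> q"
  defines "r \<equiv> 1 / 4 ^ (2 * q)"
  shows "((a + r * b) ^ (4 * q) + (a - r * b) ^ (4 * q)) / 2
    \<le> (((a + b) ^ (2 * q) + (a - b) ^ (2 * q)) / 2)\<^sup>2"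
proof (cases "a = 0")
  case True
  then show ?thesis using assms by (simp add: power_0_left)
next
  case False
  then have a: "0 < a" using assms by linarith
  define y where "y = b / a"
  have b: "b = a * y" using False by (simp add: y_def)
  have y: "\<bar>y\<bar> \<le> 1" using assms(1) a by (simp add: y_def)
  have e: "a + r * b = a * (1 + r * y)" "a - r * b = a * (1 - r * y)"
    "a + b = a * (1 + y)" "a - b = a * (1 - y)" by (auto simp: b algebra_simps)
  have "((a + r * b) ^ (4 * q) + (a - r * b) ^ (4 * q)) / 2
      = a ^ (4 * q) * (((1 + r * y) ^ (4 * q) + (1 - r * y) ^ (4 * q)) / 2)"
    unfolding e power_mult_distrib by (simp add: algebra_simps)
  also have "\<dots> \<le> a ^ (4 * q) * (((1 + y) ^ (2 * q) + (1 - y) ^ (2 * q)) / 2)\<^sup>2"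
    using two_point_unit[OF y assms(2)] a unfolding r_def by (intro mult_left_mono) auto
  also have "\<dots> = (a ^ (2 * q) * (((1 + y) ^ (2 * q) + (1 - y) ^ (2 * q)) / 2))\<^sup>2"
    unfolding power_mult_distrib[of "a ^ (2 * q)"] by (simp flip: power_mult add: mult.commute)
  also have "a ^ (2 * q) * (((1 + y) ^ (2 * q) + (1 - y) ^ (2 * q)) / 2)
      = ((a + b) ^ (2 * q) + (a - b) ^ (2 * q)) / 2"
    unfolding e power_mult_distrib by (simp add: algebra_simps)
  finally show ?thesis .
qed

text \<open>
  The vector-valued inequality follows from the scalar one: with \<open>a\<close> and \<open>b\<close> the half sum and half
  difference of \<open>norm (x + y)\<close> and \<open>norm (x - y)\<close>, writing \<open>x \<plusminus> r y\<close> as a convex combination of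
  \<open>x + y\<close> and \<open>x - y\<close> gives \<open>norm (x \<plusminus> r y) \<le> a \<plusminus> r b\<close>.
\<close>

lemma two_point_norm:
  fixes x y :: "'x::real_normed_vector"
  assumes "1 \<le> q"
  defines "r \<equiv> 1 / 4 ^ (2 * q)"
  shows "(norm (x + r *\<^sub>R y) ^ (4 * q) + norm (x - r *\<^sub>R y) ^ (4 * q)) / 2
    \<le> ((norm (x + y) ^ (2 * q) + norm (x - y) ^ (2 * q)) / 2)\<^sup>2"
proof -
  define a b where "a = (norm (x + y) + norm (x - y)) / 2" and "b = (norm (x + y) - norm (x - y)) / 2"
  have r: "0 \<le> r" "r \<le> 1" by (auto simp: r_def)
  have ab: "\<bar>b\<bar> \<le> a"
    using norm_ge_zero[of "x + y"] norm_ge_zero[of "x - y"] unfolding a_def b_def by (simp add: abs_le_iff)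
  have d: "norm (x + r *\<^sub>R y) \<le> a + r * b"
  proof -
    have "x + r *\<^sub>R y = ((1 + r) / 2) *\<^sub>R (x + y) + ((1 - r) / 2) *\<^sub>R (x - y)"
    proof -
      have "((1 + r) / 2) *\<^sub>R (x + y) + ((1 - r) / 2) *\<^sub>R (x - y)
          = ((1 + r) / 2 + (1 - r) / 2) *\<^sub>R x + ((1 + r) / 2 - (1 - r) / 2) *\<^sub>R y"
        by (simp only: scaleR_add_right scaleR_diff_right scaleR_add_left scaleR_diff_left) simp
      also have "(1 + r) / 2 + (1 - r) / 2 = 1" by (simp add: field_simps)
      also have "(1 + r) / 2 - (1 - r) / 2 = r" by (simp add: field_simps)
      finally show ?thesis by simp
    qed
    then have "norm (x + r *\<^sub>R y) \<le> norm (((1 + r) / 2) *\<^sub>R (x + y)) + norm (((1 - r) / 2) *\<^sub>R (x - y))"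
      by (metis norm_triangle_ineq)
    also have "\<dots> = (1 + r) / 2 * norm (x + y) + (1 - r) / 2 * norm (x - y)"
      unfolding norm_scaleR using r by simp
    also have "\<dots> = a + r * b" by (simp add: a_def b_def field_simps)
    finally show ?thesis .
  qed
  have d': "norm (x - r *\<^sub>R y) \<le> a - r * b"
  proof -
    have "x - r *\<^sub>R y = ((1 - r) / 2) *\<^sub>R (x + y) + ((1 + r) / 2) *\<^sub>R (x - y)"
    proof -
      have "((1 - r) / 2) *\<^sub>R (x + y) + ((1 + r) / 2) *\<^sub>R (x - y)
          = ((1 - r) / 2 + (1 + r) / 2) *\<^sub>R x + ((1 - r) / 2 - (1 + r) / 2) *\<^sub>R y"
        by (simp only: scaleR_add_right scaleR_diff_right scaleR_add_left scaleR_diff_left) simp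
      also have "(1 - r) / 2 + (1 + r) / 2 = 1" by (simp add: field_simps)
      also have "(1 - r) / 2 - (1 + r) / 2 = -r" by (simp add: field_simps)
      finally show ?thesis by simp
    qed
    then have "norm (x - r *\<^sub>R y) \<le> norm (((1 - r) / 2) *\<^sub>R (x + y)) + norm (((1 + r) / 2) *\<^sub>R (x - y))"
      by (metis norm_triangle_ineq)
    also have "\<dots> = (1 - r) / 2 * norm (x + y) + (1 + r) / 2 * norm (x - y)"
      unfolding norm_scaleR using r by simp
    also have "\<dots> = a - r * b" by (simp add: a_def b_def field_simps)
    finally show ?thesis .
  qed
  have "(norm (x + r *\<^sub>R y) ^ (4 * q) + norm (x - r *\<^sub>R y) ^ (4 * q)) / 2
      \<le> ((a + r * b) ^ (4 * q) + (a - r * b) ^ (4 * q)) / 2"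
    using d d' by (intro divide_right_mono add_mono power_mono) auto
  also have "\<dots> \<le> (((a + b) ^ (2 * q) + (a - b) ^ (2 * q)) / 2)\<^sup>2"
    unfolding r_def by (rule two_point_scalar[OF ab assms(1)])
  also have "a + b = norm (x + y)" by (simp add: a_def b_def field_simps)
  also have "a - b = norm (x - y)" by (simp add: a_def b_def field_simps)
  finally show ?thesis .
qed

text \<open>
  Minkowski's inequality for the Euclidean norm on pairs, read as the triangle inequality for sums of
  complex numbers.
\<close>

lemma sign_mean_minkowski:
  assumes "finite J"
  shows "((sign_mean J F)\<^sup>2 + (sign_mean J G)\<^sup>2) / 2
    \<le> (sign_mean J (\<lambda>s. sqrt (((F s)\<^sup>2 + (G s)\<^sup>2) / 2)))\<^sup>2"
proof -
  have "sqrt ((\<Sum>s\<in>signs J. F s)\<^sup>2 + (\<Sum>s\<in>signs J. G s)\<^sup>2)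
      = cmod (\<Sum>s\<in>signs J. Complex (F s) (G s))"
    by (simp add: cmod_def)
  also have "\<dots> \<le> (\<Sum>s\<in>signs J. sqrt ((F s)\<^sup>2 + (G s)\<^sup>2))"
    by (rule order_trans[OF norm_sum]) (simp add: cmod_def)
  finally have "(\<Sum>s\<in>signs J. F s)\<^sup>2 + (\<Sum>s\<in>signs J. G s)\<^sup>2
      \<le> (\<Sum>s\<in>signs J. sqrt ((F s)\<^sup>2 + (G s)\<^sup>2))\<^sup>2"
    by (meson real_sqrt_le_iff sqrt_le_D)
  then have "((\<Sum>s\<in>signs J. F s)\<^sup>2 + (\<Sum>s\<in>signs J. G s)\<^sup>2) / (2 * (2 ^ card J)\<^sup>2)
      \<le> (\<Sum>s\<in>signs J. sqrt ((F s)\<^sup>2 + (G s)\<^sup>2))\<^sup>2 / (2 * (2 ^ card J)\<^sup>2)"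
    by (rule divide_right_mono) simp
  then show ?thesis
    unfolding sign_mean_def
    by (simp add: real_sqrt_divide power_divide power_mult_distrib mult.commute flip: sum_divide_distrib add_divide_distrib)
qed

text \<open>
  Damping all signs by \<open>r\<close> maps the \<open>L\<close> space of exponent \<open>2 * q\<close> contractively to that of exponent
  \<open>4 * q\<close>. One sign at a time, the two-point inequality does this; Minkowski's inequality, which
  exchanges the norm in the new sign with the mean over the old ones, makes the estimate tensorise. The
  base point \<open>x0\<close> carries the new sign through the induction.
\<close>

lemma hypercontractivity:
  fixes x :: "'i \<Rightarrow> 'x::real_normed_vector"
  assumes "finite J" "1 \<le> q"
  defines "r \<equiv> 1 / 4 ^ (2 * q)"
  shows "sign_mean J (\<lambda>s. norm (x0 + r *\<^sub>R (\<Sum>i\<in>J. s i *\<^sub>R x i)) ^ (4 * q))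
    \<le> (sign_mean J (\<lambda>s. norm (x0 + (\<Sum>i\<in>J. s i *\<^sub>R x i)) ^ (2 * q)))\<^sup>2"
  using assms(1)
proof (induction J arbitrary: x0 rule: finite_induct)
  case empty
  then show ?case by (simp add: sign_mean_def signs_def flip: power_mult)
next
  case (insert j J)
  let ?S = "\<lambda>s. \<Sum>i\<in>J. s i *\<^sub>R x i"
  \<comment> \<open>The induction hypothesis is used at the two base points that the sign of the new index \<open>j\<close> produces.\<close>
  let ?P = "\<lambda>s. norm (x0 + r *\<^sub>R x j + ?S s) ^ (2 * q)"
  let ?M = "\<lambda>s. norm (x0 - r *\<^sub>R x j + ?S s) ^ (2 * q)"
  have "sign_mean (insert j J) (\<lambda>s. norm (x0 + r *\<^sub>R (\<Sum>i\<in>insert j J. s i *\<^sub>R x i)) ^ (4 * q))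
      = (sign_mean J (\<lambda>s. norm ((x0 + r *\<^sub>R x j) + r *\<^sub>R ?S s) ^ (4 * q))
        + sign_mean J (\<lambda>s. norm ((x0 - r *\<^sub>R x j) + r *\<^sub>R ?S s) ^ (4 * q))) / 2"
    by (simp only: sign_mean_insert[OF insert.hyps(1,2)] sign_sum_insert[OF insert.hyps(1,2)])
      (simp add: algebra_simps)
  also have "\<dots> \<le> ((sign_mean J ?P)\<^sup>2 + (sign_mean J ?M)\<^sup>2) / 2"
    using insert.IH[of "x0 + r *\<^sub>R x j"] insert.IH[of "x0 - r *\<^sub>R x j"] by simp
  also have "\<dots> \<le> (sign_mean J (\<lambda>s. sqrt (((?P s)\<^sup>2 + (?M s)\<^sup>2) / 2)))\<^sup>2"
    by (rule sign_mean_minkowski[OF insert.hyps(1)])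
  also have "\<dots> \<le> (sign_mean J (\<lambda>s. (norm (x0 + x j + ?S s) ^ (2 * q)
      + norm (x0 - x j + ?S s) ^ (2 * q)) / 2))\<^sup>2"
  proof (intro power_mono sign_mean_mono sign_mean_nonneg)
    fix s
    have "((?P s)\<^sup>2 + (?M s)\<^sup>2) / 2 \<le>
        ((norm (x0 + x j + ?S s) ^ (2 * q) + norm (x0 - x j + ?S s) ^ (2 * q)) / 2)\<^sup>2"
      using two_point_norm[OF assms(2), of "x0 + ?S s" "x j"] unfolding r_def
      by (simp add: algebra_simps flip: power_mult)
    then show "sqrt (((?P s)\<^sup>2 + (?M s)\<^sup>2) / 2) \<le>
        (norm (x0 + x j + ?S s) ^ (2 * q) + norm (x0 - x j + ?S s) ^ (2 * q)) / 2"
      by (rule real_le_lsqrt[rotated 1]) auto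
  qed auto
  also have "sign_mean J (\<lambda>s. (norm (x0 + x j + ?S s) ^ (2 * q) + norm (x0 - x j + ?S s) ^ (2 * q)) / 2)
      = sign_mean (insert j J) (\<lambda>s. norm (x0 + (\<Sum>i\<in>insert j J. s i *\<^sub>R x i)) ^ (2 * q))"
    by (simp only: sign_mean_insert[OF insert.hyps(1,2)] sign_sum_insert[OF insert.hyps(1,2)])
      (simp add: sign_mean_def sum.distrib algebra_simps add_divide_distrib sum_divide_distrib)
  finally show ?case .
qed

text \<open>
  For a homogeneous sum, with base point \<open>0\<close>, the damping factor comes out of the norm.
\<close>

lemma moment_doubling:
  fixes x :: "'i \<Rightarrow> 'x::real_normed_vector"
  assumes "finite J" "1 \<le> q"
  shows "sign_mean J (\<lambda>s. norm (\<Sum>i\<in>J. s i *\<^sub>R x i) ^ (4 * q))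
    \<le> (4 ^ (2 * q)) ^ (4 * q) * (sign_mean J (\<lambda>s. norm (\<Sum>i\<in>J. s i *\<^sub>R x i) ^ (2 * q)))\<^sup>2"
proof -
  let ?r = "1 / 4 ^ (2 * q) :: real"
  have e: "norm (0 + ?r *\<^sub>R z) ^ (4 * q) = ?r ^ (4 * q) * norm z ^ (4 * q)" for z :: 'x
    by (simp only: add_0 norm_scaleR power_mult_distrib) simp
  have "sign_mean J (\<lambda>s. ?r ^ (4 * q) * norm (\<Sum>i\<in>J. s i *\<^sub>R x i) ^ (4 * q))
      \<le> (sign_mean J (\<lambda>s. norm (\<Sum>i\<in>J. s i *\<^sub>R x i) ^ (2 * q)))\<^sup>2"
    using hypercontractivity[OF assms, of 0 x, unfolded e] by (simp only: add_0)
  then show ?thesis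
    unfolding sign_mean_cmult by (simp add: field_simps)
qed

text \<open>
  Hypercontractivity starts at the second moment. The first moment is reached by the pointwise
  inequality \<open>n\<^sup>2 \<le> K n + n\<^sup>4 / K\<^sup>2\<close>, where \<open>K\<close> is so large that the fourth moment, bounded by the square of
  the second, uses up only half of the second moment.
\<close>

lemma second_moment_le_first:
  fixes x :: "'i \<Rightarrow> 'x::real_normed_vector"
  assumes "finite J"
  shows "sign_mean J (\<lambda>s. norm (\<Sum>i\<in>J. s i *\<^sub>R x i) ^ 2)
    \<le> 8 * 4 ^ 8 * (sign_mean J (\<lambda>s. norm (\<Sum>i\<in>J. s i *\<^sub>R x i)))\<^sup>2"
proof -
  define B :: real where "B = 4 ^ 8"
  let ?n = "\<lambda>s. norm (\<Sum>i\<in>J. s i *\<^sub>R x i)"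
  define e2 where "e2 = sign_mean J (\<lambda>s. ?n s ^ 2)"
  have e2: "0 \<le> e2" unfolding e2_def by (rule sign_mean_nonneg) simp
  have e4: "sign_mean J (\<lambda>s. ?n s ^ 4) \<le> B * e2\<^sup>2"
    using moment_doubling[OF assms, of 1 x] by (simp add: e2_def B_def)
  show ?thesis
  proof (cases "e2 = 0")
    case True
    then show ?thesis by (simp add: e2_def)
  next
    case False
    then have pos: "0 < e2" using e2 by simp
    have B: "0 < B" by (simp add: B_def)
    \<comment> \<open>With this \<open>K\<close> the fourth moment term is at most \<open>B * e2\<^sup>2 / K\<^sup>2 = e2 / 2\<close>.\<close>
    define K where "K = sqrt (2 * B * e2)"
    have K: "0 < K" "K\<^sup>2 = 2 * B * e2" using pos B by (auto simp: K_def)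
    have pt: "n\<^sup>2 \<le> K * n + (1 / K\<^sup>2) * n ^ 4" if n: "0 \<le> n" for n :: real
    proof (cases "n \<le> K")
      case True
      then have "n * n \<le> K * n" using n by (intro mult_right_mono) auto
      then show ?thesis by (simp add: power2_eq_square add_increasing2)
    next
      case False
      then have "K\<^sup>2 \<le> n\<^sup>2" using K by (intro power_mono) auto
      then have "K\<^sup>2 * n\<^sup>2 \<le> n\<^sup>2 * n\<^sup>2" by (intro mult_right_mono) auto
      then have "n\<^sup>2 \<le> n\<^sup>2 * n\<^sup>2 / K\<^sup>2" using K(1)
        by (simp add: pos_le_divide_eq mult.commute)
      then have "n\<^sup>2 \<le> (1 / K\<^sup>2) * n ^ 4"
        by (simp flip: power_add)
      moreover have "0 \<le> K * n" using K n by simp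
      ultimately show ?thesis by linarith
    qed
    have "e2 \<le> sign_mean J (\<lambda>s. K * ?n s + (1 / K\<^sup>2) * ?n s ^ 4)"
      unfolding e2_def by (intro sign_mean_mono pt) auto
    also have "\<dots> = K * sign_mean J ?n + (1 / K\<^sup>2) * sign_mean J (\<lambda>s. ?n s ^ 4)"
      by (simp only: sign_mean_add sign_mean_cmult)
    also have "\<dots> \<le> K * sign_mean J ?n + (1 / K\<^sup>2) * (B * e2\<^sup>2)"
      using e4 by (intro add_left_mono mult_left_mono) auto
    also have "(1 / K\<^sup>2) * (B * e2\<^sup>2) = e2 / 2"
      using K pos B by (simp add: K(2) power2_eq_square)
    finally have "e2 \<le> 2 * K * sign_mean J ?n" by simp
    then have "e2\<^sup>2 \<le> (2 * K * sign_mean J ?n)\<^sup>2" using e2 by (intro power_mono) auto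
    then have "e2 * e2 \<le> e2 * (8 * B * (sign_mean J ?n)\<^sup>2)"
      by (simp add: power_mult_distrib K(2) power2_eq_square[of e2] algebra_simps)
    then show ?thesis using pos by (simp add: e2_def B_def)
  qed
qed

lemma rad_nonneg: "0 \<le> rad p J x"
  unfolding rad_def by (rule sign_mean_nonneg) simp

lemma rad_1: "rad 1 J x = sign_mean J (\<lambda>s. norm (\<Sum>i\<in>J. s i *\<^sub>R x i))"
  unfolding rad_def by simp

lemma kahane_dyadic:
  "\<exists>B\<ge>0. \<forall>J (x :: 'i \<Rightarrow> 'x::real_normed_vector). finite J \<longrightarrow>
     sign_mean J (\<lambda>s. norm (\<Sum>i\<in>J. s i *\<^sub>R x i) ^ (2 ^ Suc k)) \<le> B * rad 1 J x ^ (2 ^ Suc k)"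
proof (induction k)
  case 0
  show ?case using second_moment_le_first
    by (intro exI[of _ "8 * 4 ^ 8"]) (auto simp: rad_1)
next
  case (Suc k)
  then obtain B where B: "B \<ge> 0" "\<And>J (x :: 'i \<Rightarrow> 'x). finite J \<Longrightarrow>
     sign_mean J (\<lambda>s. norm (\<Sum>i\<in>J. s i *\<^sub>R x i) ^ (2 ^ Suc k)) \<le> B * rad 1 J x ^ (2 ^ Suc k)"
    by blast
  define q :: nat where "q = 2 ^ k"
  have q: "1 \<le> q" "(2 ^ Suc k :: nat) = 2 * q" "(2 ^ Suc (Suc k) :: nat) = 4 * q" by (auto simp: q_def)
  define C :: real where "C = (4 ^ (2 * q)) ^ (4 * q)"
  show ?case
  proof (intro exI[of _ "C * B\<^sup>2"] conjI allI impI)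
    show "0 \<le> C * B\<^sup>2" by (simp add: C_def)
    fix J :: "'i set" and x :: "'i \<Rightarrow> 'x" assume J: "finite J"
    have "sign_mean J (\<lambda>s. norm (\<Sum>i\<in>J. s i *\<^sub>R x i) ^ (4 * q))
        \<le> C * (sign_mean J (\<lambda>s. norm (\<Sum>i\<in>J. s i *\<^sub>R x i) ^ (2 * q)))\<^sup>2"
      unfolding C_def by (rule moment_doubling[OF J q(1)])
    also have "\<dots> \<le> C * (B * rad 1 J x ^ (2 * q))\<^sup>2"
      using B(2)[OF J, of x, unfolded q(2)]
      by (intro mult_left_mono power_mono sign_mean_nonneg) (auto simp: C_def)
    also have "\<dots> = C * B\<^sup>2 * rad 1 J x ^ (4 * q)"
      by (simp add: power_mult_distrib flip: power_mult)
    finally show "sign_mean J (\<lambda>s. norm (\<Sum>i\<in>J. s i *\<^sub>R x i) ^ (2 ^ Suc (Suc k)))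
        \<le> C * B\<^sup>2 * rad 1 J x ^ (2 ^ Suc (Suc k))"
      unfolding q(3) .
  qed
qed

text \<open>
  Kahane's inequality. Normalise the first moment to \<open>1\<close> and compare \<open>t powr p\<close> with \<open>1 + t ^ N\<close>, where
  \<open>N \<ge> p\<close> is a power of \<open>2\<close>.
\<close>

theorem kahane:
  fixes p :: real
  assumes "1 \<le> p"
  shows "\<exists>K>0. \<forall>J (x :: 'i \<Rightarrow> 'x::real_normed_vector). finite J \<longrightarrow>
    rad p J x \<le> K * rad 1 J x powr p"
proof -
  obtain k :: nat where k: "p \<le> 2 ^ Suc k"
  proof -
    obtain k :: nat where "p < 2 ^ k" using real_arch_pow[of 2 p] by auto
    then have "p \<le> 2 ^ Suc k" using assms by simp
    then show ?thesis by (rule that)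
  qed
  define N :: nat where "N = 2 ^ Suc k"
  have N: "p \<le> real N" using k by (simp add: N_def)
  obtain B where B: "B \<ge> 0" "\<And>J (x :: 'i \<Rightarrow> 'x). finite J \<Longrightarrow>
     sign_mean J (\<lambda>s. norm (\<Sum>i\<in>J. s i *\<^sub>R x i) ^ N) \<le> B * rad 1 J x ^ N"
    using kahane_dyadic[of k, where 'i='i and 'x='x] unfolding N_def by blast
  show ?thesis
  proof (intro exI[of _ "1 + B"] conjI allI impI)
    show "0 < 1 + B" using B by simp
    fix J :: "'i set" and x :: "'i \<Rightarrow> 'x" assume J: "finite J"
    let ?n = "\<lambda>s. norm (\<Sum>i\<in>J. s i *\<^sub>R x i)"
    define e where "e = rad 1 J x"
    have e0: "0 \<le> e" by (simp add: e_def rad_nonneg)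
    show "rad p J x \<le> (1 + B) * rad 1 J x powr p"
    proof (cases "e = 0")
      case True
      then have "\<forall>s\<in>signs J. ?n s = 0"
        using J unfolding e_def rad_1 sign_mean_def by (simp add: sum_nonneg_eq_0_iff)
      then have "rad p J x = sign_mean J (\<lambda>_. 0)"
        unfolding rad_def by (intro sign_mean_cong) simp
      then show ?thesis using True B by (simp add: J)
    next
      case False
      then have e: "0 < e" using e0 by simp
      have pt: "n powr p \<le> e powr p * (1 + (1 / e ^ N) * n ^ N)" if n: "0 \<le> n" for n
      proof -
        define t where "t = n / e"
        have t: "0 \<le> t" "n = e * t" using n e by (auto simp: t_def)
        have "t powr p \<le> 1 + t ^ N"
        proof (cases "t \<le> 1")
          case True
          then have "t powr p \<le> 1" using t assms by (intro powr_le1) auto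
          moreover have "0 \<le> t ^ N" using t by simp
          ultimately show ?thesis by linarith
        next
          case False
          then have "t powr p \<le> t powr real N" using N by (intro powr_mono) auto
          also have "\<dots> = t ^ N" using False by (simp add: powr_realpow)
          finally show ?thesis by simp
        qed
        then have "e powr p * t powr p \<le> e powr p * (1 + t ^ N)" by (intro mult_left_mono) auto
        moreover have "n powr p = e powr p * t powr p" using t e by (simp add: powr_mult)
        moreover have "(1 / e ^ N) * n ^ N = t ^ N" using e by (simp add: t_def power_divide)
        ultimately show ?thesis by simp
      qed
      have "rad p J x \<le> sign_mean J (\<lambda>s. e powr p * (1 + (1 / e ^ N) * ?n s ^ N))"
        unfolding rad_def by (intro sign_mean_mono pt) auto
      also have "\<dots> = e powr p * (1 + (1 / e ^ N) * sign_mean J (\<lambda>s. ?n s ^ N))"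
        by (simp only: sign_mean_cmult sign_mean_add sign_mean_const[OF J])
      also have "\<dots> \<le> e powr p * (1 + (1 / e ^ N) * (B * e ^ N))"
        using B(2)[OF J, of x] e unfolding e_def[symmetric]
        by (intro mult_left_mono add_left_mono) auto
      also have "\<dots> = (1 + B) * e powr p" using e by simp
      finally show ?thesis by (simp add: e_def)
    qed
  qed
qed

text \<open>
  Jensen's inequality, from the tangent of \<open>n \<mapsto> n powr p\<close> at the mean.
\<close>

lemma rad_1_powr_le:
  fixes p :: real
  assumes "1 < p" "finite J"
  shows "rad 1 J x powr p \<le> rad p J x"
proof (cases "rad 1 J x = 0")
  case True
  then show ?thesis using assms by (simp add: rad_nonneg)
next
  case False
  define e where "e = rad 1 J x"
  have e: "0 < e" using False rad_nonneg[of 1 J x] by (simp add: e_def)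
  let ?n = "\<lambda>s. norm (\<Sum>i\<in>J. s i *\<^sub>R x i)"
  have pt: "e powr p * ((p / e) * n + (1 - p)) \<le> n powr p" if n: "0 \<le> n" for n
  proof -
    have "(n / e) * 1 \<le> (n / e) powr p / p + 1 powr (p / (p - 1)) / (p / (p - 1))"
      using assms n e by (intro Youngs_inequality) (auto simp: field_simps)
    then have "n / e \<le> ((n / e) powr p + (p - 1)) / p"
      by (simp add: add_divide_distrib)
    then have "p * (n / e) \<le> (n / e) powr p + (p - 1)"
      using assms by (simp only: pos_le_divide_eq mult.commute)
    then have "e powr p * (p * (n / e) - (p - 1)) \<le> e powr p * (n / e) powr p"
      by (intro mult_left_mono) auto
    also have "\<dots> = n powr p" using n e by (simp add: powr_divide)
    finally show ?thesis by (simp add: algebra_simps)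
  qed
  have "e powr p * ((p / e) * rad 1 J x + (1 - p)) = sign_mean J (\<lambda>s. e powr p * ((p / e) * ?n s + (1 - p)))"
    by (simp only: sign_mean_cmult sign_mean_add sign_mean_const[OF assms(2)] rad_1)
  also have "\<dots> \<le> rad p J x"
    unfolding rad_def by (intro sign_mean_mono pt) auto
  finally show ?thesis using e by (simp add: e_def[symmetric])
qed

section \<open>Khintchine's inequality\<close>

text \<open>
  Parallelogram law.
\<close>

lemma sign_mean_norm_square:
  fixes x :: "'i \<Rightarrow> 'x::real_inner"
  assumes "finite J"
  shows "sign_mean J (\<lambda>s. norm (x0 + (\<Sum>i\<in>J. s i *\<^sub>R x i)) ^ 2) = norm x0 ^ 2 + (\<Sum>i\<in>J. norm (x i) ^ 2)"
  using assms
proof (induction J arbitrary: x0 rule: finite_induct)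
  case empty
  then show ?case by (simp add: sign_mean_def signs_def)
next
  case (insert j J)
  have "sign_mean (insert j J) (\<lambda>s. norm (x0 + (\<Sum>i\<in>insert j J. s i *\<^sub>R x i)) ^ 2)
      = (sign_mean J (\<lambda>s. norm ((x0 + x j) + (\<Sum>i\<in>J. s i *\<^sub>R x i)) ^ 2)
        + sign_mean J (\<lambda>s. norm ((x0 - x j) + (\<Sum>i\<in>J. s i *\<^sub>R x i)) ^ 2)) / 2"
    by (simp only: sign_mean_insert[OF insert.hyps(1,2)] sign_sum_insert[OF insert.hyps(1,2)])
      (simp add: algebra_simps)
  also have "\<dots> = (norm (x0 + x j) ^ 2 + norm (x0 - x j) ^ 2) / 2 + (\<Sum>i\<in>J. norm (x i) ^ 2)"
    unfolding insert.IH by simp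
  also have "(norm (x0 + x j) ^ 2 + norm (x0 - x j) ^ 2) / 2 = norm x0 ^ 2 + norm (x j) ^ 2"
    by (simp add: power2_norm_eq_inner inner_add_left inner_add_right inner_diff_left inner_diff_right inner_commute)
  finally show ?case using insert.hyps by simp
qed

text \<open>
  In a Euclidean space the second moment is the square sum. Kahane's inequality then gives the nontrivial
  direction for all exponents, also for \<open>q < 2\<close>.
\<close>

theorem khintchine:
  fixes q :: real
  assumes "1 < q"
  shows "\<exists>K>0. \<forall>J (x :: 'i \<Rightarrow> 'k::euclidean_space). finite J \<longrightarrow>
    L2_set (\<lambda>i. norm (x i)) J powr q \<le> K * rad q J x"
proof (intro exI[of _ "sqrt (8 * 4 ^ 8) powr q"] conjI allI impI)
  fix J :: "'i set" and x :: "'i \<Rightarrow> 'k" assume J: "finite J"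
  have "(\<Sum>i\<in>J. norm (x i) ^ 2) \<le> 8 * 4 ^ 8 * rad 1 J x ^ 2"
    using second_moment_le_first[OF J, of x] sign_mean_norm_square[OF J, of 0 x] by (simp add: rad_1)
  then have "L2_set (\<lambda>i. norm (x i)) J \<le> sqrt (8 * 4 ^ 8) * rad 1 J x"
    unfolding L2_set_def using rad_nonneg[of 1 J x]
    by (metis abs_of_nonneg real_sqrt_abs real_sqrt_le_iff real_sqrt_mult)
  then have "L2_set (\<lambda>i. norm (x i)) J powr q \<le> (sqrt (8 * 4 ^ 8) * rad 1 J x) powr q"
    using assms by (intro powr_mono2) auto
  also have "\<dots> = sqrt (8 * 4 ^ 8) powr q * rad 1 J x powr q"
    using rad_nonneg[of 1 J x] by (simp add: powr_mult)
  also have "\<dots> \<le> sqrt (8 * 4 ^ 8) powr q * rad q J x"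
    using rad_1_powr_le[OF assms J, of x] by (intro mult_left_mono) auto
  finally show "L2_set (\<lambda>i. norm (x i)) J powr q \<le> sqrt (8 * 4 ^ 8) powr q * rad q J x" .
qed simp

section \<open>Moments of Rademacher sums\<close>

text \<open>
  Functions of finitely many signs are integrated by summing over the sign patterns. Almost surely each
  coordinate in \<open>J\<close> is \<open>1\<close> or \<open>-1\<close>, so that \<open>F\<close> may be replaced by a combination of indicators of
  cylinder sets.
\<close>

lemma nn_integral_random_signs:
  fixes F :: "('i \<Rightarrow> real) \<Rightarrow> real"
  assumes J: "finite J" "J \<subseteq> I" and F: "\<And>s. 0 \<le> F s"
  shows "(\<integral>\<^sup>+\<epsilon>. ennreal (F (restrict \<epsilon> J)) \<partial>random_signs I) = ennreal (sign_mean J F)"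
proof -
  let ?p = "pmf_of_set {-1, 1 :: real}"
  interpret product_prob_space "\<lambda>_::'i. measure_pmf ?p" I
    by unfold_locales
  let ?P = "PiM I (\<lambda>_::'i. measure_pmf ?p)"
  have ae: "AE \<epsilon> in ?P. \<forall>i\<in>J. \<epsilon> i \<in> {-1, 1}"
  proof (rule AE_finite_allI[OF J(1)])
    fix i assume "i \<in> J"
    then show "AE \<epsilon> in ?P. \<epsilon> i \<in> {-1, 1}"
      using J by (intro AE_PiM_component[of I "\<lambda>_. measure_pmf ?p"])
        (auto simp: AE_measure_pmf_iff set_pmf_of_set measure_pmf.prob_space_axioms)
  qed
  define A where "A s = {\<epsilon> \<in> space ?P. \<forall>i\<in>J. \<epsilon> i \<in> {s i}}" for s :: "'i \<Rightarrow> real"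
  have A: "A s \<in> sets ?P" for s
    unfolding A_def
  proof (intro sets.sets_Collect_finite_All J(1))
    fix i assume "i \<in> J"
    then have "(\<lambda>\<epsilon>. \<epsilon> i) -` {s i} \<inter> space ?P \<in> sets ?P"
      using J by (intro measurable_sets[OF measurable_component_singleton]) auto
    moreover have "(\<lambda>\<epsilon>. \<epsilon> i) -` {s i} \<inter> space ?P = {\<epsilon> \<in> space ?P. \<epsilon> i \<in> {s i}}" by auto
    ultimately show "{\<epsilon> \<in> space ?P. \<epsilon> i \<in> {s i}} \<in> sets ?P" by simp
  qed
  have eA: "emeasure ?P (A s) = ennreal (1 / 2 ^ card J)" if "s \<in> signs J" for s
  proof -
    have "emeasure ?P (A s) = (\<Prod>i\<in>J. emeasure (measure_pmf ?p) {s i})"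
      unfolding A_def using J by (intro emeasure_PiM_Collect) auto
    also have "\<dots> = (\<Prod>i\<in>J. ennreal (1 / 2))"
    proof (rule prod.cong)
      fix i assume "i \<in> J"
      then have "s i \<in> {-1, 1}" using that by (auto simp: signs_def)
      then show "emeasure (measure_pmf ?p) {s i} = ennreal (1 / 2)"
        by (auto simp: emeasure_pmf_single)
    qed simp
    also have "\<dots> = ennreal (1 / 2 ^ card J)"
      by (subst prod_constant, subst ennreal_power) (auto simp: power_one_over)
    finally show ?thesis .
  qed
  have "(\<integral>\<^sup>+\<epsilon>. ennreal (F (restrict \<epsilon> J)) \<partial>?P)
      = (\<integral>\<^sup>+\<epsilon>. (\<Sum>s\<in>signs J. ennreal (F s) * indicator (A s) \<epsilon>) \<partial>?P)"
  proof (rule nn_integral_cong_AE, use ae AE_space in eventually_elim)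
    fix \<epsilon> assume e: "\<forall>i\<in>J. \<epsilon> i \<in> {-1, 1}" "\<epsilon> \<in> space ?P"
    have r: "restrict \<epsilon> J \<in> signs J" using e by (auto simp: signs_def)
    have "(\<Sum>s\<in>signs J. ennreal (F s) * indicator (A s) \<epsilon>)
        = (\<Sum>s\<in>{restrict \<epsilon> J}. ennreal (F s) * indicator (A s) \<epsilon>)"
    proof (rule sum.mono_neutral_right)
      show "\<forall>s\<in>signs J - {restrict \<epsilon> J}. ennreal (F s) * indicator (A s) \<epsilon> = 0"
      proof
        fix s assume s: "s \<in> signs J - {restrict \<epsilon> J}"
        have "\<epsilon> \<notin> A s"
        proof
          assume "\<epsilon> \<in> A s"
          then have "s = restrict \<epsilon> J"
            using s by (intro ext) (auto simp: A_def signs_def PiE_def extensional_def restrict_def)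
          then show False using s by simp
        qed
        then show "ennreal (F s) * indicator (A s) \<epsilon> = 0" by simp
      qed
    qed (use r J in auto)
    also have "\<dots> = ennreal (F (restrict \<epsilon> J))" using e by (simp add: A_def)
    finally show "ennreal (F (restrict \<epsilon> J)) = (\<Sum>s\<in>signs J. ennreal (F s) * indicator (A s) \<epsilon>)" by simp
  qed
  also have "\<dots> = (\<Sum>s\<in>signs J. ennreal (F s) * emeasure ?P (A s))"
    using A by (subst nn_integral_sum) (auto intro!: sum.cong nn_integral_cmult_indicator)
  also have "\<dots> = (\<Sum>s\<in>signs J. ennreal (F s * (1 / 2 ^ card J)))"
    using F by (intro sum.cong refl) (simp add: eA flip: ennreal_mult)
  also have "\<dots> = ennreal (sign_mean J F)"
    using F by (subst sum_ennreal) (auto simp: sign_mean_def sum_divide_distrib)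
  finally show ?thesis unfolding random_signs_def .
qed

text \<open>
  Both sides are the integral of the same function over the same product measure.
\<close>

lemma sign_mean_restrict:
  assumes "finite J" "J' \<subseteq> J" "\<And>s. 0 \<le> F s"
  shows "sign_mean J (\<lambda>s. F (restrict s J')) = sign_mean J' F"
proof -
  have J': "finite J'" using assms finite_subset by blast
  have "ennreal (sign_mean J (\<lambda>s. F (restrict s J')))
      = (\<integral>\<^sup>+\<epsilon>. ennreal (F (restrict (restrict \<epsilon> J) J')) \<partial>random_signs J)"
    using assms by (subst nn_integral_random_signs[symmetric]) auto
  also have "\<dots> = (\<integral>\<^sup>+\<epsilon>. ennreal (F (restrict \<epsilon> J')) \<partial>random_signs J)"
    using assms(2) by (simp add: Int_absorb1)
  also have "\<dots> = ennreal (sign_mean J' F)"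
    using assms J' by (intro nn_integral_random_signs) auto
  finally show ?thesis
    using assms(3) by (simp add: sign_mean_nonneg)
qed

lemma nn_integral_rad:
  fixes x :: "'i \<Rightarrow> 'x::real_normed_vector"
  assumes "finite J" "J \<subseteq> I"
  shows "(\<integral>\<^sup>+\<epsilon>. ennreal (norm (\<Sum>i\<in>J. \<epsilon> i *\<^sub>R x i) powr p) \<partial>random_signs I) = ennreal (rad p J x)"
proof -
  have e: "(\<Sum>i\<in>J. restrict \<epsilon> J i *\<^sub>R x i) = (\<Sum>i\<in>J. \<epsilon> i *\<^sub>R x i)" for \<epsilon> :: "'i \<Rightarrow> real"
    by (rule sum.cong) auto
  then show ?thesis
    using nn_integral_random_signs[OF assms, of "\<lambda>s. norm (\<Sum>i\<in>J. s i *\<^sub>R x i) powr p", unfolded e]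
    by (simp add: rad_def)
qed

lemma rad_subset:
  fixes x :: "'i \<Rightarrow> 'x::real_normed_vector"
  assumes "finite J" "J' \<subseteq> J"
  shows "sign_mean J (\<lambda>s. norm (\<Sum>i\<in>J'. s i *\<^sub>R x i) powr p) = rad p J' x"
proof -
  have e: "(\<Sum>i\<in>J'. restrict s J' i *\<^sub>R x i) = (\<Sum>i\<in>J'. s i *\<^sub>R x i)" for s :: "'i \<Rightarrow> real"
    by (rule sum.cong) auto
  then show ?thesis
    using sign_mean_restrict[OF assms, of "\<lambda>s. norm (\<Sum>i\<in>J'. s i *\<^sub>R x i) powr p", unfolded e]
    by (simp add: rad_def)
qed

lemma rad_neutral:
  fixes x :: "'i \<Rightarrow> 'x::real_normed_vector"
  assumes "finite J" "J' \<subseteq> J" "\<And>i. i \<in> J - J' \<Longrightarrow> x i = 0"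
  shows "rad p J x = rad p J' x"
proof -
  have e: "(\<Sum>i\<in>J. s i *\<^sub>R x i) = (\<Sum>i\<in>J'. s i *\<^sub>R x i)" for s :: "'i \<Rightarrow> real"
    using assms by (intro sum.mono_neutral_right) auto
  have "rad p J x = sign_mean J (\<lambda>s. norm (\<Sum>i\<in>J'. s i *\<^sub>R x i) powr p)"
    unfolding rad_def e ..
  then show ?thesis
    using rad_subset[OF assms(1,2), of x p] by simp
qed

lemma rad_cong: "(\<And>i. i \<in> J \<Longrightarrow> x i = y i) \<Longrightarrow> rad p J x = rad p J y"
  unfolding rad_def by simp

lemma rad_reindex:
  assumes f: "bij_betw f J' J"
  shows "rad p J' (\<lambda>i. x (f i)) = rad p J x"
proof -
  let ?g = "the_inv_into J' f"
  have inj: "inj_on f J'" and im: "f ` J' = J" using f by (auto simp: bij_betw_def)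
  have g: "?g j \<in> J'" "f (?g j) = j" if "j \<in> J" for j
    using that im inj by (auto simp: f_the_inv_into_f the_inv_into_into)
  have gf: "?g (f i) = i" if "i \<in> J'" for i using inj that by (simp add: the_inv_into_f_f)
  have "(\<Sum>s\<in>signs J'. norm (\<Sum>i\<in>J'. s i *\<^sub>R x (f i)) powr p)
      = (\<Sum>s\<in>signs J. norm (\<Sum>i\<in>J. s i *\<^sub>R x i) powr p)"
  proof (rule sum.reindex_bij_witness[where i="\<lambda>s. \<lambda>i\<in>J'. s (f i)" and j="\<lambda>s. \<lambda>i\<in>J. s (?g i)"])
    fix s assume s: "s \<in> signs J'"
    show "(\<lambda>i\<in>J'. (\<lambda>i\<in>J. s (?g i)) (f i)) = s"
      using s im gf by (intro ext) (auto simp: signs_def PiE_def extensional_def)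
    show "(\<lambda>i\<in>J. s (?g i)) \<in> signs J"
      using s g by (auto simp: signs_def)
    have "(\<Sum>i\<in>J. (\<lambda>i\<in>J. s (?g i)) i *\<^sub>R x i) = (\<Sum>i\<in>J'. s i *\<^sub>R x (f i))"
      using gf im by (subst sum.reindex_bij_betw[OF f, symmetric]) (auto intro!: sum.cong)
    then show "norm (\<Sum>i\<in>J. (\<lambda>i\<in>J. s (?g i)) i *\<^sub>R x i) powr p = norm (\<Sum>i\<in>J'. s i *\<^sub>R x (f i)) powr p"
      by simp
  next
    fix s assume s: "s \<in> signs J"
    show "(\<lambda>i\<in>J. (\<lambda>i\<in>J'. s (f i)) (?g i)) = s"
      using s g by (intro ext) (auto simp: signs_def PiE_def extensional_def)
    show "(\<lambda>i\<in>J'. s (f i)) \<in> signs J'"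
      using s im by (auto simp: signs_def)
  qed
  then show ?thesis
    unfolding rad_def sign_mean_def using bij_betw_same_card[OF f] by simp
qed

lemma rad_1_sum_le:
  fixes x :: "'i \<Rightarrow> 'x::real_normed_vector"
  assumes "finite J"
  shows "rad 1 J x \<le> (\<Sum>Q\<in>g ` J. rad 1 {R\<in>J. g R = Q} x)"
proof -
  have "rad 1 J x \<le> sign_mean J (\<lambda>s. \<Sum>Q\<in>g ` J. norm (\<Sum>R | R \<in> J \<and> g R = Q. s R *\<^sub>R x R) powr 1)"
    unfolding rad_def
  proof (rule sign_mean_mono)
    fix s
    have "(\<Sum>i\<in>J. s i *\<^sub>R x i) = (\<Sum>Q\<in>g ` J. \<Sum>R | R \<in> J \<and> g R = Q. s R *\<^sub>R x R)"
      using sum.image_gen[OF assms] by simp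
    then show "norm (\<Sum>i\<in>J. s i *\<^sub>R x i) powr 1 \<le>
        (\<Sum>Q\<in>g ` J. norm (\<Sum>R | R \<in> J \<and> g R = Q. s R *\<^sub>R x R) powr 1)"
      by (simp add: norm_sum)
  qed
  also have "\<dots> = (\<Sum>Q\<in>g ` J. rad 1 {R\<in>J. g R = Q} x)"
    unfolding sign_mean_sum using assms by (intro sum.cong refl rad_subset) auto
  finally show ?thesis .
qed

lemma type_finite:
  assumes "rademacher_type TYPE('x::real_normed_vector) t"
  shows "\<exists>C\<ge>0. \<forall>J (x :: 'i \<Rightarrow> 'x). finite J \<longrightarrow> rad 1 J x powr t \<le> C * (\<Sum>i\<in>J. norm (x i) powr t)"
proof -
  from assms obtain C where t: "1 \<le> t" and C: "\<And>(N::nat) (x :: nat \<Rightarrow> 'x).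
        (\<integral>\<^sup>+\<epsilon>. ennreal (norm (\<Sum>k<N. \<epsilon> k *\<^sub>R x k)) \<partial>random_signs UNIV)
          \<le> ennreal (C * (\<Sum>k<N. norm (x k) powr t) powr (1 / t))"
    unfolding rademacher_type_def by blast
  show ?thesis
  proof (intro exI[of _ "max C 0 powr t"] conjI allI impI)
    fix J :: "'i set" and x :: "'i \<Rightarrow> 'x" assume J: "finite J"
    obtain f where f: "bij_betw f {..<card J} J"
      using ex_bij_betw_nat_finite[OF J] by (auto simp: atLeast0LessThan)
    let ?s = "\<Sum>i\<in>J. norm (x i) powr t"
    have s0: "0 \<le> ?s" by (intro sum_nonneg) auto
    have "ennreal (rad 1 J x) = (\<integral>\<^sup>+\<epsilon>. ennreal (norm (\<Sum>k<card J. \<epsilon> k *\<^sub>R x (f k))) \<partial>random_signs UNIV)"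
      using nn_integral_rad[of "{..<card J}" UNIV "\<lambda>k. x (f k)" 1] by (simp add: rad_reindex[OF f])
    also have "\<dots> \<le> ennreal (C * (\<Sum>k<card J. norm (x (f k)) powr t) powr (1 / t))" by (rule C)
    also have "(\<Sum>k<card J. norm (x (f k)) powr t) = ?s"
      by (rule sum.reindex_bij_betw[OF f])
    also have "ennreal (C * ?s powr (1 / t)) \<le> ennreal (max C 0 * ?s powr (1 / t))"
      by (intro ennreal_leI mult_right_mono) auto
    finally have "rad 1 J x \<le> max C 0 * ?s powr (1 / t)"
      by (subst (asm) ennreal_le_iff) auto
    then have "rad 1 J x powr t \<le> (max C 0 * ?s powr (1 / t)) powr t"
      using t by (intro powr_mono2) (auto simp: rad_nonneg)
    also have "\<dots> = max C 0 powr t * ?s"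
      using t s0 by (simp add: powr_mult powr_powr)
    finally show "rad 1 J x powr t \<le> max C 0 powr t * ?s" .
  qed simp
qed

text \<open>
  The sum over \<open>J\<close> has the same distribution as the sum whose blocks \<open>{R. g R = Q}\<close> are multiplied by
  further independent signs, since multiplying the signs in each block by a fixed one permutes the sign
  patterns. For fixed inner signs the outer signs form a Rademacher sum of the block sums, to which
  Kahane's inequality and the type inequality apply.
\<close>

lemma type_decoupling:
  assumes "rademacher_type TYPE('x::real_normed_vector) t"
  shows "\<exists>C\<ge>0. \<forall>J (x :: 'i \<Rightarrow> 'x) (g :: 'i \<Rightarrow> 'j). finite J \<longrightarrow>
    rad t J x \<le> C * (\<Sum>Q\<in>g ` J. rad t {R\<in>J. g R = Q} x)"
proof -
  have t: "1 \<le> t" using assms by (simp add: rademacher_type_def)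
  obtain K where K: "K > 0" "\<And>J (x :: 'j \<Rightarrow> 'x). finite J \<Longrightarrow> rad t J x \<le> K * rad 1 J x powr t"
    using kahane[OF t, where 'i='j and 'x='x] by blast
  obtain C where C: "C \<ge> 0" "\<And>J (x :: 'j \<Rightarrow> 'x). finite J \<Longrightarrow>
      rad 1 J x powr t \<le> C * (\<Sum>i\<in>J. norm (x i) powr t)"
    using type_finite[OF assms, where 'i='j] by blast
  show ?thesis
  proof (intro exI[of _ "K * C"] conjI allI impI)
    show "0 \<le> K * C" using K C by simp
    fix J :: "'i set" and x :: "'i \<Rightarrow> 'x" and g :: "'i \<Rightarrow> 'j" assume J: "finite J"
    define X where "X s Q = (\<Sum>R | R \<in> J \<and> g R = Q. s R *\<^sub>R x R)" for s Q
    \<comment> \<open>\<open>s'\<close> are the outer signs; the sign change \<open>?f\<close> below is an involution of the patterns on \<open>J\<close>.\<close>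
    have flip: "rad t J x = sign_mean J (\<lambda>s. norm (\<Sum>Q\<in>g ` J. s' Q *\<^sub>R X s Q) powr t)"
      if s': "s' \<in> signs (g ` J)" for s'
    proof -
      have s'1: "s' (g i) = 1 \<or> s' (g i) = -1" if "i \<in> J" for i
        using s' that by (auto simp: signs_def PiE_def Pi_def)
      have s'2: "s' (g i) * s' (g i) = 1" if "i \<in> J" for i using s'1[OF that] by auto
      let ?f = "\<lambda>s. \<lambda>i\<in>J. s' (g i) * s i"
      have f: "?f s \<in> signs J" "?f (?f s) = s" if "s \<in> signs J" for s
      proof -
        have "s' (g i) * s i \<in> {-1, 1}" if "i \<in> J" for i
          using s'1[OF that] \<open>s \<in> signs J\<close> that by (auto simp: signs_def PiE_def Pi_def)
        then show "?f s \<in> signs J" by (auto simp: signs_def)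
        show "?f (?f s) = s"
        proof
          fix i show "?f (?f s) i = s i"
            using \<open>s \<in> signs J\<close> s'2[of i]
            by (auto simp: signs_def PiE_def extensional_def mult.assoc[symmetric])
        qed
      qed
      have "(\<Sum>s\<in>signs J. norm (\<Sum>i\<in>J. s i *\<^sub>R x i) powr t)
        = (\<Sum>s\<in>signs J. norm (\<Sum>Q\<in>g ` J. s' Q *\<^sub>R X s Q) powr t)"
      proof (rule sum.reindex_bij_witness[where i="?f" and j="?f"])
        fix s assume s: "s \<in> signs J"
        have "(\<Sum>Q\<in>g ` J. s' Q *\<^sub>R X (?f s) Q) = (\<Sum>Q\<in>g ` J. \<Sum>R | R \<in> J \<and> g R = Q. s' (g R) *\<^sub>R (?f s R *\<^sub>R x R))"
          unfolding X_def by (intro sum.cong refl) (auto simp: scaleR_sum_right intro!: sum.cong)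
        also have "\<dots> = (\<Sum>R\<in>J. s' (g R) *\<^sub>R (?f s R *\<^sub>R x R))"
          using sum.image_gen[OF J, of "\<lambda>R. s' (g R) *\<^sub>R (?f s R *\<^sub>R x R)" g] by simp
        also have "\<dots> = (\<Sum>R\<in>J. s R *\<^sub>R x R)"
          using s'2 by (intro sum.cong refl) (simp add: mult.assoc[symmetric])
        finally show "norm (\<Sum>Q\<in>g ` J. s' Q *\<^sub>R X (?f s) Q) powr t = norm (\<Sum>i\<in>J. s i *\<^sub>R x i) powr t"
          by simp
      qed (use f in auto)
      then show ?thesis by (simp add: rad_def sign_mean_def)
    qed
    have "rad t J x = sign_mean (g ` J) (\<lambda>s'. rad t J x)" using J by simp
    also have "\<dots> = sign_mean (g ` J) (\<lambda>s'. sign_mean J (\<lambda>s. norm (\<Sum>Q\<in>g ` J. s' Q *\<^sub>R X s Q) powr t))"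
      using flip by (rule sign_mean_cong)
    also have "\<dots> = sign_mean J (\<lambda>s. rad t (g ` J) (X s))"
      by (subst sign_mean_swap) (simp add: rad_def)
    also have "\<dots> \<le> sign_mean J (\<lambda>s. K * (C * (\<Sum>Q\<in>g ` J. norm (X s Q) powr t)))"
    proof (rule sign_mean_mono)
      fix s
      have "rad t (g ` J) (X s) \<le> K * rad 1 (g ` J) (X s) powr t" using K J by auto
      also have "\<dots> \<le> K * (C * (\<Sum>Q\<in>g ` J. norm (X s Q) powr t))"
        using C(2)[of "g ` J" "X s"] K J by (intro mult_left_mono) auto
      finally show "rad t (g ` J) (X s) \<le> K * (C * (\<Sum>Q\<in>g ` J. norm (X s Q) powr t))" .
    qed
    also have "\<dots> = K * C * (\<Sum>Q\<in>g ` J. sign_mean J (\<lambda>s. norm (X s Q) powr t))"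
      by (simp only: sign_mean_cmult sign_mean_sum mult.assoc)
    also have "\<dots> = K * C * (\<Sum>Q\<in>g ` J. rad t {R\<in>J. g R = Q} x)"
      unfolding X_def using J by (intro arg_cong2[where f="(*)"] sum.cong refl rad_subset) auto
    finally show "rad t J x \<le> K * C * (\<Sum>Q\<in>g ` J. rad t {R\<in>J. g R = Q} x)" .
  qed
qed

section \<open>The strong Bochner integral\<close>

abbreviation vol :: "'a::euclidean_space set \<Rightarrow> real" where
  "vol \<equiv> measure lebesgue"

text \<open>
  Completeness of Lebesgue measure is what makes almost everywhere limits of simple functions
  measurable after composition with the norm.
\<close>

lemma borel_measurable_lebesgue_AE:
  fixes f g :: "'a::euclidean_space \<Rightarrow> real"
  assumes g: "g \<in> borel_measurable lebesgue" and ae: "AE x in lebesgue. f x = g x"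
  shows "f \<in> borel_measurable lebesgue"
proof -
  obtain N where N: "N \<in> null_sets lebesgue" "\<And>x. x \<notin> N \<Longrightarrow> f x = g x"
    using ae by (auto elim!: AE_E3)
  show ?thesis
  proof (rule measurableI)
    fix A :: "real set" assume A: "A \<in> sets borel"
    have "f -` A \<inter> space lebesgue = ((g -` A \<inter> space lebesgue) - N) \<union> (f -` A \<inter> N)"
      using N(2) by auto
    moreover have "g -` A \<inter> space lebesgue \<in> sets lebesgue" using g A by measurable
    moreover have "f -` A \<inter> N \<in> sets lebesgue"
      by (rule null_setsD2[OF null_sets_completion_subset[OF _ N(1)]]) auto
    ultimately show "f -` A \<inter> space lebesgue \<in> sets lebesgue"
      using null_setsD2[OF N(1)] by (metis sets.Diff sets.Un)
  qed simp
qed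

lemma borel_measurable_norm_diff:
  fixes f :: "'a::euclidean_space \<Rightarrow> 'x::real_normed_vector"
  assumes f: "strongly_measurable lebesgue f" and s: "simple_function lebesgue s"
  shows "(\<lambda>x. norm (f x - s x)) \<in> borel_measurable lebesgue"
proof -
  obtain t where t: "\<And>i::nat. simple_function lebesgue (t i)"
    and lim: "AE x in lebesgue. (\<lambda>i. t i x) \<longlonglongrightarrow> f x"
    using f unfolding strongly_measurable_def by blast
  obtain N where N: "N \<in> null_sets lebesgue" "\<And>x. x \<notin> N \<Longrightarrow> (\<lambda>i. t i x) \<longlonglongrightarrow> f x"
    using lim by (auto elim!: AE_E3)
  let ?g = "\<lambda>x. indicator (- N) x * norm (f x - s x)"
  have "?g \<in> borel_measurable lebesgue"
  proof (rule borel_measurable_LIMSEQ_real)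
    show "(\<lambda>i. indicator (- N) x * norm (t i x - s x)) \<longlonglongrightarrow> ?g x" for x
      using N(2)[of x] by (cases "x \<in> N") (auto intro!: tendsto_intros)
    fix i
    have "(\<lambda>x. norm (t i x - s x)) \<in> borel_measurable lebesgue"
      by (intro borel_measurable_simple_function simple_function_compose2[OF t s])
    then show "(\<lambda>x. indicator (- N) x * norm (t i x - s x)) \<in> borel_measurable lebesgue"
      using N(1) by (intro borel_measurable_times borel_measurable_indicator)
        (auto simp: Compl_in_sets_lebesgue)
  qed
  then show ?thesis
  proof (rule borel_measurable_lebesgue_AE)
    show "AE x in lebesgue. norm (f x - s x) = ?g x"
      using N(1) by (intro AE_I'[OF N(1)]) (auto simp: indicator_def)
  qed
qed

lemma borel_measurable_norm_strong:
  assumes "strongly_measurable lebesgue f"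
  shows "(\<lambda>x. norm (f x)) \<in> borel_measurable lebesgue"
  using borel_measurable_norm_diff[OF assms, of "\<lambda>_. 0"] by simp

lemma strongly_measurable_add:
  assumes "strongly_measurable M f" "strongly_measurable M g"
  shows "strongly_measurable M (\<lambda>x. f x + g x)"
proof -
  obtain s where s: "\<And>i::nat. simple_function M (s i)" "AE x in M. (\<lambda>i. s i x) \<longlonglongrightarrow> f x"
    using assms(1) unfolding strongly_measurable_def by blast
  obtain t where t: "\<And>i::nat. simple_function M (t i)" "AE x in M. (\<lambda>i. t i x) \<longlonglongrightarrow> g x"
    using assms(2) unfolding strongly_measurable_def by blast
  show ?thesis unfolding strongly_measurable_def
  proof (intro exI conjI allI)
    show "simple_function M (\<lambda>x. s i x + t i x)" for i
      by (rule simple_function_compose2[OF s(1) t(1)])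
    show "AE x in M. (\<lambda>i. s i x + t i x) \<longlonglongrightarrow> f x + g x"
      using s(2) t(2) by eventually_elim (rule tendsto_add)
  qed
qed

lemma strongly_measurable_simple: "simple_function M f \<Longrightarrow> strongly_measurable M f"
  unfolding strongly_measurable_def by (intro exI[of _ "\<lambda>_. f"]) simp

lemma strongly_measurable_indicator:
  fixes f :: "'a \<Rightarrow> 'x::real_normed_vector"
  assumes "strongly_measurable M f" "A \<in> sets M"
  shows "strongly_measurable M (\<lambda>x. indicator A x *\<^sub>R f x)"
proof -
  obtain s where s: "\<And>i::nat. simple_function M (s i)" "AE x in M. (\<lambda>i. s i x) \<longlonglongrightarrow> f x"
    using assms(1) unfolding strongly_measurable_def by blast
  show ?thesis unfolding strongly_measurable_def
  proof (intro exI conjI allI)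
    show "simple_function M (\<lambda>x. (indicator A x :: real) *\<^sub>R s i x)" for i
      by (rule simple_function_compose2[OF simple_function_indicator[OF assms(2)] s(1)])
    show "AE x in M. (\<lambda>i. indicator A x *\<^sub>R s i x) \<longlonglongrightarrow> indicator A x *\<^sub>R f x"
      using s(2) by eventually_elim (intro tendsto_intros)
  qed
qed

text \<open>
  This estimate is the source of uniqueness and existence of the integral, and of its norm bound: the
  integrals of simple functions that approximate \<open>f\<close> in mean are a Cauchy sequence.
\<close>

lemma simple_bochner_integral_close:
  fixes f :: "'a::euclidean_space \<Rightarrow> 'x::real_normed_vector"
  assumes f: "strongly_measurable lebesgue f"
    and s: "Bochner_Integration.simple_bochner_integrable lebesgue s"
    and t: "Bochner_Integration.simple_bochner_integrable lebesgue t"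
  shows "ennreal (norm (Bochner_Integration.simple_bochner_integral lebesgue s
            - Bochner_Integration.simple_bochner_integral lebesgue t))
    \<le> (\<integral>\<^sup>+x. ennreal (norm (f x - s x)) \<partial>lebesgue) + (\<integral>\<^sup>+x. ennreal (norm (f x - t x)) \<partial>lebesgue)"
    (is "ennreal (norm (?I s - ?I t)) \<le> _")
proof -
  have ss: "simple_function lebesgue s" "simple_function lebesgue t"
    using s t by (auto elim: simple_bochner_integrable.cases)
  have "ennreal (norm (?I s - ?I t)) = norm (?I (\<lambda>x. s x - t x))"
    using s t by (subst simple_bochner_integral_diff) auto
  also have "\<dots> \<le> Bochner_Integration.simple_bochner_integral lebesgue (\<lambda>x. norm (s x - t x))"
    using simple_bochner_integrable_compose2[of "(-)" lebesgue "s" "t"] s t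
    by (auto intro!: simple_bochner_integral_norm_bound)
  also have "\<dots> = (\<integral>\<^sup>+x. norm (s x - t x) \<partial>lebesgue)"
    using simple_bochner_integrable_compose2[of "\<lambda>x y. norm (x - y)" lebesgue "s" "t"] s t
    by (auto intro!: simple_bochner_integral_eq_nn_integral)
  also have "\<dots> \<le> (\<integral>\<^sup>+x. ennreal (norm (f x - s x)) + ennreal (norm (f x - t x)) \<partial>lebesgue)"
  proof (rule nn_integral_mono)
    fix x
    have "norm (s x - t x) \<le> norm (f x - s x) + norm (f x - t x)"
      by (metis dual_order.refl norm_diff_triangle_le norm_minus_commute)
    then show "ennreal (norm (s x - t x)) \<le> ennreal (norm (f x - s x)) + ennreal (norm (f x - t x))"
      by (simp add: ennreal_leI flip: ennreal_plus)
  qed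
  also have "\<dots> = (\<integral>\<^sup>+x. ennreal (norm (f x - s x)) \<partial>lebesgue) + (\<integral>\<^sup>+x. ennreal (norm (f x - t x)) \<partial>lebesgue)"
    using borel_measurable_norm_diff[OF f] ss by (intro nn_integral_add) auto
  finally show ?thesis .
qed

lemma has_strong_bochner_integral_unique:
  fixes f :: "'a::euclidean_space \<Rightarrow> 'x::real_normed_vector"
  assumes "has_strong_bochner_integral lebesgue f I" "has_strong_bochner_integral lebesgue f J"
  shows "I = J"
proof -
  let ?I = "Bochner_Integration.simple_bochner_integral lebesgue :: ('a \<Rightarrow> 'x) \<Rightarrow> 'x"
  have f: "strongly_measurable lebesgue f" using assms(1) by (simp add: has_strong_bochner_integral_def)
  obtain s where s: "\<And>i::nat. Bochner_Integration.simple_bochner_integrable lebesgue (s i)"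
      "(\<lambda>i. \<integral>\<^sup>+x. ennreal (norm (f x - s i x)) \<partial>lebesgue) \<longlonglongrightarrow> 0" "(\<lambda>i. ?I (s i)) \<longlonglongrightarrow> I"
    using assms(1) unfolding has_strong_bochner_integral_def by blast
  obtain t where t: "\<And>i::nat. Bochner_Integration.simple_bochner_integrable lebesgue (t i)"
      "(\<lambda>i. \<integral>\<^sup>+x. ennreal (norm (f x - t i x)) \<partial>lebesgue) \<longlonglongrightarrow> 0" "(\<lambda>i. ?I (t i)) \<longlonglongrightarrow> J"
    using assms(2) unfolding has_strong_bochner_integral_def by blast
  have "(\<lambda>i. ennreal (norm (?I (s i) - ?I (t i)))) \<longlonglongrightarrow> ennreal (norm (I - J))"
    by (intro tendsto_intros s t)
  moreover have "(\<lambda>i. (\<integral>\<^sup>+x. ennreal (norm (f x - s i x)) \<partial>lebesgue)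
      + (\<integral>\<^sup>+x. ennreal (norm (f x - t i x)) \<partial>lebesgue)) \<longlonglongrightarrow> 0 + 0"
    by (intro tendsto_add s t)
  ultimately have "ennreal (norm (I - J)) \<le> 0 + 0"
    by (rule LIMSEQ_le) (use simple_bochner_integral_close[OF f s(1) t(1)] in auto)
  then show ?thesis by simp
qed

lemma strong_bochner_integral_eq:
  fixes f :: "'a::euclidean_space \<Rightarrow> 'x::real_normed_vector"
  assumes "has_strong_bochner_integral lebesgue f I"
  shows "strong_bochner_integral lebesgue f = I"
  unfolding strong_bochner_integral_def
proof (rule the_equality)
  show "has_strong_bochner_integral lebesgue f I" by (rule assms)
  show "J = I" if "has_strong_bochner_integral lebesgue f J" for J
    using that assms by (rule has_strong_bochner_integral_unique)
qed

text \<open>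
  A pointwise approximation by simple functions is made dominated by setting an approximant to \<open>0\<close>
  wherever its norm exceeds \<open>2 * norm (f x)\<close>; this cannot happen in the limit where \<open>f x \<noteq> 0\<close>, and it
  forces the value \<open>0\<close> where \<open>f x = 0\<close>.
\<close>

lemma has_strong_bochner_integral_exists:
  fixes f :: "'a::euclidean_space \<Rightarrow> 'x::banach"
  assumes f: "strongly_measurable lebesgue f"
    and fin: "(\<integral>\<^sup>+x. ennreal (norm (f x)) \<partial>lebesgue) < \<infinity>"
  shows "\<exists>I. has_strong_bochner_integral lebesgue f I"
proof -
  let ?I = "Bochner_Integration.simple_bochner_integral lebesgue :: ('a \<Rightarrow> 'x) \<Rightarrow> 'x"
  obtain t where t: "\<And>i::nat. simple_function lebesgue (t i)"
    and lim: "AE x in lebesgue. (\<lambda>i. t i x) \<longlonglongrightarrow> f x"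
    using f unfolding strongly_measurable_def by blast
  note nf = borel_measurable_norm_strong[OF f]
  have nt: "(\<lambda>x. norm (t i x)) \<in> borel_measurable lebesgue" for i
    by (intro borel_measurable_simple_function simple_function_compose1[OF t])
  define A where "A i = {x \<in> space lebesgue. norm (t i x) \<le> 2 * norm (f x)}" for i
  have A: "A i \<in> sets lebesgue" for i
    unfolding A_def using nf nt by measurable
  define s where "s i x = (indicator (A i) x :: real) *\<^sub>R t i x" for i x
  have ss: "simple_function lebesgue (s i)" for i
    unfolding s_def by (rule simple_function_compose2[OF simple_function_indicator[OF A] t])
  have sn: "norm (s i x) \<le> 2 * norm (f x)" for i x
    by (auto simp: s_def A_def indicator_def)
  have slim: "AE x in lebesgue. (\<lambda>i. s i x) \<longlonglongrightarrow> f x"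
    using lim
  proof eventually_elim
    fix x assume x: "(\<lambda>i. t i x) \<longlonglongrightarrow> f x"
    show "(\<lambda>i. s i x) \<longlonglongrightarrow> f x"
    proof (cases "f x = 0")
      case True
      then have "s i x = 0" for i using sn[of i x] by simp
      then show ?thesis using True by simp
    next
      case False
      then have "norm (f x) < 2 * norm (f x)" by simp
      from order_tendstoD(2)[OF tendsto_norm[OF x] this]
      have "eventually (\<lambda>i. t i x = s i x) sequentially"
        by eventually_elim (simp add: s_def A_def)
      then show ?thesis using x by (rule Lim_transform_eventually[rotated])
    qed
  qed
  have s: "Bochner_Integration.simple_bochner_integrable lebesgue (s i)" for i
  proof (rule simple_bochner_integrableI_bounded[OF ss])
    have "(\<integral>\<^sup>+x. ennreal (norm (s i x)) \<partial>lebesgue) \<le> (\<integral>\<^sup>+x. ennreal 2 * ennreal (norm (f x)) \<partial>lebesgue)"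
      using sn by (intro nn_integral_mono) (subst ennreal_mult[symmetric], auto intro: ennreal_leI)
    also have "\<dots> = 2 * (\<integral>\<^sup>+x. ennreal (norm (f x)) \<partial>lebesgue)"
      using nf by (subst nn_integral_cmult) auto
    also have "\<dots> < \<infinity>" using fin by (simp add: ennreal_mult_less_top)
    finally show "(\<integral>\<^sup>+x. ennreal (norm (s i x)) \<partial>lebesgue) < \<infinity>" .
  qed
  have conv: "(\<lambda>i. \<integral>\<^sup>+x. ennreal (norm (f x - s i x)) \<partial>lebesgue) \<longlonglongrightarrow> 0"
  proof -
    have "(\<lambda>i. \<integral>\<^sup>+x. ennreal (norm (f x - s i x)) \<partial>lebesgue) \<longlonglongrightarrow> (\<integral>\<^sup>+x. 0 \<partial>(lebesgue :: 'a measure))"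
    proof (rule nn_integral_dominated_convergence[where w="\<lambda>x. ennreal 3 * ennreal (norm (f x))"])
      show "(\<lambda>x. ennreal (norm (f x - s j x))) \<in> borel_measurable lebesgue" for j
        using borel_measurable_norm_diff[OF f ss] by measurable
      show "(\<lambda>x. ennreal 3 * ennreal (norm (f x))) \<in> borel_measurable lebesgue" using nf by measurable
      show "AE x in lebesgue. ennreal (norm (f x - s j x)) \<le> ennreal 3 * ennreal (norm (f x))" for j
      proof (rule AE_I2)
        fix x
        have "norm (f x - s j x) \<le> 3 * norm (f x)"
          using sn[of j x] norm_triangle_ineq4[of "f x" "s j x"] by simp
        then show "ennreal (norm (f x - s j x)) \<le> ennreal 3 * ennreal (norm (f x))"
          by (subst ennreal_mult[symmetric]) (auto intro: ennreal_leI)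
      qed
      have "(\<integral>\<^sup>+x. ennreal 3 * ennreal (norm (f x)) \<partial>lebesgue) = ennreal 3 * (\<integral>\<^sup>+x. ennreal (norm (f x)) \<partial>lebesgue)"
        by (rule nn_integral_cmult) (use nf in measurable)
      then show "(\<integral>\<^sup>+x. ennreal 3 * ennreal (norm (f x)) \<partial>lebesgue) < \<infinity>"
        using fin by (simp add: ennreal_mult_less_top)
      show "AE x in lebesgue. (\<lambda>i. ennreal (norm (f x - s i x))) \<longlonglongrightarrow> 0"
        using slim
      proof eventually_elim
        fix x assume "(\<lambda>i. s i x) \<longlonglongrightarrow> f x"
        then have "(\<lambda>i. ennreal (norm (f x - s i x))) \<longlonglongrightarrow> ennreal (norm (f x - f x))"
          by (intro tendsto_ennrealI tendsto_intros)
        then show "(\<lambda>i. ennreal (norm (f x - s i x))) \<longlonglongrightarrow> 0" by simp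
      qed
    qed simp
    then show ?thesis by simp
  qed
  have "Cauchy (\<lambda>i. ?I (s i))"
  proof (rule metric_CauchyI)
    fix e :: real assume e: "0 < e"
    have "eventually (\<lambda>i. (\<integral>\<^sup>+x. ennreal (norm (f x - s i x)) \<partial>lebesgue) < ennreal (e / 2)) sequentially"
      using e by (intro order_tendstoD(2)[OF conv]) simp
    then obtain n where n: "\<And>i. i \<ge> n \<Longrightarrow> (\<integral>\<^sup>+x. ennreal (norm (f x - s i x)) \<partial>lebesgue) < ennreal (e / 2)"
      by (auto simp: eventually_sequentially)
    show "\<exists>M. \<forall>m\<ge>M. \<forall>k\<ge>M. dist (?I (s m)) (?I (s k)) < e"
    proof (intro exI allI impI)
      fix m k assume "n \<le> m" "n \<le> k"
      have "ennreal (norm (?I (s m) - ?I (s k))) < ennreal (e / 2) + ennreal (e / 2)"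
        by (rule le_less_trans[OF simple_bochner_integral_close[OF f s s]])
          (intro add_strict_mono n \<open>n \<le> m\<close> \<open>n \<le> k\<close>)
      then show "dist (?I (s m)) (?I (s k)) < e"
        using e by (simp add: dist_norm ennreal_less_iff flip: ennreal_plus)
    qed
  qed
  then obtain I where "(\<lambda>i. ?I (s i)) \<longlonglongrightarrow> I"
    using convergent_eq_Cauchy by (auto simp: Cauchy_convergent_iff convergent_def)
  then show ?thesis
    using f s conv unfolding has_strong_bochner_integral_def by blast
qed

lemma has_strong_bochner_integral_norm_bound:
  fixes f :: "'a::euclidean_space \<Rightarrow> 'x::real_normed_vector"
  assumes "has_strong_bochner_integral lebesgue f I"
  shows "ennreal (norm I) \<le> (\<integral>\<^sup>+x. ennreal (norm (f x)) \<partial>lebesgue)"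
proof -
  let ?I = "Bochner_Integration.simple_bochner_integral lebesgue :: ('a \<Rightarrow> 'x) \<Rightarrow> 'x"
  let ?F = "\<integral>\<^sup>+x. ennreal (norm (f x)) \<partial>lebesgue"
  have f: "strongly_measurable lebesgue f" using assms(1) by (simp add: has_strong_bochner_integral_def)
  obtain s where s: "\<And>i::nat. Bochner_Integration.simple_bochner_integrable lebesgue (s i)"
      "(\<lambda>i. \<integral>\<^sup>+x. ennreal (norm (f x - s i x)) \<partial>lebesgue) \<longlonglongrightarrow> 0" "(\<lambda>i. ?I (s i)) \<longlonglongrightarrow> I"
    using assms(1) unfolding has_strong_bochner_integral_def by blast
  have z: "Bochner_Integration.simple_bochner_integrable lebesgue (\<lambda>_::'a. 0::'x)"
    by (rule simple_bochner_integrable.intros) auto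
  have z0: "?I (\<lambda>_. 0) = 0" by (simp add: simple_bochner_integral_def)
  have b: "ennreal (norm (?I (s i))) \<le> (\<integral>\<^sup>+x. ennreal (norm (f x - s i x)) \<partial>lebesgue) + ?F" for i
    using simple_bochner_integral_close[OF f s(1) z, of i] by (simp add: z0)
  have "(\<lambda>i. ennreal (norm (?I (s i)))) \<longlonglongrightarrow> ennreal (norm I)"
    by (intro tendsto_intros s)
  moreover have "(\<lambda>i. (\<integral>\<^sup>+x. ennreal (norm (f x - s i x)) \<partial>lebesgue) + ?F) \<longlonglongrightarrow> 0 + ?F"
    by (intro tendsto_add s tendsto_const)
  ultimately have "ennreal (norm I) \<le> 0 + ?F"
    by (rule LIMSEQ_le) (use b in auto)
  then show ?thesis by simp
qed

lemma has_strong_bochner_integral_add: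
  fixes f g :: "'a::euclidean_space \<Rightarrow> 'x::real_normed_vector"
  assumes "has_strong_bochner_integral lebesgue f I" "has_strong_bochner_integral lebesgue g J"
  shows "has_strong_bochner_integral lebesgue (\<lambda>x. f x + g x) (I + J)"
proof -
  let ?I = "Bochner_Integration.simple_bochner_integral lebesgue :: ('a \<Rightarrow> 'x) \<Rightarrow> 'x"
  have f: "strongly_measurable lebesgue f" using assms(1) by (simp add: has_strong_bochner_integral_def)
  have g: "strongly_measurable lebesgue g" using assms(2) by (simp add: has_strong_bochner_integral_def)
  obtain s where s: "\<And>i::nat. Bochner_Integration.simple_bochner_integrable lebesgue (s i)"
      "(\<lambda>i. \<integral>\<^sup>+x. ennreal (norm (f x - s i x)) \<partial>lebesgue) \<longlonglongrightarrow> 0" "(\<lambda>i. ?I (s i)) \<longlonglongrightarrow> I"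
    using assms(1) unfolding has_strong_bochner_integral_def by blast
  obtain t where t: "\<And>i::nat. Bochner_Integration.simple_bochner_integrable lebesgue (t i)"
      "(\<lambda>i. \<integral>\<^sup>+x. ennreal (norm (g x - t i x)) \<partial>lebesgue) \<longlonglongrightarrow> 0" "(\<lambda>i. ?I (t i)) \<longlonglongrightarrow> J"
    using assms(2) unfolding has_strong_bochner_integral_def by blast
  have ss: "simple_function lebesgue (s i)" "simple_function lebesgue (t i)" for i
    using s(1)[of i] t(1)[of i] by (auto elim: simple_bochner_integrable.cases)
  show ?thesis
    unfolding has_strong_bochner_integral_def
  proof (intro conjI exI allI)
    show "strongly_measurable lebesgue (\<lambda>x. f x + g x)" by (rule strongly_measurable_add[OF f g])
    show "Bochner_Integration.simple_bochner_integrable lebesgue (\<lambda>x. s i x + t i x)" for i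
      by (rule simple_bochner_integrable_compose2[OF _ s(1) t(1)]) simp
    have "(\<lambda>i. ?I (s i) + ?I (t i)) \<longlonglongrightarrow> I + J" by (intro tendsto_intros s t)
    then show "(\<lambda>i. ?I (\<lambda>x. s i x + t i x)) \<longlonglongrightarrow> I + J"
      using simple_bochner_integral_add[OF s(1) t(1)] by simp
    have b: "(\<integral>\<^sup>+x. ennreal (norm (f x + g x - (s i x + t i x))) \<partial>lebesgue) \<le>
        (\<integral>\<^sup>+x. ennreal (norm (f x - s i x)) \<partial>lebesgue) + (\<integral>\<^sup>+x. ennreal (norm (g x - t i x)) \<partial>lebesgue)" for i
    proof -
      have "(\<integral>\<^sup>+x. ennreal (norm (f x + g x - (s i x + t i x))) \<partial>lebesgue) \<le>
          (\<integral>\<^sup>+x. ennreal (norm (f x - s i x)) + ennreal (norm (g x - t i x)) \<partial>lebesgue)"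
      proof (rule nn_integral_mono)
        fix x
        have "norm (f x + g x - (s i x + t i x)) \<le> norm (f x - s i x) + norm (g x - t i x)"
          by (rule norm_diff_triangle_ineq)
        then show "ennreal (norm (f x + g x - (s i x + t i x))) \<le> ennreal (norm (f x - s i x)) + ennreal (norm (g x - t i x))"
          by (simp add: ennreal_leI flip: ennreal_plus)
      qed
      also have "\<dots> = (\<integral>\<^sup>+x. ennreal (norm (f x - s i x)) \<partial>lebesgue) + (\<integral>\<^sup>+x. ennreal (norm (g x - t i x)) \<partial>lebesgue)"
        using borel_measurable_norm_diff[OF f ss(1)] borel_measurable_norm_diff[OF g ss(2)]
        by (intro nn_integral_add) auto
      finally show ?thesis .
    qed
    have "(\<lambda>i. (\<integral>\<^sup>+x. ennreal (norm (f x - s i x)) \<partial>lebesgue)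
        + (\<integral>\<^sup>+x. ennreal (norm (g x - t i x)) \<partial>lebesgue)) \<longlonglongrightarrow> 0 + 0"
      by (intro tendsto_add s t)
    then have lim0: "(\<lambda>i. (\<integral>\<^sup>+x. ennreal (norm (f x - s i x)) \<partial>lebesgue)
        + (\<integral>\<^sup>+x. ennreal (norm (g x - t i x)) \<partial>lebesgue)) \<longlonglongrightarrow> 0"
      by (simp only: add_0)
    show "(\<lambda>i. \<integral>\<^sup>+x. ennreal (norm (f x + g x - (s i x + t i x))) \<partial>lebesgue) \<longlonglongrightarrow> 0"
      by (intro tendsto_sandwich[OF _ _ tendsto_const lim0] always_eventually allI b) simp
  qed
qed

lemma has_strong_bochner_integral_indicator:
  fixes c :: "'x::real_normed_vector"
  assumes A: "A \<in> sets lebesgue" "emeasure lebesgue A < \<infinity>"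
  shows "has_strong_bochner_integral lebesgue (\<lambda>x::'a::euclidean_space. indicator A x *\<^sub>R c) (vol A *\<^sub>R c)"
proof -
  let ?i = "indicator A :: 'a \<Rightarrow> real"
  have ind: "Bochner_Integration.simple_bochner_integrable lebesgue ?i"
    using A by (intro simple_bochner_integrable.intros simple_function_indicator) (auto simp: indicator_def)
  have "ennreal (Bochner_Integration.simple_bochner_integral lebesgue ?i) = (\<integral>\<^sup>+x. ennreal (?i x) \<partial>lebesgue)"
    using ind by (rule simple_bochner_integral_eq_nn_integral) simp
  also have "\<dots> = (\<integral>\<^sup>+x. indicator A x \<partial>lebesgue)"
    by (intro nn_integral_cong) (simp add: indicator_def)
  also have "\<dots> = ennreal (vol A)"
    unfolding nn_integral_indicator[OF A(1)] using A(2) by (intro emeasure_eq_ennreal_measure) simp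
  finally have e: "Bochner_Integration.simple_bochner_integral lebesgue ?i = vol A"
    by (simp add: simple_bochner_integral_nonneg)
  have lin: "linear (\<lambda>r::real. r *\<^sub>R c)" by (intro linearI) (auto simp: scaleR_add_left)
  have s: "simple_function lebesgue (\<lambda>x. ?i x *\<^sub>R c)"
    by (rule simple_function_compose1[OF simple_function_indicator[OF A(1)]])
  have i: "Bochner_Integration.simple_bochner_integrable lebesgue (\<lambda>x. ?i x *\<^sub>R c)"
    using simple_bochner_integrable_compose2[OF _ ind ind, of "\<lambda>r _. r *\<^sub>R c"] by simp
  have I: "Bochner_Integration.simple_bochner_integral lebesgue (\<lambda>x. ?i x *\<^sub>R c) = vol A *\<^sub>R c"
    using simple_bochner_integral_linear[OF lin ind] unfolding e .
  show ?thesis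
    unfolding has_strong_bochner_integral_def
  proof (intro conjI exI[of _ "\<lambda>_ x. ?i x *\<^sub>R c"] allI i strongly_measurable_simple[OF s])
    show "(\<lambda>i. Bochner_Integration.simple_bochner_integral lebesgue (\<lambda>x. ?i x *\<^sub>R c))
        \<longlonglongrightarrow> vol A *\<^sub>R c"
      unfolding I by (rule tendsto_const)
    show "(\<lambda>i. \<integral>\<^sup>+x. ennreal (norm (?i x *\<^sub>R c - ?i x *\<^sub>R c)) \<partial>lebesgue) \<longlonglongrightarrow> 0" by simp
  qed
qed

lemma has_strong_bochner_integral_zero:
  "has_strong_bochner_integral lebesgue (\<lambda>x::'a::euclidean_space. 0 :: 'x::real_normed_vector) 0"
  using has_strong_bochner_integral_indicator[of "{} :: 'a set" "0::'x"] by simp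

lemma has_strong_bochner_integral_sum:
  fixes f :: "'i \<Rightarrow> 'a::euclidean_space \<Rightarrow> 'x::real_normed_vector"
  assumes "finite G" "\<And>P. P \<in> G \<Longrightarrow> has_strong_bochner_integral lebesgue (f P) (I P)"
  shows "has_strong_bochner_integral lebesgue (\<lambda>x. \<Sum>P\<in>G. f P x) (\<Sum>P\<in>G. I P)"
  using assms by (induction G rule: finite_induct)
    (auto intro: has_strong_bochner_integral_zero has_strong_bochner_integral_add)

section \<open>Integrals over sets and of step functions\<close>

definition bochner_on :: "'a::euclidean_space set \<Rightarrow> ('a \<Rightarrow> 'x::real_normed_vector) \<Rightarrow> 'x" where
  "bochner_on A u = strong_bochner_integral lebesgue (\<lambda>x. indicator A x *\<^sub>R u x)"

lemma average_bochner_on: "average R u = (1 / vol R) *\<^sub>R bochner_on R u"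
  by (simp add: average_def bochner_on_def)

lemma nn_integral_indicator_norm:
  fixes u :: "'a \<Rightarrow> 'x::real_normed_vector"
  shows "(\<integral>\<^sup>+x. ennreal (norm (indicator A x *\<^sub>R u x)) \<partial>M) = (\<integral>\<^sup>+x\<in>A. ennreal (norm (u x)) \<partial>M)"
  by (intro nn_integral_cong) (simp add: indicator_def)

lemma has_bochner_on:
  fixes u :: "'a::euclidean_space \<Rightarrow> 'x::banach"
  assumes "strongly_measurable lebesgue u" "A \<in> sets lebesgue"
    "(\<integral>\<^sup>+x\<in>A. ennreal (norm (u x)) \<partial>lebesgue) < \<infinity>"
  shows "has_strong_bochner_integral lebesgue (\<lambda>x. indicator A x *\<^sub>R u x) (bochner_on A u)"
proof -
  obtain I where I: "has_strong_bochner_integral lebesgue (\<lambda>x. indicator A x *\<^sub>R u x) I"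
    using has_strong_bochner_integral_exists[OF strongly_measurable_indicator[OF assms(1,2)]] assms(3)
    unfolding nn_integral_indicator_norm by blast
  then show ?thesis unfolding bochner_on_def strong_bochner_integral_eq[OF I] .
qed

lemma bochner_on_norm_bound:
  fixes u :: "'a::euclidean_space \<Rightarrow> 'x::banach"
  assumes "strongly_measurable lebesgue u" "A \<in> sets lebesgue"
    "(\<integral>\<^sup>+x\<in>A. ennreal (norm (u x)) \<partial>lebesgue) < \<infinity>"
  shows "ennreal (norm (bochner_on A u)) \<le> (\<integral>\<^sup>+x\<in>A. ennreal (norm (u x)) \<partial>lebesgue)"
  using has_strong_bochner_integral_norm_bound[OF has_bochner_on[OF assms]]
  unfolding nn_integral_indicator_norm .

lemma indicator_disjoint_Union:
  assumes "finite G" "disjoint G"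
  shows "(indicator (\<Union>G) x :: real) = (\<Sum>P\<in>G. indicator P x)"
  using indicator_UN_disjoint[of G "\<lambda>P. P" x] assms
  by (simp add: disjoint_family_on_def disjoint_def)

lemma bochner_on_Union:
  fixes u :: "'a::euclidean_space \<Rightarrow> 'x::banach"
  assumes u: "strongly_measurable lebesgue u" and G: "finite G" "disjoint G" "G \<subseteq> sets lebesgue"
    and fin: "(\<integral>\<^sup>+x\<in>\<Union>G. ennreal (norm (u x)) \<partial>lebesgue) < \<infinity>"
  shows "bochner_on (\<Union>G) u = (\<Sum>P\<in>G. bochner_on P u)"
proof -
  have "has_strong_bochner_integral lebesgue (\<lambda>x. indicator P x *\<^sub>R u x) (bochner_on P u)" if P: "P \<in> G" for P
  proof (rule has_bochner_on[OF u])
    have "(\<integral>\<^sup>+x\<in>P. ennreal (norm (u x)) \<partial>lebesgue) \<le> (\<integral>\<^sup>+x\<in>\<Union>G. ennreal (norm (u x)) \<partial>lebesgue)"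
      using P by (intro nn_integral_mono) (auto simp: indicator_def)
    then show "(\<integral>\<^sup>+x\<in>P. ennreal (norm (u x)) \<partial>lebesgue) < \<infinity>" using fin by (rule le_less_trans)
  qed (use P G in auto)
  then have "has_strong_bochner_integral lebesgue (\<lambda>x. \<Sum>P\<in>G. indicator P x *\<^sub>R u x) (\<Sum>P\<in>G. bochner_on P u)"
    by (rule has_strong_bochner_integral_sum[OF G(1)])
  moreover have "(\<lambda>x. \<Sum>P\<in>G. indicator P x *\<^sub>R u x) = (\<lambda>x. indicator (\<Union>G) x *\<^sub>R u x)"
    using G by (simp add: indicator_disjoint_Union scaleR_sum_left)
  ultimately show ?thesis
    unfolding bochner_on_def[of "\<Union>G"] by (simp add: strong_bochner_integral_eq)
qed

lemma bochner_on_step_function: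
  fixes a :: "'a::euclidean_space set \<Rightarrow> 'x::real_normed_vector"
  assumes G: "finite G" "G \<subseteq> sets lebesgue" "\<And>P. P \<in> G \<Longrightarrow> emeasure lebesgue P < \<infinity>"
    and R: "R \<in> sets lebesgue"
  shows "bochner_on R (\<lambda>x. \<Sum>P\<in>G. indicator P x *\<^sub>R a P) = (\<Sum>P\<in>G. vol (R \<inter> P) *\<^sub>R a P)"
proof -
  have "has_strong_bochner_integral lebesgue (\<lambda>x. \<Sum>P\<in>G. indicator (R \<inter> P) x *\<^sub>R a P)
      (\<Sum>P\<in>G. vol (R \<inter> P) *\<^sub>R a P)"
  proof (rule has_strong_bochner_integral_sum[OF G(1)], rule has_strong_bochner_integral_indicator)
    fix P assume P: "P \<in> G"
    have "emeasure lebesgue (R \<inter> P) \<le> emeasure lebesgue P"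
      using P G by (intro emeasure_mono) auto
    then show "emeasure lebesgue (R \<inter> P) < \<infinity>" using G(3)[OF P] by (rule le_less_trans)
    show "R \<inter> P \<in> sets lebesgue" using P G R by auto
  qed
  moreover have "(\<lambda>x. \<Sum>P\<in>G. indicator (R \<inter> P) x *\<^sub>R a P) = (\<lambda>x. indicator R x *\<^sub>R (\<Sum>P\<in>G. indicator P x *\<^sub>R a P))"
    by (simp add: scaleR_sum_right indicator_inter_arith)
  ultimately show ?thesis
    unfolding bochner_on_def by (simp add: strong_bochner_integral_eq)
qed

section \<open>Dyadic cubes\<close>

text \<open>
  The dyadic cube of side length \<open>2 powi k\<close> that contains \<open>x\<close>. Describing cubes by the integer parts of
  rescaled coordinates turns nestedness into the fact that an integer part determines the integer part
  of the quotient by a power of \<open>2\<close>.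
\<close>

definition cell :: "int \<Rightarrow> real ^ 'n::finite \<Rightarrow> (real ^ 'n) set" where
  "cell k x = {y. \<forall>i. \<lfloor>y $ i / 2 powi k\<rfloor> = \<lfloor>x $ i / 2 powi k\<rfloor>}"

lemma dyadic_cubes_at_eq_range_cell: "dyadic_cubes_at k = range (cell k :: real ^ 'n::finite \<Rightarrow> _)"
proof -
  have eq: "(\<lambda>x. (2 powi k) *\<^sub>R (x + (\<chi> i. of_int (m $ i)))) ` {x. \<forall>i. 0 \<le> x $ i \<and> x $ i < 1}
      = {y :: real ^ 'n. \<forall>i. \<lfloor>y $ i / 2 powi k\<rfloor> = m $ i}" (is "?f ` ?U = ?V") for m :: "int ^ 'n"
  proof
    show "?f ` ?U \<subseteq> ?V"
      by (auto simp: floor_eq_iff)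
    show "?V \<subseteq> ?f ` ?U"
    proof
      fix y assume y: "y \<in> ?V"
      let ?x = "\<chi> i. y $ i / 2 powi k - of_int (m $ i)"
      have "y = ?f ?x" by (simp add: vec_eq_iff)
      moreover have "?x \<in> ?U"
      proof (simp, intro allI)
        fix i
        from y have "\<lfloor>y $ i / 2 powi k\<rfloor> = m $ i" by simp
        then show "of_int (m $ i) \<le> y $ i / 2 powi k \<and> y $ i / 2 powi k - of_int (m $ i) < 1"
          unfolding floor_eq_iff by linarith
      qed
      ultimately show "y \<in> ?f ` ?U" by (rule image_eqI)
    qed
  qed
  show ?thesis
  proof
    show "dyadic_cubes_at k \<subseteq> range (cell k :: real ^ 'n \<Rightarrow> _)"
    proof
      fix Q :: "(real ^ 'n) set" assume "Q \<in> dyadic_cubes_at k"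
      then obtain m :: "int ^ 'n" where Q: "Q = {y :: real ^ 'n. \<forall>i. \<lfloor>y $ i / 2 powi k\<rfloor> = m $ i}"
        unfolding dyadic_cubes_at_def eq by blast
      have "Q = cell k (\<chi> i. 2 powi k * of_int (m $ i))"
        unfolding Q cell_def by simp
      then show "Q \<in> range (cell k)" by blast
    qed
    show "range (cell k :: real ^ 'n \<Rightarrow> _) \<subseteq> dyadic_cubes_at k"
    proof
      fix Q assume "Q \<in> range (cell k :: real ^ 'n \<Rightarrow> _)"
      then obtain x :: "real ^ 'n" where Q: "Q = cell k x" by blast
      have "Q = {y. \<forall>i. \<lfloor>y $ i / 2 powi k\<rfloor> = (\<chi> i. \<lfloor>x $ i / 2 powi k\<rfloor>) $ i}"
        by (simp add: Q cell_def)
      then show "Q \<in> dyadic_cubes_at k"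
        unfolding dyadic_cubes_at_def eq by blast
    qed
  qed
qed

lemma dyadic_cubesE:
  assumes "R \<in> dyadic_cubes"
  obtains k x where "R = cell k x"
  using assms by (auto simp: dyadic_cubes_def dyadic_cubes_at_eq_range_cell)

lemma cell_in_dyadic_cubes [simp]: "cell k x \<in> dyadic_cubes"
  by (auto simp: dyadic_cubes_def dyadic_cubes_at_eq_range_cell)

lemma self_in_cell [simp]: "x \<in> cell k x"
  by (simp add: cell_def)

lemma cell_eq: "y \<in> cell k x \<Longrightarrow> cell k y = cell k x"
  by (simp add: cell_def)

lemma cell_mono:
  fixes x :: "real ^ 'n::finite"
  assumes "j \<le> k"
  shows "cell j x \<subseteq> cell k x"
proof
  fix y assume y: "y \<in> cell j x"
  define d where "d = nat (k - j)"
  have k: "(2::real) powi k = 2 powi j * real_of_int (2 ^ d)"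
    using assms by (simp add: d_def flip: power_int_add power_int_of_nat)
  have "\<lfloor>z / 2 powi k\<rfloor> = \<lfloor>z / 2 powi j\<rfloor> div 2 ^ d" for z :: real
    using floor_divide_real_eq_div[of "2 ^ d" "z / 2 powi j"] by (simp add: k)
  then show "y \<in> cell k x" using y by (simp add: cell_def)
qed

lemma dyadic_cubes_nested:
  assumes "R \<in> dyadic_cubes" "Q \<in> dyadic_cubes" "z \<in> R" "z \<in> Q"
  shows "R \<subseteq> Q \<or> Q \<subseteq> R"
proof -
  obtain j x where R: "R = cell j x" using assms(1) by (rule dyadic_cubesE)
  obtain k y where Q: "Q = cell k y" using assms(2) by (rule dyadic_cubesE)
  have "R = cell j z" "Q = cell k z" using assms R Q by (metis cell_eq)+
  then show ?thesis using cell_mono[of j k z] cell_mono[of k j z] by (cases "j \<le> k") auto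
qed

lemma dyadic_cubes_nonempty: "Q \<in> dyadic_cubes \<Longrightarrow> Q \<noteq> {}"
  using self_in_cell by (metis dyadic_cubesE empty_iff)

lemma sets_cell: "cell k (x :: real ^ 'n::finite) \<in> sets lebesgue"
proof -
  have "cell k x = (\<Inter>i\<in>UNIV. {y. \<lfloor>y $ i / 2 powi k\<rfloor> = \<lfloor>x $ i / 2 powi k\<rfloor>})"
    by (auto simp: cell_def)
  also have "\<dots> \<in> sets borel"
  proof (rule sets.finite_INT)
    fix i :: 'n
    have "{y :: real ^ 'n. \<lfloor>y $ i / 2 powi k\<rfloor> = \<lfloor>x $ i / 2 powi k\<rfloor>}
      = {y. of_int \<lfloor>x $ i / 2 powi k\<rfloor> * 2 powi k \<le> y $ i} \<inter> {y. y $ i < (of_int \<lfloor>x $ i / 2 powi k\<rfloor> + 1) * 2 powi k}"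
      by (auto simp: floor_eq_iff field_simps)
    also have "\<dots> \<in> sets borel"
      by (intro sets.Int borel_closed borel_open closed_Collect_le open_Collect_less continuous_intros)
    finally show "{y :: real ^ 'n. \<lfloor>y $ i / 2 powi k\<rfloor> = \<lfloor>x $ i / 2 powi k\<rfloor>} \<in> sets borel" .
  qed auto
  finally show ?thesis by (simp add: sets_completionI_sets)
qed

lemma emeasure_cell:
  "emeasure lebesgue (cell k (x :: real ^ 'n::finite)) = ennreal ((2 powi k) ^ CARD('n))"
proof -
  define a b :: "real ^ 'n" where "a = (\<chi> i. of_int \<lfloor>x $ i / 2 powi k\<rfloor> * 2 powi k)"
    and "b = (\<chi> i. (of_int \<lfloor>x $ i / 2 powi k\<rfloor> + 1) * 2 powi k)"
  have ab: "b $ i - a $ i = 2 powi k" for i by (simp add: a_def b_def algebra_simps)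
  have le: "a $ i \<le> b $ i" for i using ab[of i] zero_le_power_int[of "2::real" k] by linarith
  have 1: "box a b \<subseteq> cell k x" "cell k x \<subseteq> cbox a b"
    by (auto simp: cell_def mem_box_cart a_def b_def floor_eq_iff field_simps less_imp_le)
  have le': "a \<bullet> i \<le> b \<bullet> i" if "i \<in> Basis" for i
    using that le by (auto simp: Basis_vec_def inner_axis)
  have m: "emeasure lborel (cbox a b) = ennreal ((2 powi k) ^ CARD('n))"
  proof -
    have "cbox a b \<noteq> {}" using le by (simp add: interval_ne_empty_cart)
    then have "measure lborel (cbox a b) = (2 powi k) ^ CARD('n)"
      by (subst content_cbox_cart) (auto simp: ab)
    then show ?thesis
      by (metis emeasure_eq_ennreal_measure emeasure_lborel_cbox_finite infinity_ennreal_def order_less_irrefl)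
  qed
  have m': "emeasure lborel (box a b) = emeasure lborel (cbox a b)"
    using le' by simp
  show ?thesis
  proof (rule antisym)
    have "emeasure lebesgue (cell k x) \<le> emeasure lebesgue (cbox a b)"
      by (rule emeasure_mono[OF 1(2)]) simp
    then show "emeasure lebesgue (cell k x) \<le> ennreal ((2 powi k) ^ CARD('n))"
      using m by simp
    have "emeasure lebesgue (box a b) \<le> emeasure lebesgue (cell k x)"
      by (rule emeasure_mono[OF 1(1) sets_cell])
    then show "ennreal ((2 powi k) ^ CARD('n)) \<le> emeasure lebesgue (cell k x)"
      using m m' by simp
  qed
qed

lemma measure_cell: "vol (cell k (x :: real ^ 'n::finite)) = (2 powi k) ^ CARD('n)"
  by (simp add: measure_def emeasure_cell)

lemma sets_dyadic: "Q \<in> dyadic_cubes \<Longrightarrow> Q \<in> sets lebesgue"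
  by (metis dyadic_cubesE sets_cell)

lemma measure_dyadic_pos: "Q \<in> dyadic_cubes \<Longrightarrow> 0 < vol Q"
  by (erule dyadic_cubesE) (simp add: measure_cell)

lemma emeasure_dyadic: "Q \<in> dyadic_cubes \<Longrightarrow> emeasure lebesgue Q = ennreal (vol Q)"
  by (erule dyadic_cubesE) (simp add: measure_cell emeasure_cell)

lemma fmeasurable_dyadic: "Q \<in> dyadic_cubes \<Longrightarrow> Q \<in> fmeasurable lebesgue"
  by (intro fmeasurableI sets_dyadic) (auto simp: emeasure_dyadic)

text \<open>
  Volume determines the level of a cube.
\<close>

lemma cell_level_mono:
  assumes "cell j (x :: real ^ 'n::finite) \<subseteq> cell k y"
  shows "j \<le> k"
proof (rule ccontr)
  assume "\<not> j \<le> k"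
  then have "(2::real) powi k < 2 powi j" by (simp add: power_int_strict_increasing)
  then have "((2::real) powi k) ^ CARD('n) < (2 powi j) ^ CARD('n)"
    by (intro power_strict_mono) auto
  moreover have "vol (cell j x) \<le> vol (cell k y)"
    by (intro measure_mono_fmeasurable assms sets_cell fmeasurable_dyadic) auto
  ultimately show False unfolding measure_cell by linarith
qed

lemma measure_cell_Suc:
  "vol (cell (k + 1) (x :: real ^ 'n::finite)) = 2 ^ CARD('n) * vol (cell k x)"
  by (simp add: measure_cell power_int_add power_mult_distrib)

text \<open>
  Disjoint cubes of equal positive volume fit into \<open>Q\<close> only finitely often.
\<close>

lemma finite_subcells:
  assumes "Q \<in> dyadic_cubes"
  shows "finite {R :: (real ^ 'n::finite) set. R \<in> dyadic_cubes_at j \<and> R \<subseteq> Q}" (is "finite ?S")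
proof (rule ccontr)
  assume inf: "infinite ?S"
  define m where "m = ((2::real) powi j) ^ CARD('n)"
  have m: "0 < m" by (simp add: m_def)
  obtain N :: nat where N: "vol Q < real N * m"
    using reals_Archimedean3[OF m] by blast
  obtain B where B: "B \<subseteq> ?S" "finite B" "card B = N"
    using infinite_arbitrarily_large[OF inf] by metis
  have mB: "R \<in> fmeasurable lebesgue" "vol R = m" if "R \<in> B" for R
    using that B(1) by (auto simp: dyadic_cubes_at_eq_range_cell measure_cell m_def fmeasurable_dyadic)
  have "disjoint B"
  proof (rule pairwiseI)
    fix R R' assume RR: "R \<in> B" "R' \<in> B" "R \<noteq> R'"
    obtain x where x: "R = cell j x"
      using RR(1) B(1) by (auto simp: dyadic_cubes_at_eq_range_cell)
    obtain y where y: "R' = cell j y"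
      using RR(2) B(1) by (auto simp: dyadic_cubes_at_eq_range_cell)
    show "disjnt R R'"
    proof (rule ccontr)
      assume "\<not> disjnt R R'"
      then obtain z where "z \<in> cell j x" "z \<in> cell j y" by (auto simp: disjnt_def x y)
      then show False using RR(3) cell_eq[of z j x] cell_eq[of z j y] by (simp add: x y)
    qed
  qed
  then have "vol (\<Union>B) = (\<Sum>R\<in>B. vol R)"
    using B(2) mB(1) by (intro measure_Union')
  then have "real N * m = vol (\<Union>B)" using mB B(3) by simp
  also have "\<dots> \<le> vol Q"
  proof (rule measure_mono_fmeasurable)
    show "\<Union>B \<subseteq> Q" using B(1) by blast
    show "\<Union>B \<in> sets lebesgue" using B(2) mB(1) by (intro sets.finite_Union) (auto dest: fmeasurableD)
    show "Q \<in> fmeasurable lebesgue" by (rule fmeasurable_dyadic[OF assms])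
  qed
  finally show False using N by simp
qed

lemma maximal_disjoint_dyadic:
  assumes "finite F" "F \<subseteq> dyadic_cubes"
  obtains G where "G \<subseteq> F" "disjoint G" "\<Union>G = \<Union>F"
proof -
  define G where "G = {R \<in> F. \<forall>Q\<in>F. \<not> R \<subset> Q}"
  show thesis
  proof (rule that[of G])
    show "G \<subseteq> F" by (auto simp: G_def)
    show "disjoint G"
    proof (rule pairwiseI)
      fix R R' assume RR: "R \<in> G" "R' \<in> G" "R \<noteq> R'"
      show "disjnt R R'"
      proof (rule ccontr)
        assume "\<not> disjnt R R'"
        then obtain z where "z \<in> R" "z \<in> R'" by (auto simp: disjnt_def)
        then have "R \<subseteq> R' \<or> R' \<subseteq> R"
          using RR assms(2) by (intro dyadic_cubes_nested[of R R' z]) (auto simp: G_def)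
        then show False using RR by (auto simp: G_def)
      qed
    qed
    show "\<Union>G = \<Union>F"
    proof
      show "\<Union>F \<subseteq> \<Union>G"
      proof
        fix x assume "x \<in> \<Union>F"
        then have "finite {R\<in>F. x \<in> R}" "{R\<in>F. x \<in> R} \<noteq> {}" using assms by auto
        from finite_has_maximal[OF this] obtain R where R: "R \<in> {R\<in>F. x \<in> R}"
          and max: "\<forall>Q\<in>{R\<in>F. x \<in> R}. R \<subseteq> Q \<longrightarrow> R = Q" ..
        have "\<not> R \<subset> Q" if "Q \<in> F" for Q
          using max R that by auto
        then have "R \<in> G" using R unfolding G_def by simp
        then show "x \<in> \<Union>G" using R by blast
      qed
    qed (auto simp: G_def)
  qed
qed

text \<open>
  The partition consists of the maximal heavy cubes and of those cubes of the finest level \<open>j\<close> that lie in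
  no heavy cube. A maximal heavy cube is not \<open>Q\<close>, so its parent lies in \<open>Q\<close> and is not heavy, and this
  bounds the mean over the cube. A cube of level at least \<open>j\<close> that lies in no heavy member is a union of
  members, which is why averages over it survive the conditional expectation.
\<close>

lemma calderon_zygmund_partition:
  fixes H :: "(real ^ 'n::finite) set \<Rightarrow> bool"
  assumes Q: "Q = cell k z" and jk: "j \<le> k" and HQ: "\<not> H Q"
  obtains G where "finite G" "G \<subseteq> dyadic_cubes" "disjoint G" "\<Union>G = Q"
    "\<forall>P\<in>G. \<not> H P \<or> (\<exists>P'\<in>dyadic_cubes. \<not> H P' \<and> P \<subseteq> P' \<and> P' \<subseteq> Q
        \<and> vol P' = 2 ^ CARD('n) * vol P)"
    "\<forall>i x. j \<le> i \<and> cell i x \<subseteq> Q \<and> \<not> (\<exists>P\<in>G. H P \<and> cell i x \<subseteq> P) \<longrightarrow>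
        (\<forall>P\<in>G. P \<subseteq> cell i x \<or> P \<inter> cell i x = {})"
proof -
  define D where "D = {cell i x | i x. j \<le> i \<and> i \<le> k \<and> x \<in> Q}"
  have D_Q: "P \<subseteq> Q" if "P \<in> D" for P
    using that cell_mono cell_eq unfolding D_def Q by blast
  have D_dyadic: "D \<subseteq> dyadic_cubes" by (auto simp: D_def)
  have "finite D"
  proof (rule finite_subset)
    show "D \<subseteq> (\<Union>i\<in>{j..k}. {R. R \<in> dyadic_cubes_at i \<and> R \<subseteq> Q})"
      using D_Q by (fastforce simp: D_def dyadic_cubes_at_eq_range_cell)
    show "finite (\<Union>i\<in>{j..k}. {R :: (real ^ 'n) set. R \<in> dyadic_cubes_at i \<and> R \<subseteq> Q})"
      using finite_subcells[of Q] by (simp add: Q)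
  qed
  define G1 where "G1 = {P \<in> D. H P \<and> (\<forall>P'\<in>D. P \<subset> P' \<longrightarrow> \<not> H P')}"
  define G2 where "G2 = {P \<in> D \<inter> range (cell j). \<forall>P'\<in>D. P \<subseteq> P' \<longrightarrow> \<not> H P'}"
  have heavy_max: "\<exists>P'\<in>G1. P \<subseteq> P'" if P: "P \<in> D" "H P" for P
  proof -
    let ?A = "{P' \<in> D. H P' \<and> P \<subseteq> P'}"
    have "finite ?A" "?A \<noteq> {}" using \<open>finite D\<close> P by auto
    from finite_has_maximal[OF this] obtain P' where P': "P' \<in> ?A" and max: "\<forall>S\<in>?A. P' \<subseteq> S \<longrightarrow> P' = S" ..
    have "\<not> H S" if "S \<in> D" "P' \<subset> S" for S
      using max P' that by auto
    then have "P' \<in> G1" using P' unfolding G1_def by simp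
    then show ?thesis using P' by blast
  qed
  have disj: "disjoint (G1 \<union> G2)"
  proof (rule pairwiseI)
    fix R R' assume RR: "R \<in> G1 \<union> G2" "R' \<in> G1 \<union> G2" "R \<noteq> R'"
    show "disjnt R R'"
    proof (rule ccontr)
      assume "\<not> disjnt R R'"
      then obtain y where y: "y \<in> R" "y \<in> R'" by (auto simp: disjnt_def)
      then have nest: "R \<subseteq> R' \<or> R' \<subseteq> R"
        using RR D_dyadic by (intro dyadic_cubes_nested[of R R' y]) (auto simp: G1_def G2_def)
      have eq2: "R = R'" if h: "R \<in> G2" "R' \<in> G2"
      proof -
        obtain x where x: "R = cell j x" using h(1) unfolding G2_def by blast
        obtain x' where x': "R' = cell j x'" using h(2) unfolding G2_def by blast
        show ?thesis using y cell_eq[of y j x] cell_eq[of y j x'] unfolding x x' by simp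
      qed
      have bot: "R = R'" if h: "R \<in> G2" "R' \<in> G1" "R' \<subseteq> R" for R R'
      proof -
        obtain x where x: "R = cell j x" using h(1) unfolding G2_def by blast
        obtain i x' where x': "R' = cell i x'" "j \<le> i" using h(2) unfolding G1_def D_def by blast
        have "i \<le> j" using h(3) unfolding x x' by (rule cell_level_mono)
        then have eq: "R' = cell j x'" using x' by simp
        then have "x' \<in> cell j x" using h(3) x by auto
        then show ?thesis unfolding x eq by (rule cell_eq[symmetric])
      qed
      show False
      proof (cases "R \<in> G2 \<or> R' \<in> G2")
        case False
        then show False using nest RR unfolding G1_def by blast
      next
        case True
        then show False
        proof (cases "R \<in> G2 \<and> R' \<in> G2")
          case True
          then show False using eq2 RR(3) by simp
        next
          case False
          have no: "\<not> A \<subseteq> B" if "A \<in> G2" "B \<in> G1" for A B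
            using that unfolding G1_def G2_def by blast
          from False \<open>R \<in> G2 \<or> R' \<in> G2\<close> RR(1,2) consider "R \<in> G2" "R' \<in> G1" | "R' \<in> G2" "R \<in> G1" by blast
          then show False
            by cases (use nest no bot RR(3) in metis)+
        qed
      qed
    qed
  qed
  have un: "\<Union>(G1 \<union> G2) = Q"
  proof
    show "\<Union>(G1 \<union> G2) \<subseteq> Q" using D_Q by (auto simp: G1_def G2_def)
    show "Q \<subseteq> \<Union>(G1 \<union> G2)"
    proof
      fix x assume x: "x \<in> Q"
      have jx: "cell j x \<in> D" using x jk by (auto simp: D_def)
      show "x \<in> \<Union>(G1 \<union> G2)"
      proof (cases "\<exists>P'\<in>D. cell j x \<subseteq> P' \<and> H P'")
        case True
        then show ?thesis using heavy_max self_in_cell[of x j] by blast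
      next
        case False
        then have "cell j x \<in> G2" using jx by (auto simp: G2_def)
        then show ?thesis using self_in_cell[of x j] by blast
      qed
    qed
  qed
  show thesis
  proof (rule that[of "G1 \<union> G2"])
    show "finite (G1 \<union> G2)" using \<open>finite D\<close> by (auto simp: G1_def G2_def)
    show "G1 \<union> G2 \<subseteq> dyadic_cubes" using D_dyadic by (auto simp: G1_def G2_def)
    show "\<forall>P\<in>G1 \<union> G2. \<not> H P \<or> (\<exists>P'\<in>dyadic_cubes. \<not> H P' \<and> P \<subseteq> P' \<and> P' \<subseteq> Q
        \<and> vol P' = 2 ^ CARD('n) * vol P)"
    proof
      fix P assume P: "P \<in> G1 \<union> G2"
      show "\<not> H P \<or> (\<exists>P'\<in>dyadic_cubes. \<not> H P' \<and> P \<subseteq> P' \<and> P' \<subseteq> Q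
          \<and> vol P' = 2 ^ CARD('n) * vol P)"
      proof (cases "H P")
        case True
        then have P1: "P \<in> G1" using P by (auto simp: G2_def)
        then obtain i x where ix: "P = cell i x" "j \<le> i" "i \<le> k" "x \<in> Q" by (auto simp: G1_def D_def)
        have "i \<noteq> k" using True HQ ix cell_eq unfolding Q by metis
        then have up: "cell (i + 1) x \<in> D"
          unfolding D_def using ix by (intro CollectI exI[of _ "i + 1"] exI[of _ x]) auto
        have sub: "P \<subseteq> cell (i + 1) x" using cell_mono[of i "i + 1"] by (simp add: ix)
        have "P \<noteq> cell (i + 1) x" using cell_level_mono[of "i + 1" x i x] ix by auto
        then have "\<not> H (cell (i + 1) x)" using P1 up sub by (auto simp: G1_def)
        then show ?thesis
          using sub D_Q[OF up] measure_cell_Suc[of i x] ix(1) by (metis cell_in_dyadic_cubes)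
      qed simp
    qed
  next
    show "\<forall>i x. j \<le> i \<and> cell i x \<subseteq> Q \<and> \<not> (\<exists>P\<in>G1 \<union> G2. H P \<and> cell i x \<subseteq> P) \<longrightarrow>
        (\<forall>P\<in>G1 \<union> G2. P \<subseteq> cell i x \<or> P \<inter> cell i x = {})"
    proof (intro allI impI ballI, elim conjE)
      fix i :: int and x :: "real ^ 'n" and P
      define R where "R = cell i x"
      assume h: "j \<le> i" "cell i x \<subseteq> Q" "\<not> (\<exists>P\<in>G1 \<union> G2. H P \<and> cell i x \<subseteq> P)" and P: "P \<in> G1 \<union> G2"
      have R: "R = cell i x" "j \<le> i" "R \<subseteq> Q" "\<not> (\<exists>P\<in>G1 \<union> G2. H P \<and> R \<subseteq> P)" using h by (simp_all add: R_def)
      show "P \<subseteq> cell i x \<or> P \<inter> cell i x = {}" unfolding R(1)[symmetric]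
      proof (rule ccontr)
        assume c: "\<not> (P \<subseteq> R \<or> P \<inter> R = {})"
        then obtain y where y: "y \<in> P" "y \<in> R" by blast
        then have "R \<subseteq> P"
          using dyadic_cubes_nested[of P R y] P D_dyadic c R(1) by (auto simp: G1_def G2_def)
        then have "\<not> H P" using R(4) P by blast
        then have "P \<in> G2" using P by (auto simp: G1_def)
        then obtain x' where x': "P = cell j x'" by (auto simp: G2_def)
        have "i \<le> j" using \<open>R \<subseteq> P\<close> unfolding R(1) x' by (rule cell_level_mono)
        then have "i = j" using R(2) by simp
        then have "P = R" using y cell_eq[of y j x] cell_eq[of y j x'] unfolding R(1) x' by simp
        then show False using c by simp
      qed
    qed
  qed (use disj un in auto)
qed

section \<open>Stopping families\<close>

text \<open>
  Principal sets for an abstract stopping rule. By induction on the number of sets: remove a minimal set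
  \<open>R0\<close>, and add it to the family selected for the rest exactly if it is not already served there by a good
  pair. If \<open>R0\<close> is added, it makes a bad pair with every selected set that contains it.
\<close>

lemma stopping_family:
  fixes F :: "'a set set"
  assumes fin: "finite F"
    and chain: "\<And>P Q R. P \<in> F \<Longrightarrow> Q \<in> F \<Longrightarrow> R \<in> F \<Longrightarrow> R \<subseteq> P \<Longrightarrow> R \<subseteq> Q \<Longrightarrow> P \<subseteq> Q \<or> Q \<subseteq> P"
    and refl: "\<And>Q. Q \<in> F \<Longrightarrow> \<not> bad Q Q"
    and mono: "\<And>Q R R'. Q \<in> F \<Longrightarrow> R \<in> F \<Longrightarrow> R' \<in> F \<Longrightarrow> R' \<subseteq> R \<Longrightarrow> R \<subseteq> Q \<Longrightarrow> bad Q R \<Longrightarrow> bad Q R'"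
  shows "\<exists>S\<subseteq>F. (\<forall>R\<in>F. \<exists>Q\<in>S. R \<subseteq> Q \<and> \<not> bad Q R) \<and> (\<forall>Q\<in>S. \<forall>Q'\<in>S. Q' \<subset> Q \<longrightarrow> bad Q Q')"
  using assms
proof (induction "card F" arbitrary: F rule: less_induct)
  case less
  show ?case
  proof (cases "F = {}")
    case False
    then obtain R0 where R0: "R0 \<in> F" "\<And>R. R \<in> F \<Longrightarrow> R \<subseteq> R0 \<Longrightarrow> R = R0"
      using finite_has_minimal[OF less.prems(1)] by metis
    let ?F = "F - {R0}"
    have "card ?F < card F" using R0(1) by (intro psubset_card_mono less.prems(1)) blast
    then have "\<exists>S\<subseteq>?F. (\<forall>R\<in>?F. \<exists>Q\<in>S. R \<subseteq> Q \<and> \<not> bad Q R) \<and> (\<forall>Q\<in>S. \<forall>Q'\<in>S. Q' \<subset> Q \<longrightarrow> bad Q Q')"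
    proof (rule less.hyps)
      show "finite ?F" using less.prems(1) by simp
      show "\<not> bad Q Q" if "Q \<in> ?F" for Q using less.prems(3) that by simp
      show "P \<subseteq> Q \<or> Q \<subseteq> P" if "P \<in> ?F" "Q \<in> ?F" "R \<in> ?F" "R \<subseteq> P" "R \<subseteq> Q" for P Q R
        using less.prems(2)[of P Q R] that by simp
      show "bad Q R'" if "Q \<in> ?F" "R \<in> ?F" "R' \<in> ?F" "R' \<subseteq> R" "R \<subseteq> Q" "bad Q R" for Q R R'
        using less.prems(4)[of Q R R'] that by simp
    qed
    then obtain S where S: "S \<subseteq> ?F" and cover: "\<forall>R\<in>?F. \<exists>Q\<in>S. R \<subseteq> Q \<and> \<not> bad Q R"
      and nested: "\<forall>Q\<in>S. \<forall>Q'\<in>S. Q' \<subset> Q \<longrightarrow> bad Q Q'" by (elim exE conjE)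
    show ?thesis
    proof (cases "\<exists>Q\<in>S. R0 \<subseteq> Q \<and> \<not> bad Q R0")
      case True
      have "\<forall>R\<in>F. \<exists>Q\<in>S. R \<subseteq> Q \<and> \<not> bad Q R"
      proof
        fix R assume "R \<in> F"
        then show "\<exists>Q\<in>S. R \<subseteq> Q \<and> \<not> bad Q R" using True cover by (cases "R = R0") simp_all
      qed
      then show ?thesis using S nested by (intro exI[of _ S] conjI) auto
    next
      case False
      have 1: "\<forall>R\<in>F. \<exists>Q\<in>insert R0 S. R \<subseteq> Q \<and> \<not> bad Q R"
      proof
        fix R assume R: "R \<in> F"
        show "\<exists>Q\<in>insert R0 S. R \<subseteq> Q \<and> \<not> bad Q R"
        proof (cases "R = R0")
          case True
          then show ?thesis using less.prems(3)[OF R0(1)] by simp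
        next
          case False
          then have "R \<in> ?F" using R by simp
          then show ?thesis using cover by simp
        qed
      qed
      have 2: "bad Q Q'" if h: "Q \<in> insert R0 S" "Q' \<in> insert R0 S" "Q' \<subset> Q" for Q Q'
      proof (cases "Q = R0")
        case True
        have "Q' \<in> F" using h(2) R0(1) S by auto
        then have "Q' = R0" using R0(2)[of Q'] h(3) True by simp
        then show ?thesis using h(3) True by simp
      next
        case Q: False
        then have QS: "Q \<in> S" using h(1) by simp
        show ?thesis
        proof (cases "Q' = R0")
          case True
          then show ?thesis using False QS h(3) by auto
        next
          case False
          then have "Q' \<in> S" using h(2) by simp
          then show ?thesis using nested QS h(3) by simp
        qed
      qed
      show ?thesis using 1 2 S R0(1) by (intro exI[of _ "insert R0 S"] conjI) auto
    qed
  qed auto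
qed

section \<open>Averages of norms\<close>

lemma enn_powr_ennreal: "0 \<le> a \<Longrightarrow> enn_powr (ennreal a) r = ennreal (a powr r)"
  by (simp add: enn_powr_def)

lemma enn_powr_0 [simp]: "enn_powr 0 r = 0"
  by (simp add: enn_powr_def)

lemma enn_powr_mono:
  assumes "a \<le> b" "0 \<le> r"
  shows "enn_powr a r \<le> enn_powr b r"
proof (cases "b = \<infinity>")
  case True
  then show ?thesis by (simp add: enn_powr_def)
next
  case False
  then have "a \<noteq> \<infinity>" using assms(1) by (auto simp: top_unique)
  moreover have "enn2real a \<le> enn2real b"
    using False assms(1) by (intro enn2real_mono) (auto simp: less_top)
  ultimately show ?thesis using False assms(2) by (auto simp: enn_powr_def intro!: ennreal_leI powr_mono2)
qed

text \<open>
  The consequence of \<open>u \<in> L\<^sup>p\<close> on which all arguments about averages rest.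
\<close>

definition loc_integrable :: "(real ^ 'n::finite \<Rightarrow> 'x::real_normed_vector) \<Rightarrow> bool" where
  "loc_integrable u \<longleftrightarrow> strongly_measurable lebesgue u \<and>
     (\<forall>Q\<in>dyadic_cubes. (\<integral>\<^sup>+x\<in>Q. ennreal (norm (u x)) \<partial>lebesgue) < \<infinity>)"

definition mean_norm :: "(real ^ 'n::finite \<Rightarrow> 'x::real_normed_vector) \<Rightarrow> (real ^ 'n) set \<Rightarrow> real" where
  "mean_norm u Q = enn2real (\<integral>\<^sup>+x\<in>Q. ennreal (norm (u x)) \<partial>lebesgue) / vol Q"

lemma mean_norm_nonneg: "0 \<le> mean_norm u Q"
  by (simp add: mean_norm_def)

lemma mean_norm_integral:
  assumes "loc_integrable u" "Q \<in> dyadic_cubes"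
  shows "ennreal (mean_norm u Q * vol Q) = (\<integral>\<^sup>+x\<in>Q. ennreal (norm (u x)) \<partial>lebesgue)"
  using assms measure_dyadic_pos[OF assms(2)] by (auto simp: loc_integrable_def mean_norm_def)

lemma norm_average_le:
  fixes u :: "real ^ 'n::finite \<Rightarrow> 'x::banach"
  assumes u: "loc_integrable u" and Q: "Q \<in> dyadic_cubes"
  shows "norm (average Q u) \<le> mean_norm u Q"
proof -
  have "ennreal (norm (bochner_on Q u)) \<le> ennreal (mean_norm u Q * vol Q)"
    unfolding mean_norm_integral[OF u Q]
    using u Q sets_dyadic[OF Q] by (intro bochner_on_norm_bound) (auto simp: loc_integrable_def)
  then have "norm (bochner_on Q u) \<le> mean_norm u Q * vol Q"
    by (subst (asm) ennreal_le_iff) (auto simp: mean_norm_nonneg)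
  then show ?thesis
    using measure_dyadic_pos[OF Q] by (simp add: average_bochner_on field_simps)
qed

lemma mean_norm_mono:
  assumes u: "loc_integrable u" and QR: "Q \<in> dyadic_cubes" "R \<in> dyadic_cubes" "R \<subseteq> Q"
  shows "mean_norm u R * vol R \<le> mean_norm u Q * vol Q"
proof -
  have "ennreal (mean_norm u R * vol R) \<le> ennreal (mean_norm u Q * vol Q)"
    unfolding mean_norm_integral[OF u QR(1)] mean_norm_integral[OF u QR(2)]
    using QR(3) by (intro nn_integral_mono) (auto simp: indicator_def)
  then show ?thesis
    using mean_norm_nonneg[of u Q] by (subst (asm) ennreal_le_iff) auto
qed

lemma borel_measurable_norm_loc:
  "loc_integrable u \<Longrightarrow> (\<lambda>x. norm (u x)) \<in> borel_measurable lebesgue"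
  by (simp add: loc_integrable_def borel_measurable_norm_strong)

lemma nn_integral_disjoint_sum_le:
  fixes f :: "'a::euclidean_space \<Rightarrow> ennreal"
  assumes f: "f \<in> borel_measurable lebesgue"
    and G: "finite G" "disjoint G" "G \<subseteq> sets lebesgue" "\<Union>G \<subseteq> Q"
  shows "(\<Sum>P\<in>G. \<integral>\<^sup>+x\<in>P. f x \<partial>lebesgue) \<le> (\<integral>\<^sup>+x\<in>Q. f x \<partial>lebesgue)"
proof -
  have "(\<Sum>P\<in>G. \<integral>\<^sup>+x\<in>P. f x \<partial>lebesgue) = (\<integral>\<^sup>+x. (\<Sum>P\<in>G. f x * indicator P x) \<partial>lebesgue)"
    using f G(3) by (subst nn_integral_sum) auto
  also have "\<dots> = (\<integral>\<^sup>+x\<in>\<Union>G. f x \<partial>lebesgue)"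
  proof (rule nn_integral_cong)
    fix x
    have "indicator (\<Union>P\<in>G. P) x = (\<Sum>P\<in>G. indicator P x :: ennreal)"
      using G(1,2) by (intro indicator_UN_disjoint) (simp_all add: disjoint_family_on_def disjoint_def)
    then have "(\<Sum>P\<in>G. indicator P x :: ennreal) = indicator (\<Union>G) x" by simp
    then show "(\<Sum>P\<in>G. f x * indicator P x) = f x * indicator (\<Union>G) x"
      by (simp flip: sum_distrib_left)
  qed
  also have "\<dots> \<le> (\<integral>\<^sup>+x\<in>Q. f x \<partial>lebesgue)"
    using G(4) by (intro nn_integral_mono) (auto simp: indicator_def)
  finally show ?thesis .
qed

lemma mean_norm_disjoint_sum:
  assumes u: "loc_integrable u" and Q: "Q \<in> dyadic_cubes"
    and G: "finite G" "G \<subseteq> dyadic_cubes" "disjoint G" "\<Union>G \<subseteq> Q"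
  shows "(\<Sum>P\<in>G. mean_norm u P * vol P) \<le> mean_norm u Q * vol Q"
proof -
  have "ennreal (\<Sum>P\<in>G. mean_norm u P * vol P) = (\<Sum>P\<in>G. \<integral>\<^sup>+x\<in>P. ennreal (norm (u x)) \<partial>lebesgue)"
  proof -
    have "(\<Sum>P\<in>G. \<integral>\<^sup>+x\<in>P. ennreal (norm (u x)) \<partial>lebesgue)
        = (\<Sum>P\<in>G. ennreal (mean_norm u P * vol P))"
      using G(2) by (intro sum.cong refl mean_norm_integral[OF u, symmetric]) auto
    also have "\<dots> = ennreal (\<Sum>P\<in>G. mean_norm u P * vol P)"
      by (rule sum_ennreal) (simp add: mean_norm_nonneg)
    finally show ?thesis ..
  qed
  also have "\<dots> \<le> (\<integral>\<^sup>+x\<in>Q. ennreal (norm (u x)) \<partial>lebesgue)"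
    using G sets_dyadic borel_measurable_norm_loc[OF u] by (intro nn_integral_disjoint_sum_le) auto
  also have "\<dots> = ennreal (mean_norm u Q * vol Q)"
    by (rule mean_norm_integral[OF u Q, symmetric])
  finally show ?thesis
    using mean_norm_nonneg[of u Q] by (subst (asm) ennreal_le_iff) auto
qed

section \<open>The Rademacher maximal function and principal cubes\<close>

lemma dyadic_average_cell: "dyadic_average k u x = average (cell k x) u"
proof -
  have "(THE Q. Q \<in> dyadic_cubes_at k \<and> x \<in> Q) = cell k x"
    by (rule the_equality) (auto simp: dyadic_cubes_at_eq_range_cell cell_eq)
  then show ?thesis by (simp add: dyadic_average_def)
qed

lemma rad_scale:
  fixes x :: "'i \<Rightarrow> 'x::real_normed_vector"
  assumes "0 \<le> c"
  shows "rad 1 J (\<lambda>i. c *\<^sub>R x i) = c * rad 1 J x"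
proof -
  have "norm (\<Sum>i\<in>J. s i *\<^sub>R c *\<^sub>R x i) = c * norm (\<Sum>i\<in>J. s i *\<^sub>R x i)" for s
  proof -
    have "(\<Sum>i\<in>J. s i *\<^sub>R c *\<^sub>R x i) = c *\<^sub>R (\<Sum>i\<in>J. s i *\<^sub>R x i)"
      by (simp add: scaleR_sum_right mult.commute)
    then show ?thesis using assms by simp
  qed
  then show ?thesis by (simp add: rad_1 sign_mean_cmult)
qed

lemma normed_space_overD:
  assumes "normed_space_over sc"
  shows "sc 0 x = 0" "sc a 0 = 0" "sc (of_real r * a) x = r *\<^sub>R sc a x" "norm (sc a x) = norm a * norm x"
proof -
  interpret vector_space sc using assms by (simp add: normed_space_over_def)
  show "sc 0 x = 0" "sc a 0 = 0" by simp_all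
  show "sc (of_real r * a) x = r *\<^sub>R sc a x"
    using assms scale_scale[of "of_real r" a x] unfolding normed_space_over_def by metis
  show "norm (sc a x) = norm a * norm x" using assms by (simp add: normed_space_over_def)
qed

text \<open>
  The cubes of \<open>F\<close> all contain \<open>x\<close>, so each level occurs at most once among them, and reindexing by levels
  turns the sum into one of those in the definition of the maximal function. That definition normalises
  the coefficients, whence the factor on the right.
\<close>

lemma rad_le_rademacher_maximal:
  fixes sc :: "'k::real_normed_field \<Rightarrow> 'x::real_normed_vector \<Rightarrow> 'x"
    and g :: "real ^ 'n::finite \<Rightarrow> 'x"
  assumes sc: "normed_space_over sc"
    and F: "finite F" "F \<subseteq> dyadic_cubes" "\<And>P. P \<in> F \<Longrightarrow> x \<in> P"
  shows "ennreal (rad 1 F (\<lambda>P. sc (l P) (average P g)))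
    \<le> ennreal (L2_set (\<lambda>P. norm (l P)) F) * rademacher_maximal sc g x"
proof -
  define N where "N = L2_set (\<lambda>P. norm (l P)) F"
  define S where "S = {P \<in> F. l P \<noteq> 0}"
  have S: "finite S" "S \<subseteq> F" using F(1) by (auto simp: S_def)
  have rS: "rad 1 F (\<lambda>P. sc (l P) (average P g)) = rad 1 S (\<lambda>P. sc (l P) (average P g))"
    using normed_space_overD(1)[OF sc] by (intro rad_neutral F(1) S(2)) (auto simp: S_def)
  show ?thesis
  proof (cases "N = 0")
    case True
    then have "S = {}" using F(1) by (auto simp: N_def S_def L2_set_eq_0_iff)
    then show ?thesis unfolding rS by (simp add: rad_1 sign_mean_def)
  next
    case False
    then have N: "0 < N" using L2_set_nonneg[of "\<lambda>P. norm (l P)" F] unfolding N_def by linarith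
    define L where "L = {k. cell k x \<in> S}"
    have bij: "bij_betw (\<lambda>k. cell k x) L S"
    proof (rule bij_betw_imageI)
      show "inj_on (\<lambda>k. cell k x) L"
      proof (rule inj_onI)
        fix i j assume "cell i x = cell j x"
        then show "i = j" using cell_level_mono[of i x j x] cell_level_mono[of j x i x] by simp
      qed
      show "(\<lambda>k. cell k x) ` L = S"
      proof
        show "S \<subseteq> (\<lambda>k. cell k x) ` L"
        proof
          fix P assume P: "P \<in> S"
          then obtain k y where ky: "P = cell k y" using F(2) S(2) by (meson dyadic_cubesE subsetD)
          have "x \<in> P" using P S(2) F(3) by blast
          then have "cell k x = P" unfolding ky by (rule cell_eq)
          then show "P \<in> (\<lambda>k. cell k x) ` L" using P by (auto simp: L_def)
        qed
      qed (auto simp: L_def)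
    qed
    define l' where "l' k = (if k \<in> L then of_real (1 / N) * l (cell k x) else 0)" for k
    have L: "{k. l' k \<noteq> 0} = L" using N by (auto simp: l'_def L_def S_def)
    have fL: "finite L" using bij S(1) bij_betw_finite by blast
    have l2: "L2_set (\<lambda>k. norm (l' k)) L \<le> 1"
    proof -
      have "L2_set (\<lambda>k. norm (l' k)) L = L2_set (\<lambda>P. (1 / N) * norm (l P)) S"
        unfolding L2_set_def
        by (subst sum.reindex_bij_betw[OF bij, symmetric])
          (use N in \<open>auto simp: l'_def norm_mult norm_divide power_divide intro!: sum.cong\<close>)
      also have "\<dots> = (1 / N) * L2_set (\<lambda>P. norm (l P)) S"
        using N by (subst L2_set_right_distrib[symmetric]) auto
      also have "L2_set (\<lambda>P. norm (l P)) S = N"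
        unfolding N_def L2_set_def using F(1)
        by (intro arg_cong[where f=sqrt] sum.mono_neutral_left) (auto simp: S_def)
      finally show ?thesis using N by simp
    qed
    have "ennreal ((1 / N) * rad 1 S (\<lambda>P. sc (l P) (average P g)))
        = ennreal (rad 1 S (\<lambda>P. sc (of_real (1 / N) * l P) (average P g)))"
      unfolding normed_space_overD(3)[OF sc] using N by (subst rad_scale) auto
    also have "\<dots> = ennreal (rad 1 L (\<lambda>k. sc (of_real (1 / N) * l (cell k x)) (average (cell k x) g)))"
      by (subst rad_reindex[OF bij, symmetric]) simp
    also have "rad 1 L (\<lambda>k. sc (of_real (1 / N) * l (cell k x)) (average (cell k x) g))
        = rad 1 L (\<lambda>k. sc (l' k) (dyadic_average k g x))"
      by (rule rad_cong) (simp add: l'_def dyadic_average_cell)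
    also have "ennreal \<dots> = (\<integral>\<^sup>+\<epsilon>. ennreal (norm (\<Sum>k\<in>L. \<epsilon> k *\<^sub>R sc (l' k) (dyadic_average k g x))) \<partial>random_signs UNIV)"
      using nn_integral_rad[OF fL, of UNIV "\<lambda>k. sc (l' k) (dyadic_average k g x)" 1] by simp
    also have "\<dots> \<le> rademacher_maximal sc g x"
      unfolding rademacher_maximal_def
      using fL l2 L by (intro SUP_upper2[of l']) auto
    finally have le: "ennreal N * ennreal ((1 / N) * rad 1 S (\<lambda>P. sc (l P) (average P g)))
        \<le> ennreal N * rademacher_maximal sc g x"
      by (rule mult_left_mono) simp
    have eq: "ennreal N * ennreal ((1 / N) * rad 1 S (\<lambda>P. sc (l P) (average P g)))
        = ennreal (rad 1 S (\<lambda>P. sc (l P) (average P g)))"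
      using N by (subst ennreal_mult[symmetric]) (auto simp: rad_nonneg)
    show ?thesis using le unfolding eq unfolding rS N_def .
  qed
qed

text \<open>
  Chebyshev's inequality for the maximal function of a step function, whose \<open>L\<^sup>2\<close> norm is bounded by its
  supremum.
\<close>

lemma rmf_chebyshev:
  fixes sc :: "'k::real_normed_field \<Rightarrow> 'x::real_normed_vector \<Rightarrow> 'x"
    and a :: "(real ^ 'n::finite) set \<Rightarrow> 'x"
  assumes rmf: "\<And>u :: real ^ 'n \<Rightarrow> 'x. u \<in> Lp_space 2 \<Longrightarrow>
        Lp_norm 2 (rademacher_maximal sc u) \<le> ennreal K * Lp_norm 2 (\<lambda>x. ennreal (norm (u x)))"
    and K: "0 \<le> K" and Q: "Q \<in> dyadic_cubes"
    and G: "finite G" "G \<subseteq> dyadic_cubes" "disjoint G" "\<Union>G = Q"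
    and a: "\<And>P. P \<in> G \<Longrightarrow> norm (a P) \<le> A" and A: "0 \<le> A"
    and g: "g = (\<lambda>x. \<Sum>P\<in>G. indicator P x *\<^sub>R a P)"
    and U: "U \<in> fmeasurable lebesgue" "0 \<le> t" "\<And>x. x \<in> U \<Longrightarrow> ennreal t \<le> rademacher_maximal sc g x"
  shows "t\<^sup>2 * vol U \<le> (K * A)\<^sup>2 * vol Q"
proof -
  have simple: "simple_function lebesgue g"
    unfolding g
  proof (rule simple_function_sum)
    fix P assume "P \<in> G"
    then have "P \<in> sets lebesgue" using G(2) sets_dyadic by blast
    then have "simple_function lebesgue (indicator P :: _ \<Rightarrow> real)" by (rule simple_function_indicator)
    then show "simple_function lebesgue (\<lambda>x. indicator P x *\<^sub>R a P)" by (rule simple_function_compose1)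
  qed
  have g_in: "norm (g x) \<le> A * indicator Q x" for x
  proof (cases "x \<in> Q")
    case True
    then obtain P where P: "P \<in> G" "x \<in> P" using G(4) by blast
    have "g x = (\<Sum>P'\<in>{P}. indicator P' x *\<^sub>R a P')"
      unfolding g using G(1,3) P
      by (intro sum.mono_neutral_right) (auto simp: disjoint_def indicator_def)
    then show ?thesis using P a True by simp
  next
    case False
    then have "g x = 0" unfolding g using G(4) by (intro sum.neutral) (auto simp: indicator_def)
    then show ?thesis using False by simp
  qed
  have int_g: "(\<integral>\<^sup>+x. enn_powr (ennreal (norm (g x))) 2 \<partial>lebesgue) \<le> ennreal (A\<^sup>2 * vol Q)"
  proof -
    have "(\<integral>\<^sup>+x. enn_powr (ennreal (norm (g x))) 2 \<partial>lebesgue) \<le> (\<integral>\<^sup>+x. ennreal (A\<^sup>2) * indicator Q x \<partial>lebesgue)"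
    proof (rule nn_integral_mono)
      fix x
      have "norm (g x) powr 2 \<le> A\<^sup>2 * indicator Q x"
        using g_in[of x] A by (cases "x \<in> Q") (auto simp: power_mono)
      then show "enn_powr (ennreal (norm (g x))) 2 \<le> ennreal (A\<^sup>2) * indicator Q x"
        by (cases "x \<in> Q") (auto simp: enn_powr_ennreal intro: ennreal_leI)
    qed
    also have "\<dots> = ennreal (A\<^sup>2) * emeasure lebesgue Q"
      using sets_dyadic[OF Q] by (rule nn_integral_cmult_indicator)
    finally show ?thesis by (simp add: emeasure_dyadic[OF Q] ennreal_mult)
  qed
  have Lg: "Lp_norm 2 (\<lambda>x. ennreal (norm (g x))) \<le> ennreal (A * sqrt (vol Q))"
  proof -
    have "Lp_norm 2 (\<lambda>x. ennreal (norm (g x))) \<le> enn_powr (ennreal (A\<^sup>2 * vol Q)) (1 / 2)"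
      unfolding Lp_norm_def by (rule enn_powr_mono[OF int_g]) simp
    also have "\<dots> = ennreal (A * sqrt (vol Q))"
      using A by (simp add: enn_powr_ennreal powr_half_sqrt real_sqrt_mult)
    finally show ?thesis .
  qed
  have "g \<in> Lp_space 2"
    unfolding Lp_space_def using strongly_measurable_simple[OF simple] Lg by (auto intro: le_less_trans)
  from rmf[OF this] have "Lp_norm 2 (rademacher_maximal sc g) \<le> ennreal K * ennreal (A * sqrt (vol Q))"
    by (rule order_trans) (intro mult_left_mono Lg, simp)
  also have "\<dots> = ennreal (K * A * sqrt (vol Q))"
    using K by (simp add: ennreal_mult' mult.assoc)
  finally have up: "Lp_norm 2 (rademacher_maximal sc g) \<le> ennreal (K * A * sqrt (vol Q))" .
  have "ennreal (t\<^sup>2 * vol U) = (\<integral>\<^sup>+x. ennreal (t\<^sup>2) * indicator U x \<partial>lebesgue)"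
    using U(1) by (subst nn_integral_cmult_indicator) (auto simp: ennreal_mult emeasure_eq_measure2 fmeasurableD)
  also have "\<dots> \<le> (\<integral>\<^sup>+x. enn_powr (rademacher_maximal sc g x) 2 \<partial>lebesgue)"
  proof (rule nn_integral_mono)
    fix x
    show "ennreal (t\<^sup>2) * indicator U x \<le> enn_powr (rademacher_maximal sc g x) 2"
    proof (cases "x \<in> U")
      case True
      have "enn_powr (ennreal t) 2 \<le> enn_powr (rademacher_maximal sc g x) 2"
        by (rule enn_powr_mono[OF U(3)[OF True]]) simp
      then show ?thesis using True U(2) by (simp add: enn_powr_ennreal)
    qed simp
  qed
  finally have "enn_powr (ennreal (t\<^sup>2 * vol U)) (1 / 2) \<le> Lp_norm 2 (rademacher_maximal sc g)"
    unfolding Lp_norm_def by (rule enn_powr_mono) simp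
  also note up
  finally have "ennreal (t * sqrt (vol U)) \<le> ennreal (K * A * sqrt (vol Q))"
    using U(2) by (simp add: enn_powr_ennreal powr_half_sqrt real_sqrt_mult)
  then have "t * sqrt (vol U) \<le> K * A * sqrt (vol Q)"
    using K A by (subst (asm) ennreal_le_iff) auto
  then have "(t * sqrt (vol U))\<^sup>2 \<le> (K * A * sqrt (vol Q))\<^sup>2"
    using U(2) by (intro power_mono) auto
  then show ?thesis by (simp add: power_mult_distrib)
qed

text \<open>
  The condition is homogeneous in the coefficients \<open>l\<close>, so that it can be applied to the values
  \<open>b R x\<close> without normalising them.
\<close>

definition bad_pair ::
    "('k::real_normed_field \<Rightarrow> 'x::real_normed_vector \<Rightarrow> 'x) \<Rightarrow> real \<Rightarrow> (real ^ 'n::finite \<Rightarrow> 'x) \<Rightarrow>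
     (real ^ 'n) set set \<Rightarrow> (real ^ 'n) set \<Rightarrow> (real ^ 'n) set \<Rightarrow> bool" where
  "bad_pair sc C u F Q R \<longleftrightarrow> (\<exists>l :: (real ^ 'n) set \<Rightarrow> 'k.
     rad 1 {P\<in>F. R \<subseteq> P \<and> P \<subseteq> Q} (\<lambda>P. sc (l P) (average P u))
       > C * mean_norm u Q * L2_set (\<lambda>P. norm (l P)) {P\<in>F. R \<subseteq> P \<and> P \<subseteq> Q})"

text \<open>
  The step function is the conditional expectation of \<open>u\<close> on the partition \<open>G\<close>, and \<open>P\<close> is a union of
  members of \<open>G\<close>.
\<close>

lemma average_conditional_expectation:
  fixes u :: "real ^ 'n::finite \<Rightarrow> 'x::banach"
  assumes u: "loc_integrable u"
    and G: "finite G" "G \<subseteq> dyadic_cubes" "disjoint G" "\<Union>G = Q"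
    and P: "P \<in> dyadic_cubes" "P \<subseteq> Q" "\<forall>P'\<in>G. P' \<subseteq> P \<or> P' \<inter> P = {}"
  shows "average P (\<lambda>x. \<Sum>P'\<in>G. indicator P' x *\<^sub>R average P' u) = average P u"
proof -
  let ?G = "{P'\<in>G. P' \<subseteq> P}"
  have "bochner_on P (\<lambda>x. \<Sum>P'\<in>G. indicator P' x *\<^sub>R average P' u)
      = (\<Sum>P'\<in>G. vol (P \<inter> P') *\<^sub>R average P' u)"
  proof (rule bochner_on_step_function[OF G(1)])
    show "G \<subseteq> sets lebesgue" "P \<in> sets lebesgue" using G(2) P(1) sets_dyadic by auto
    show "emeasure lebesgue P' < \<infinity>" if "P' \<in> G" for P'
      using that G(2) by (subst emeasure_dyadic) auto
  qed
  also have "\<dots> = (\<Sum>P'\<in>?G. vol (P \<inter> P') *\<^sub>R average P' u)"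
    using P(3) G(1) by (intro sum.mono_neutral_right) (auto simp: Int_commute)
  also have "\<dots> = (\<Sum>P'\<in>?G. bochner_on P' u)"
  proof (rule sum.cong)
    fix P' assume P': "P' \<in> ?G"
    then have "P \<inter> P' = P'" "0 < vol P'" using measure_dyadic_pos G(2) by auto
    then show "vol (P \<inter> P') *\<^sub>R average P' u = bochner_on P' u"
      by (simp add: average_bochner_on)
  qed simp
  also have "\<dots> = bochner_on (\<Union>?G) u"
  proof (rule bochner_on_Union[symmetric])
    show "strongly_measurable lebesgue u" using u by (simp add: loc_integrable_def)
    show "finite ?G" using G(1) by simp
    show "disjoint ?G" using G(3) by (auto simp: disjoint_def)
    show "?G \<subseteq> sets lebesgue" using G(2) sets_dyadic by auto
    have "(\<integral>\<^sup>+x\<in>\<Union>?G. ennreal (norm (u x)) \<partial>lebesgue) \<le> (\<integral>\<^sup>+x\<in>P. ennreal (norm (u x)) \<partial>lebesgue)"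
      by (intro nn_integral_mono) (auto simp: indicator_def)
    also have "\<dots> < \<infinity>" using u P(1) by (simp add: loc_integrable_def)
    finally show "(\<integral>\<^sup>+x\<in>\<Union>?G. ennreal (norm (u x)) \<partial>lebesgue) < \<infinity>" .
  qed
  also have "\<Union>?G = P" using G(4) P(2,3) by blast
  finally show ?thesis by (simp add: average_bochner_on)
qed

lemma bad_pair_rademacher_maximal:
  fixes sc :: "'k::real_normed_field \<Rightarrow> 'x::real_normed_vector \<Rightarrow> 'x"
    and u g :: "real ^ 'n::finite \<Rightarrow> 'x"
  assumes sc: "normed_space_over sc" and C: "0 \<le> C"
    and F: "finite F" "F \<subseteq> dyadic_cubes"
    and bad: "bad_pair sc C u F Q R"
    and g: "\<And>P. P \<in> F \<Longrightarrow> R \<subseteq> P \<Longrightarrow> P \<subseteq> Q \<Longrightarrow> average P g = average P u"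
    and x: "x \<in> R"
  shows "ennreal (C * mean_norm u Q) \<le> rademacher_maximal sc g x"
proof -
  let ?J = "{P\<in>F. R \<subseteq> P \<and> P \<subseteq> Q}"
  obtain l where l: "rad 1 ?J (\<lambda>P. sc (l P) (average P u)) > C * mean_norm u Q * L2_set (\<lambda>P. norm (l P)) ?J"
    using bad unfolding bad_pair_def by blast
  define N where "N = L2_set (\<lambda>P. norm (l P)) ?J"
  have N0: "0 \<le> N" by (simp add: N_def)
  have le: "ennreal (rad 1 ?J (\<lambda>P. sc (l P) (average P g))) \<le> ennreal N * rademacher_maximal sc g x"
    unfolding N_def using F x by (intro rad_le_rademacher_maximal[OF sc]) auto
  have eq: "rad 1 ?J (\<lambda>P. sc (l P) (average P g)) = rad 1 ?J (\<lambda>P. sc (l P) (average P u))"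
    by (rule rad_cong) (simp add: g)
  have "N \<noteq> 0"
  proof
    assume "N = 0"
    then have "ennreal (rad 1 ?J (\<lambda>P. sc (l P) (average P u))) \<le> 0" using le eq by simp
    then show False using l \<open>N = 0\<close> by (simp add: N_def[symmetric])
  qed
  then have N: "0 < N" using N0 by simp
  show ?thesis
  proof (cases "rademacher_maximal sc g x")
    case (real m)
    then have "ennreal (rad 1 ?J (\<lambda>P. sc (l P) (average P u))) \<le> ennreal (N * m)"
      using le eq N0 by (simp add: ennreal_mult)
    then have "rad 1 ?J (\<lambda>P. sc (l P) (average P u)) \<le> N * m"
      using N0 real by (subst (asm) ennreal_le_iff) auto
    then have "C * mean_norm u Q * N < N * m" using l by (simp add: N_def)
    then have "C * mean_norm u Q < m" using N by (simp add: mult.commute)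
    then show ?thesis using real by (auto intro: ennreal_leI)
  qed simp
qed

text \<open>
  Call a cube heavy if the mean of \<open>norm u\<close> over it exceeds four times the mean over \<open>Q\<close>. The heavy members
  of the Calderon--Zygmund partition fill at most a quarter of \<open>Q\<close>. A bad cube that lies in none of them
  sees only averages that are also averages of the conditional expectation \<open>g\<close>, so that the maximal
  function of \<open>g\<close> is large on it. As \<open>g\<close> is bounded by \<open>A = 2 ^ n * 4\<close> times the mean over \<open>Q\<close>, and \<open>C\<close> is
  \<open>2 * K * 2 ^ n * 4\<close>, such cubes fill at most another quarter.
\<close>

lemma local_weak_type:
  fixes sc :: "'k::real_normed_field \<Rightarrow> 'x::banach \<Rightarrow> 'x"
    and u :: "real ^ 'n::finite \<Rightarrow> 'x"
  assumes sc: "normed_space_over sc"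
    and rmf: "\<And>u :: real ^ 'n \<Rightarrow> 'x. u \<in> Lp_space 2 \<Longrightarrow>
        Lp_norm 2 (rademacher_maximal sc u) \<le> ennreal K * Lp_norm 2 (\<lambda>x. ennreal (norm (u x)))"
    and K: "0 < K" and C: "C = 8 * 2 ^ CARD('n) * K"
    and u: "loc_integrable u"
    and F: "finite F" "F \<subseteq> dyadic_cubes" and QF: "Q \<in> F"
  shows "vol (\<Union>{R\<in>F. R \<subseteq> Q \<and> bad_pair sc C u F Q R}) \<le> vol Q / 2"
proof -
  have Q: "Q \<in> dyadic_cubes" using F QF by blast
  have C0: "0 \<le> C" using C K by simp
  define a where "a = mean_norm u Q"
  have a0: "0 \<le> a" by (simp add: a_def mean_norm_nonneg)
  show ?thesis
  proof (cases "a = 0")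
    case True
    have "\<not> bad_pair sc C u F Q R" for R
    proof
      assume "bad_pair sc C u F Q R"
      then obtain l where l: "rad 1 {P\<in>F. R \<subseteq> P \<and> P \<subseteq> Q} (\<lambda>P. sc (l P) (average P u)) > 0"
        using True unfolding bad_pair_def a_def by auto
      have "average P u = 0" if P: "P \<in> F" "P \<subseteq> Q" for P
      proof -
        have Pd: "P \<in> dyadic_cubes" using P F by blast
        have "mean_norm u P * vol P \<le> 0"
          using mean_norm_mono[OF u Q Pd P(2)] True by (simp add: a_def)
        then have "mean_norm u P \<le> 0" using measure_dyadic_pos[OF Pd] by (simp add: mult_le_0_iff)
        then have "norm (average P u) \<le> 0" using norm_average_le[OF u Pd] by linarith
        then show ?thesis by simp
      qed
      then have "rad 1 {P\<in>F. R \<subseteq> P \<and> P \<subseteq> Q} (\<lambda>P. sc (l P) (average P u))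
          = rad 1 {} (\<lambda>P. sc (l P) (average P u))"
        using F(1) normed_space_overD(2)[OF sc] by (intro rad_neutral) auto
      then show False using l by (simp add: rad_1 sign_mean_def)
    qed
    then show ?thesis by simp
  next
    case False
    then have a: "0 < a" using a0 by simp
    obtain k z where kz: "Q = cell k z" using Q by (rule dyadic_cubesE)
    have "\<exists>lev. \<forall>R\<in>F. R \<in> range (cell (lev R))"
      using F(2) by (intro bchoice ballI) (metis dyadic_cubesE rangeI subsetD)
    then obtain lev where lev: "\<And>R. R \<in> F \<Longrightarrow> R \<in> range (cell (lev R))" by blast
    \<comment> \<open>The finest level that occurs in \<open>F\<close> limits the resolution of the partition.\<close>
    define j where "j = Min (insert k (lev ` F))"
    have j: "j \<le> k" "\<And>R. R \<in> F \<Longrightarrow> j \<le> lev R" using F(1) by (auto simp: j_def)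
    define H where "H P \<longleftrightarrow> 4 * a < mean_norm u P" for P
    have HQ: "\<not> H Q" using a by (simp add: H_def flip: a_def)
    obtain G where G: "finite G" "G \<subseteq> dyadic_cubes" "disjoint G" "\<Union>G = Q"
      and Gmean: "\<forall>P\<in>G. \<not> H P \<or> (\<exists>P'\<in>dyadic_cubes. \<not> H P' \<and> P \<subseteq> P' \<and> P' \<subseteq> Q
        \<and> vol P' = 2 ^ CARD('n) * vol P)"
      and Gsub: "\<forall>i x. j \<le> i \<and> cell i x \<subseteq> Q \<and> \<not> (\<exists>P\<in>G. H P \<and> cell i x \<subseteq> P) \<longrightarrow>
        (\<forall>P\<in>G. P \<subseteq> cell i x \<or> P \<inter> cell i x = {})"
      by (rule calderon_zygmund_partition[where H=H, OF kz j(1) HQ])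
    define A where "A = 2 ^ CARD('n) * (4 * a)"
    have one: "(1::real) \<le> 2 ^ CARD('n)" by simp
    have A0: "0 \<le> A" using a by (simp add: A_def)
    have GA: "norm (average P u) \<le> A" if P: "P \<in> G" for P
    proof -
      have Pd: "P \<in> dyadic_cubes" using P G by blast
      have "mean_norm u P \<le> A"
      proof (cases "H P")
        case True
        then obtain P' where P': "P' \<in> dyadic_cubes" "\<not> H P'" "P \<subseteq> P'"
          "vol P' = 2 ^ CARD('n) * vol P" using Gmean P by auto
        have "mean_norm u P * vol P \<le> mean_norm u P' * vol P'"
          by (rule mean_norm_mono[OF u P'(1) Pd P'(3)])
        also have "\<dots> \<le> 4 * a * vol P'"
          using P'(2) by (intro mult_right_mono) (auto simp: H_def)
        also have "\<dots> = A * vol P" by (simp add: A_def P'(4))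
        finally show ?thesis using measure_dyadic_pos[OF Pd] by simp
      next
        case False
        then have "mean_norm u P \<le> 4 * a" by (simp add: H_def)
        also have "\<dots> \<le> A" using one a unfolding A_def by (simp add: mult_le_cancel_right1)
        finally show ?thesis .
      qed
      then show ?thesis using norm_average_le[OF u Pd] by simp
    qed
    define g where "g = (\<lambda>x. \<Sum>P\<in>G. indicator P x *\<^sub>R average P u)"
    define GH where "GH = {P\<in>G. H P}"
    have GH: "finite GH" "GH \<subseteq> dyadic_cubes" "disjoint GH" "\<Union>GH \<subseteq> Q"
      using G by (auto simp: GH_def disjoint_def)
    have fm: "P \<in> fmeasurable lebesgue" if "P \<in> dyadic_cubes" for P :: "(real ^ 'n) set"
      using that by (rule fmeasurable_dyadic)
    have mOmega: "vol (\<Union>GH) \<le> vol Q / 4"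
    proof -
      have "vol (\<Union>GH) = (\<Sum>P\<in>GH. vol P)"
        using GH fm by (intro measure_Union') auto
      then have "4 * a * vol (\<Union>GH) = (\<Sum>P\<in>GH. 4 * a * vol P)"
        by (simp add: sum_distrib_left)
      also have "\<dots> \<le> (\<Sum>P\<in>GH. mean_norm u P * vol P)"
        by (intro sum_mono mult_right_mono) (auto simp: GH_def H_def)
      also have "\<dots> \<le> a * vol Q"
        unfolding a_def by (rule mean_norm_disjoint_sum[OF u Q GH])
      finally show ?thesis using a by simp
    qed
    define B where "B = {R\<in>F. R \<subseteq> Q \<and> bad_pair sc C u F Q R \<and> \<not> (\<exists>P\<in>G. H P \<and> R \<subseteq> P)}"
    have B: "finite B" "B \<subseteq> dyadic_cubes" using F by (auto simp: B_def)
    have UB: "\<Union>B \<in> fmeasurable lebesgue" using B fm by (intro fmeasurable.finite_Union) auto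
    have "(C * a)\<^sup>2 * vol (\<Union>B) \<le> (K * A)\<^sup>2 * vol Q"
    proof (rule rmf_chebyshev[OF rmf _ Q G GA A0 g_def UB])
      show "0 \<le> K" "0 \<le> C * a" using K C0 a by auto
      fix x assume "x \<in> \<Union>B"
      then obtain R where R: "x \<in> R" "R \<in> F" "R \<subseteq> Q" "bad_pair sc C u F Q R" "\<not> (\<exists>P\<in>G. H P \<and> R \<subseteq> P)"
        unfolding B_def by blast
      show "ennreal (C * a) \<le> rademacher_maximal sc g x"
        unfolding a_def
      proof (rule bad_pair_rademacher_maximal[OF sc C0 F R(4) _ R(1)])
        fix P assume P: "P \<in> F" "R \<subseteq> P" "P \<subseteq> Q"
        obtain y where y: "P = cell (lev P) y" using lev[OF P(1)] by blast
        have "\<forall>P'\<in>G. P' \<subseteq> P \<or> P' \<inter> P = {}"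
          using Gsub[rule_format, of "lev P" y] R(5) P(2,3) j(2)[OF P(1)] unfolding y[symmetric] by blast
        then show "average P g = average P u"
          unfolding g_def using P F(2) by (intro average_conditional_expectation[OF u G]) auto
      qed
    qed
    moreover have "(C * a)\<^sup>2 = (K * A)\<^sup>2 * 4" by (simp add: C A_def power_mult_distrib)
    ultimately have "(K * A)\<^sup>2 * (4 * vol (\<Union>B)) \<le> (K * A)\<^sup>2 * vol Q"
      by (simp only: mult.assoc)
    moreover have "0 < (K * A)\<^sup>2" using K a by (simp add: A_def)
    ultimately have mB: "4 * vol (\<Union>B) \<le> vol Q"
      by (rule mult_left_le_imp_le)
    have "vol (\<Union>{R\<in>F. R \<subseteq> Q \<and> bad_pair sc C u F Q R}) \<le> vol (\<Union>GH \<union> \<Union>B)"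
    proof (rule measure_mono_fmeasurable)
      show "\<Union>{R\<in>F. R \<subseteq> Q \<and> bad_pair sc C u F Q R} \<subseteq> \<Union>GH \<union> \<Union>B"
        unfolding GH_def B_def by blast
      show "\<Union>{R\<in>F. R \<subseteq> Q \<and> bad_pair sc C u F Q R} \<in> sets lebesgue"
        using F sets_dyadic by (intro sets.finite_Union) auto
      show "\<Union>GH \<union> \<Union>B \<in> fmeasurable lebesgue"
        using GH fm by (intro fmeasurable.Un UB) (auto intro!: fmeasurable.finite_Union)
    qed
    also have "\<dots> \<le> vol (\<Union>GH) + vol (\<Union>B)"
    proof (rule measure_Un_le)
      show "\<Union>GH \<in> sets lebesgue" using GH sets_dyadic by (intro sets.finite_Union) auto
      show "\<Union>B \<in> sets lebesgue" using UB by (rule fmeasurableD)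
    qed
    also have "\<dots> \<le> vol Q / 2" using mOmega mB by simp
    finally show ?thesis .
  qed
qed

text \<open>
  The disjoint sets \<open>E Q\<close> bound the total volume of the cubes by twice that of their union, however much
  the cubes overlap.
\<close>

definition sparse_family :: "(real ^ 'n::finite) set set \<Rightarrow> ((real ^ 'n) set \<Rightarrow> (real ^ 'n) set) \<Rightarrow> bool" where
  "sparse_family S E \<longleftrightarrow> finite S \<and> S \<subseteq> dyadic_cubes \<and> disjoint_family_on E S \<and>
     (\<forall>Q\<in>S. E Q \<in> sets lebesgue \<and> E Q \<subseteq> Q \<and> vol Q \<le> 2 * vol (E Q))"

text \<open>
  \<open>E Q\<close> is what the bad cubes leave of \<open>Q\<close>. A principal cube strictly inside \<open>Q\<close> forms a bad pair with
  \<open>Q\<close>, so it is disjoint from \<open>E Q\<close>.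
\<close>

lemma principal_cubes:
  fixes sc :: "'k::real_normed_field \<Rightarrow> 'x::banach \<Rightarrow> 'x"
    and u :: "real ^ 'n::finite \<Rightarrow> 'x"
  assumes sc: "normed_space_over sc"
    and rmf: "\<And>u :: real ^ 'n \<Rightarrow> 'x. u \<in> Lp_space 2 \<Longrightarrow>
        Lp_norm 2 (rademacher_maximal sc u) \<le> ennreal K * Lp_norm 2 (\<lambda>x. ennreal (norm (u x)))"
    and K: "1 \<le> K" and C: "C = 8 * 2 ^ CARD('n) * K"
    and u: "loc_integrable u"
    and F: "finite F" "F \<subseteq> dyadic_cubes"
  shows "\<exists>S E. S \<subseteq> F \<and> sparse_family S E \<and> (\<forall>R\<in>F. \<exists>Q\<in>S. R \<subseteq> Q \<and> \<not> bad_pair sc C u F Q R)"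
proof -
  let ?bad = "bad_pair sc C u F"
  have C1: "1 \<le> C"
  proof -
    have "1 * 1 \<le> (8 * 2 ^ CARD('n)) * K"
      using K by (intro mult_mono) (auto intro: order_trans[of _ "8"])
    then show ?thesis by (simp add: C)
  qed
  have "\<exists>S\<subseteq>F. (\<forall>R\<in>F. \<exists>Q\<in>S. R \<subseteq> Q \<and> \<not> ?bad Q R) \<and> (\<forall>Q\<in>S. \<forall>Q'\<in>S. Q' \<subset> Q \<longrightarrow> ?bad Q Q')"
  proof (rule stopping_family[OF F(1)])
    fix P Q R assume PQR: "P \<in> F" "Q \<in> F" "R \<in> F" "R \<subseteq> P" "R \<subseteq> Q"
    then obtain z where "z \<in> R" using dyadic_cubes_nonempty F(2) by blast
    then show "P \<subseteq> Q \<or> Q \<subseteq> P" using PQR F(2) by (intro dyadic_cubes_nested[of P Q z]) auto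
  next
    fix Q assume Q: "Q \<in> F"
    show "\<not> ?bad Q Q"
    proof
      assume "?bad Q Q"
      then obtain l where l: "rad 1 {P\<in>F. Q \<subseteq> P \<and> P \<subseteq> Q} (\<lambda>P. sc (l P) (average P u))
          > C * mean_norm u Q * L2_set (\<lambda>P. norm (l P)) {P\<in>F. Q \<subseteq> P \<and> P \<subseteq> Q}"
        unfolding bad_pair_def by blast
      have J: "{P\<in>F. Q \<subseteq> P \<and> P \<subseteq> Q} = {Q}" using Q by auto
      have "rad 1 {Q} (\<lambda>P. sc (l P) (average P u)) = norm (l Q) * norm (average Q u)"
      proof -
        have "rad 1 (insert Q {}) (\<lambda>P. sc (l P) (average P u)) = norm (sc (l Q) (average Q u))"
          unfolding rad_1 by (subst sign_mean_insert) auto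
        then show ?thesis using normed_space_overD(4)[OF sc] by simp
      qed
      also have "\<dots> \<le> norm (l Q) * (C * mean_norm u Q)"
      proof (rule mult_left_mono)
        have "norm (average Q u) \<le> mean_norm u Q" using Q F(2) by (intro norm_average_le[OF u]) auto
        also have "\<dots> \<le> C * mean_norm u Q"
          using C1 mean_norm_nonneg[of u Q] mult_right_mono[of 1 C "mean_norm u Q"] by simp
        finally show "norm (average Q u) \<le> C * mean_norm u Q" .
      qed simp
      finally show False using l by (simp add: J L2_set_def mult.commute)
    qed
  next
    fix Q R R' assume QR: "Q \<in> F" "R \<in> F" "R' \<in> F" "R' \<subseteq> R" "R \<subseteq> Q" "?bad Q R"
    let ?J = "{P\<in>F. R \<subseteq> P \<and> P \<subseteq> Q}" and ?J' = "{P\<in>F. R' \<subseteq> P \<and> P \<subseteq> Q}"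
    have sub: "?J \<subseteq> ?J'" "finite ?J'" using QR(4) F(1) by auto
    obtain l where l: "rad 1 ?J (\<lambda>P. sc (l P) (average P u))
          > C * mean_norm u Q * L2_set (\<lambda>P. norm (l P)) ?J"
      using QR(6) unfolding bad_pair_def by blast
    define l' where "l' P = (if P \<in> ?J then l P else 0)" for P
    have "rad 1 ?J' (\<lambda>P. sc (l' P) (average P u)) = rad 1 ?J (\<lambda>P. sc (l' P) (average P u))"
      using sub normed_space_overD(1)[OF sc] by (intro rad_neutral) (auto simp: l'_def)
    also have "\<dots> = rad 1 ?J (\<lambda>P. sc (l P) (average P u))"
      by (rule rad_cong) (simp add: l'_def)
    finally have r: "rad 1 ?J' (\<lambda>P. sc (l' P) (average P u)) = rad 1 ?J (\<lambda>P. sc (l P) (average P u))" .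
    have "(\<Sum>P\<in>?J'. (norm (l' P))\<^sup>2) = (\<Sum>P\<in>?J. (norm (l' P))\<^sup>2)"
      using sub by (intro sum.mono_neutral_right) (auto simp: l'_def)
    also have "\<dots> = (\<Sum>P\<in>?J. (norm (l P))\<^sup>2)"
      by (rule sum.cong) (auto simp: l'_def)
    finally have "L2_set (\<lambda>P. norm (l' P)) ?J' = L2_set (\<lambda>P. norm (l P)) ?J"
      by (simp add: L2_set_def)
    then show "?bad Q R'"
      unfolding bad_pair_def using l r by (intro exI[of _ l']) simp
  qed
  then obtain S where S: "S \<subseteq> F" "\<forall>R\<in>F. \<exists>Q\<in>S. R \<subseteq> Q \<and> \<not> ?bad Q R"
    and nested: "\<forall>Q\<in>S. \<forall>Q'\<in>S. Q' \<subset> Q \<longrightarrow> ?bad Q Q'" by (elim exE conjE)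
  define E where "E Q = Q - \<Union>{R\<in>F. R \<subseteq> Q \<and> ?bad Q R}" for Q
  have "sparse_family S E"
    unfolding sparse_family_def
  proof (intro conjI ballI)
    show "finite S" "S \<subseteq> dyadic_cubes" using S(1) F finite_subset by auto
    have empty: "E Q \<inter> E Q' = {}" if h: "Q \<in> S" "Q' \<in> S" "Q' \<subset> Q" for Q Q'
    proof -
      have "?bad Q Q'" using nested h by blast
      then have "Q' \<subseteq> \<Union>{R\<in>F. R \<subseteq> Q \<and> ?bad Q R}" using h S(1) by blast
      then show ?thesis unfolding E_def by blast
    qed
    show "disjoint_family_on E S"
      unfolding disjoint_family_on_def
    proof (intro ballI impI)
      fix Q Q' assume h: "Q \<in> S" "Q' \<in> S" "Q \<noteq> Q'"
      show "E Q \<inter> E Q' = {}"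
      proof (rule ccontr)
        assume "E Q \<inter> E Q' \<noteq> {}"
        then obtain z where "z \<in> Q" "z \<in> Q'" unfolding E_def by blast
        then have "Q \<subseteq> Q' \<or> Q' \<subseteq> Q"
          using h S(1) F(2) by (intro dyadic_cubes_nested[of Q Q' z]) auto
        then have "Q \<subset> Q' \<or> Q' \<subset> Q" using h(3) by auto
        then show False using empty[of Q Q'] empty[of Q' Q] h \<open>E Q \<inter> E Q' \<noteq> {}\<close> by (auto simp: Int_commute)
      qed
    qed
    fix Q assume Q: "Q \<in> S"
    have QF: "Q \<in> F" "Q \<in> dyadic_cubes" using Q S(1) F(2) by auto
    let ?B = "\<Union>{R\<in>F. R \<subseteq> Q \<and> ?bad Q R}"
    have B: "?B \<in> sets lebesgue" "?B \<subseteq> Q" using F sets_dyadic by (auto intro!: sets.finite_Union)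
    show "E Q \<in> sets lebesgue" unfolding E_def using B sets_dyadic[OF QF(2)] by blast
    show "E Q \<subseteq> Q" by (auto simp: E_def)
    have "vol (E Q) = vol Q - vol ?B"
      unfolding E_def using B fmeasurable_dyadic[OF QF(2)] by (intro measurable_measure_Diff) auto
    moreover have "vol ?B \<le> vol Q / 2"
      using K by (intro local_weak_type[OF sc rmf _ C u F QF(1)]) auto
    ultimately show "vol Q \<le> 2 * vol (E Q)" by simp
  qed
  then show ?thesis using S by blast
qed

section \<open>Carleson's embedding theorem for scalar functions\<close>

text \<open>
  A geometric series, dominated by its largest term.
\<close>

lemma sum_two_powr_int_le:
  fixes t s :: real
  assumes J: "finite J" and t: "\<And>j. j \<in> J \<Longrightarrow> 2 powr real_of_int j < t" and s: "0 < s"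
  shows "(\<Sum>j\<in>J. 2 powr (real_of_int j * s)) \<le> t powr s / (1 - 2 powr (- s))"
proof (cases "J = {}")
  case True
  have "2 powr (- s) < (1::real)" using s by (simp add: powr_less_one)
  then show ?thesis using True by simp
next
  case False
  define m where "m = Max J"
  have m: "m \<in> J" "\<And>j. j \<in> J \<Longrightarrow> j \<le> m" using J False by (auto simp: m_def)
  define r :: real where "r = 2 powr (- s)"
  have r: "0 < r" "r < 1" using s by (auto simp: r_def powr_less_one)
  let ?f = "\<lambda>j. nat (m - j)"
  have inj: "inj_on ?f J" 
  proof (rule inj_onI)
    fix x y assume "x \<in> J" "y \<in> J" "?f x = ?f y"
    then show "x = y" using m(2)[of x] m(2)[of y] by simp
  qed
  have "(\<Sum>j\<in>J. 2 powr (real_of_int j * s)) = (\<Sum>j\<in>J. 2 powr (real_of_int m * s) * r ^ ?f j)"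
  proof (rule sum.cong)
    fix j assume j: "j \<in> J"
    have "r ^ ?f j = r powr real (?f j)" using r by (simp add: powr_realpow)
    also have "\<dots> = 2 powr (- s * (real_of_int m - real_of_int j))"
      using m(2)[OF j] by (simp add: r_def powr_powr)
    finally show "2 powr (real_of_int j * s) = 2 powr (real_of_int m * s) * r ^ ?f j"
      by (simp add: algebra_simps flip: powr_add)
  qed simp
  also have "\<dots> = 2 powr (real_of_int m * s) * (\<Sum>i\<in>?f ` J. r ^ i)"
    using inj by (simp add: sum.reindex sum_distrib_left)
  also have "\<dots> \<le> 2 powr (real_of_int m * s) * (1 / (1 - r))"
  proof (rule mult_left_mono)
    have "(\<Sum>i\<in>?f ` J. r ^ i) \<le> (\<Sum>i. r ^ i)"
      using r J by (intro sum_le_suminf summable_geometric) auto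
    then show "(\<Sum>i\<in>?f ` J. r ^ i) \<le> 1 / (1 - r)" using r by (simp add: suminf_geometric)
  qed simp
  also have "2 powr (real_of_int m * s) = (2 powr real_of_int m) powr s" by (simp add: powr_powr)
  also have "(2 powr real_of_int m) powr s * (1 / (1 - r)) \<le> t powr s * (1 / (1 - r))"
    using t[OF m(1)] s r by (intro mult_right_mono powr_mono2) auto
  finally show ?thesis by (simp add: r_def)
qed

text \<open>
  The weak type inequality of the dyadic maximal function, weighted by a sparse family. Where the mean of
  \<open>w\<close> over \<open>Q\<close> is at least \<open>t\<close>, the part of \<open>w\<close> below \<open>t / 2\<close> accounts for at most half of it. By sparseness
  the total volume of the cubes is at most twice that of their union, which is a disjoint union of
  maximal cubes.
\<close>

lemma sparse_packing:
  fixes w :: "real ^ 'n::finite \<Rightarrow> real"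
  assumes S: "sparse_family S E" and w: "w \<in> borel_measurable lebesgue" "\<And>x. 0 \<le> w x"
    and c: "\<And>Q. Q \<in> S \<Longrightarrow> ennreal (c Q * vol Q) \<le> (\<integral>\<^sup>+x\<in>Q. ennreal (w x) \<partial>lebesgue)"
    and T: "T \<subseteq> S" "\<And>Q. Q \<in> T \<Longrightarrow> t \<le> c Q" and t: "0 < t"
  shows "ennreal (\<Sum>Q\<in>T. vol Q) \<le>
    ennreal (4 / t) * (\<integral>\<^sup>+x. ennreal (w x) * indicator {x. t / 2 < w x} x \<partial>lebesgue)"
proof -
  have fin: "finite T" "T \<subseteq> dyadic_cubes" using S T finite_subset unfolding sparse_family_def by blast+
  let ?h = "\<lambda>x. ennreal (w x) * indicator {x. t / 2 < w x} x"
  have hm: "?h \<in> borel_measurable lebesgue" using w(1) by measurable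
  obtain G where G: "G \<subseteq> T" "disjoint G" "\<Union>G = \<Union>T"
    using maximal_disjoint_dyadic[OF fin] by metis
  have fG: "finite G" "G \<subseteq> dyadic_cubes" using G fin finite_subset by auto
  have fm: "P \<in> fmeasurable lebesgue" if "P \<in> dyadic_cubes" for P :: "(real ^ 'n) set"
    using that by (rule fmeasurable_dyadic)
  have one: "ennreal (vol Q) \<le> ennreal (2 / t) * (\<integral>\<^sup>+x\<in>Q. ?h x \<partial>lebesgue)" if Q: "Q \<in> T" for Q
  proof -
    have Qd: "Q \<in> dyadic_cubes" using Q fin by blast
    have "ennreal (t * vol Q) \<le> ennreal (c Q * vol Q)"
      using T(2)[OF Q] by (intro ennreal_leI mult_right_mono) auto
    also have "\<dots> \<le> (\<integral>\<^sup>+x\<in>Q. ennreal (w x) \<partial>lebesgue)" using c Q T(1) by blast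
    also have "\<dots> \<le> (\<integral>\<^sup>+x. ?h x * indicator Q x + ennreal (t / 2) * indicator Q x \<partial>lebesgue)"
      using t by (intro nn_integral_mono) (auto simp: indicator_def not_less intro!: ennreal_leI)
    also have "\<dots> = (\<integral>\<^sup>+x\<in>Q. ?h x \<partial>lebesgue) + ennreal (t / 2) * emeasure lebesgue Q"
      using hm sets_dyadic[OF Qd] by (subst nn_integral_add) (auto simp: nn_integral_cmult_indicator)
    also have "ennreal (t / 2) * emeasure lebesgue Q = ennreal (t / 2 * vol Q)"
      using t by (subst emeasure_dyadic[OF Qd], subst ennreal_mult) auto
    finally have le: "ennreal (t * vol Q) \<le> (\<integral>\<^sup>+x\<in>Q. ?h x \<partial>lebesgue) + ennreal (t / 2 * vol Q)" .
    show ?thesis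
    proof (cases "\<integral>\<^sup>+x\<in>Q. ?h x \<partial>lebesgue")
      case (real m)
      then have "ennreal (t * vol Q) \<le> ennreal (m + t / 2 * vol Q)"
        using le t by (simp add: ennreal_plus)
      then have "t * vol Q \<le> m + t / 2 * vol Q"
        using real t by (subst (asm) ennreal_le_iff) auto
      then have "vol Q \<le> 2 / t * m" using t by (simp add: field_simps)
      then show ?thesis using real t by (auto simp flip: ennreal_mult intro: ennreal_leI)
    next
      case top
      then show ?thesis using t by (simp add: ennreal_mult_top)
    qed
  qed
  have "(\<Sum>Q\<in>T. vol Q) \<le> (\<Sum>Q\<in>T. 2 * vol (E Q))"
    using S T(1) unfolding sparse_family_def by (intro sum_mono) blast
  also have "\<dots> = 2 * vol (\<Union>Q\<in>T. E Q)"
  proof -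
    have "vol (\<Union>(E ` T)) = (\<Sum>Q\<in>T. vol (E Q))"
    proof (rule measure_finite_Union[OF fin(1)])
      show "E ` T \<subseteq> sets lebesgue" using S T(1) unfolding sparse_family_def by blast
      show "disjoint_family_on E T"
        using S T(1) unfolding sparse_family_def by (blast intro: disjoint_family_on_mono)
      show "emeasure lebesgue (E Q) \<noteq> \<infinity>" if Q: "Q \<in> T" for Q
      proof -
        have "emeasure lebesgue (E Q) \<le> emeasure lebesgue Q"
          using S T(1) Q sets_dyadic unfolding sparse_family_def by (intro emeasure_mono) blast+
        moreover have "Q \<in> dyadic_cubes" using Q fin by blast
        ultimately show ?thesis by (auto simp: emeasure_dyadic top_unique)
      qed
    qed
    then show ?thesis by (simp add: sum_distrib_left)
  qed
  also have "\<dots> \<le> 2 * vol (\<Union>G)"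
  proof (rule mult_left_mono, rule measure_mono_fmeasurable)
    show "(\<Union>Q\<in>T. E Q) \<subseteq> \<Union>G" using S T(1) unfolding G(3) sparse_family_def by blast
    show "(\<Union>Q\<in>T. E Q) \<in> sets lebesgue"
      using fin(1) S T(1) unfolding sparse_family_def by (intro sets.finite_UN) blast+
    show "\<Union>G \<in> fmeasurable lebesgue" using fG fm by (intro fmeasurable.finite_Union) auto
  qed simp
  also have "vol (\<Union>G) = (\<Sum>P\<in>G. vol P)"
    using G(2) fG fm by (intro measure_Union') auto
  finally have "ennreal (\<Sum>Q\<in>T. vol Q) \<le> ennreal (2 * (\<Sum>P\<in>G. vol P))"
    by (rule ennreal_leI)
  also have "\<dots> = ennreal 2 * (\<Sum>P\<in>G. ennreal (vol P))"
    by (subst sum_ennreal) (auto simp: ennreal_mult sum_nonneg)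
  also have "\<dots> \<le> ennreal 2 * (\<Sum>P\<in>G. ennreal (2 / t) * (\<integral>\<^sup>+x\<in>P. ?h x \<partial>lebesgue))"
    using one G(1) by (intro mult_left_mono sum_mono) auto
  also have "\<dots> = ennreal (4 / t) * (\<Sum>P\<in>G. \<integral>\<^sup>+x\<in>P. ?h x \<partial>lebesgue)"
  proof -
    have "ennreal 2 * ennreal (2 / t) = ennreal (4 / t)" using t by (subst ennreal_mult[symmetric]) auto
    then show ?thesis by (simp only: sum_distrib_left[symmetric] mult.assoc[symmetric])
  qed
  also have "\<dots> \<le> ennreal (4 / t) * (\<integral>\<^sup>+x\<in>UNIV. ?h x \<partial>lebesgue)"
    using fG G(2) hm sets_dyadic by (intro mult_left_mono nn_integral_disjoint_sum_le) auto
  finally show ?thesis by simp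
qed

text \<open>
  Sort the cubes by the dyadic size \<open>2 ^ j\<close> of \<open>c Q\<close> and apply the packing estimate on each level. After
  exchanging sum and integral, the levels with \<open>2 ^ j < 2 * w x\<close> contribute a geometric series of ratio
  \<open>2 powr (r - 1)\<close>, which is where \<open>r > 1\<close> is needed.
\<close>

theorem carleson_embedding:
  fixes r :: real
  assumes r: "1 < r"
  shows "\<exists>C>0. \<forall>S E (w :: real ^ 'n::finite \<Rightarrow> real) (c :: (real ^ 'n) set \<Rightarrow> real).
    sparse_family S E \<longrightarrow> w \<in> borel_measurable lebesgue \<longrightarrow> (\<forall>x. 0 \<le> w x) \<longrightarrow> (\<forall>Q\<in>S. 0 \<le> c Q) \<longrightarrow>
    (\<forall>Q\<in>S. ennreal (c Q * vol Q) \<le> (\<integral>\<^sup>+x\<in>Q. ennreal (w x) \<partial>lebesgue)) \<longrightarrow>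
    ennreal (\<Sum>Q\<in>S. c Q powr r * vol Q) \<le> ennreal C * (\<integral>\<^sup>+x. ennreal (w x powr r) \<partial>lebesgue)"
proof -
  define s where "s = r - 1"
  have s: "0 < s" using r by (simp add: s_def)
  have lt1: "2 powr (- s) < (1::real)" using s by (simp add: powr_less_one)
  define C :: real where "C = 4 * 2 powr r * (2 powr s / (1 - 2 powr (- s)))"
  have C: "0 < C" using lt1 by (simp add: C_def)
  show ?thesis
  proof (intro exI[of _ C] conjI C allI impI)
    fix S E and w :: "real ^ 'n \<Rightarrow> real" and c :: "(real ^ 'n) set \<Rightarrow> real"
    assume S: "sparse_family S E" and w: "w \<in> borel_measurable lebesgue" "\<forall>x. 0 \<le> w x"
      and c0: "\<forall>Q\<in>S. 0 \<le> c Q"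
      and c: "\<forall>Q\<in>S. ennreal (c Q * vol Q) \<le> (\<integral>\<^sup>+x\<in>Q. ennreal (w x) \<partial>lebesgue)"
    define S' where "S' = {Q\<in>S. c Q \<noteq> 0}"
    have S': "finite S'" "S' \<subseteq> S" using S by (auto simp: S'_def sparse_family_def)
    have cpos: "0 < c Q" if "Q \<in> S'" for Q using that c0 by (auto simp: S'_def less_le)
    \<comment> \<open>Cubes with \<open>c Q = 0\<close> have no level and are removed first.\<close>
    define lev where "lev Q = \<lfloor>log 2 (c Q)\<rfloor>" for Q
    have lev: "2 powr real_of_int (lev Q) \<le> c Q" "c Q powr r \<le> 2 powr (real_of_int (lev Q) * r) * 2 powr r"
      if "Q \<in> S'" for Q
    proof -
      have p: "0 < c Q" using cpos that .
      have "real_of_int (lev Q) \<le> log 2 (c Q)" unfolding lev_def by simp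
      then have "2 powr real_of_int (lev Q) \<le> 2 powr log 2 (c Q)" by simp
      then show "2 powr real_of_int (lev Q) \<le> c Q" using p by simp
      have "log 2 (c Q) \<le> real_of_int (lev Q) + 1" unfolding lev_def by linarith
      then have "2 powr log 2 (c Q) \<le> 2 powr (real_of_int (lev Q) + 1)" by simp
      then have "c Q powr r \<le> (2 powr (real_of_int (lev Q) + 1)) powr r"
        using p r by (intro powr_mono2) auto
      also have "\<dots> = 2 powr (real_of_int (lev Q) * r) * 2 powr r"
        by (simp add: powr_powr algebra_simps flip: powr_add)
      finally show "c Q powr r \<le> 2 powr (real_of_int (lev Q) * r) * 2 powr r" .
    qed
    let ?J = "lev ` S'"
    let ?h = "\<lambda>j x. ennreal (w x) * indicator {x. 2 powr real_of_int j / 2 < w x} x"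
    have hm: "?h j \<in> borel_measurable lebesgue" for j using w(1) by measurable
    have "(\<Sum>Q\<in>S. c Q powr r * vol Q) = (\<Sum>Q\<in>S'. c Q powr r * vol Q)"
      using S by (intro sum.mono_neutral_right) (auto simp: S'_def sparse_family_def)
    also have "\<dots> \<le> (\<Sum>Q\<in>S'. 2 powr (real_of_int (lev Q) * r) * 2 powr r * vol Q)"
      using lev(2) by (intro sum_mono mult_right_mono) auto
    also have "\<dots> = (\<Sum>j\<in>?J. 2 powr (real_of_int j * r) * 2 powr r * (\<Sum>Q | Q \<in> S' \<and> lev Q = j. vol Q))"
      unfolding sum.image_gen[OF S'(1), of "\<lambda>Q. 2 powr (real_of_int (lev Q) * r) * 2 powr r * vol Q" lev]
      by (auto simp: sum_distrib_left intro!: sum.cong)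
    finally have "ennreal (\<Sum>Q\<in>S. c Q powr r * vol Q)
        \<le> ennreal (\<Sum>j\<in>?J. 2 powr (real_of_int j * r) * 2 powr r * (\<Sum>Q | Q \<in> S' \<and> lev Q = j. vol Q))"
      by (rule ennreal_leI)
    also have "\<dots> = (\<Sum>j\<in>?J. ennreal (2 powr (real_of_int j * r) * 2 powr r) * ennreal (\<Sum>Q | Q \<in> S' \<and> lev Q = j. vol Q))"
      by (subst sum_ennreal[symmetric]) (auto simp: ennreal_mult sum_nonneg)
    also have "\<dots> \<le> (\<Sum>j\<in>?J. ennreal (2 powr (real_of_int j * r) * 2 powr r) *
        (ennreal (4 / 2 powr real_of_int j) * (\<integral>\<^sup>+x. ?h j x \<partial>lebesgue)))"
    proof (intro sum_mono mult_left_mono)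
      fix j
      show "ennreal (\<Sum>Q | Q \<in> S' \<and> lev Q = j. vol Q) \<le> ennreal (4 / 2 powr real_of_int j) * (\<integral>\<^sup>+x. ?h j x \<partial>lebesgue)"
        using S' lev(1) w c by (intro sparse_packing[OF S]) auto
    qed simp
    also have "\<dots> = (\<Sum>j\<in>?J. \<integral>\<^sup>+x. ennreal (4 * 2 powr r * 2 powr (real_of_int j * s)) * ?h j x \<partial>lebesgue)"
    proof (rule sum.cong)
      fix j
      have "2 powr (real_of_int j * r) * 2 powr r * (4 / 2 powr real_of_int j) = 4 * 2 powr r * 2 powr (real_of_int j * s)"
        by (simp add: s_def algebra_simps powr_diff)
      then have "ennreal (2 powr (real_of_int j * r) * 2 powr r) * ennreal (4 / 2 powr real_of_int j)
          = ennreal (4 * 2 powr r * 2 powr (real_of_int j * s))"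
        by (subst ennreal_mult[symmetric]) auto
      then show "ennreal (2 powr (real_of_int j * r) * 2 powr r) *
          (ennreal (4 / 2 powr real_of_int j) * (\<integral>\<^sup>+x. ?h j x \<partial>lebesgue))
          = (\<integral>\<^sup>+x. ennreal (4 * 2 powr r * 2 powr (real_of_int j * s)) * ?h j x \<partial>lebesgue)"
        unfolding nn_integral_cmult[OF hm] by (simp only: mult.assoc[symmetric])
    qed simp
    also have "\<dots> = (\<integral>\<^sup>+x. (\<Sum>j\<in>?J. ennreal (4 * 2 powr r * 2 powr (real_of_int j * s)) * ?h j x) \<partial>lebesgue)"
      using hm by (subst nn_integral_sum) auto
    also have "\<dots> \<le> (\<integral>\<^sup>+x. ennreal C * ennreal (w x powr r) \<partial>lebesgue)"
    proof (rule nn_integral_mono)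
      fix x
      let ?Jx = "{j\<in>?J. 2 powr real_of_int j / 2 < w x}"
      have wx: "0 \<le> w x" using w by simp
      have "(\<Sum>j\<in>?J. ennreal (4 * 2 powr r * 2 powr (real_of_int j * s)) * ?h j x)
          = (\<Sum>j\<in>?Jx. ennreal (4 * 2 powr r * 2 powr (real_of_int j * s) * w x))"
        using S'(1) wx by (intro sum.mono_neutral_cong_right) (auto simp: ennreal_mult)
      also have "\<dots> = ennreal (4 * 2 powr r * (\<Sum>j\<in>?Jx. 2 powr (real_of_int j * s)) * w x)"
        using wx by (subst sum_ennreal) (auto simp: sum_distrib_left sum_distrib_right)
      also have "\<dots> \<le> ennreal (4 * 2 powr r * ((2 * w x) powr s / (1 - 2 powr (- s))) * w x)"
        using S'(1) s wx by (intro ennreal_leI mult_right_mono mult_left_mono sum_two_powr_int_le) auto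
      also have "4 * 2 powr r * ((2 * w x) powr s / (1 - 2 powr (- s))) * w x = C * w x powr r"
      proof (cases "w x = 0")
        case False
        then have "w x powr r = w x powr s * w x" using wx by (simp add: s_def powr_diff)
        then show ?thesis using wx by (simp add: C_def powr_mult)
      qed simp
      finally show "(\<Sum>j\<in>?J. ennreal (4 * 2 powr r * 2 powr (real_of_int j * s)) * ?h j x) \<le> ennreal C * ennreal (w x powr r)"
        using C by (simp add: ennreal_mult)
    qed
    also have "\<dots> = ennreal C * (\<integral>\<^sup>+x. ennreal (w x powr r) \<partial>lebesgue)"
      using w(1) by (intro nn_integral_cmult) measurable
    finally show "ennreal (\<Sum>Q\<in>S. c Q powr r * vol Q) \<le> ennreal C * (\<integral>\<^sup>+x. ennreal (w x powr r) \<partial>lebesgue)" .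
  qed
qed

section \<open>Sums over sparse families\<close>

text \<open>
  By Young's inequality for \<open>f x / a\<close> and \<open>g x / b\<close>. If \<open>a\<close> or \<open>b\<close> vanishes, one of the functions vanishes
  almost everywhere.
\<close>

lemma nn_integral_Holder:
  fixes f g :: "'a \<Rightarrow> real"
  assumes f: "f \<in> borel_measurable M" "\<And>x. 0 \<le> f x" and g: "g \<in> borel_measurable M" "\<And>x. 0 \<le> g x"
    and q: "1 < q" "1 < q'" "1 / q + 1 / q' = 1" and ab: "0 \<le> a" "0 \<le> b"
    and fa: "(\<integral>\<^sup>+x. ennreal (f x powr q) \<partial>M) \<le> ennreal (a powr q)"
    and gb: "(\<integral>\<^sup>+x. ennreal (g x powr q') \<partial>M) \<le> ennreal (b powr q')"
  shows "(\<integral>\<^sup>+x. ennreal (f x * g x) \<partial>M) \<le> ennreal (a * b)"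
proof -
  have z: "(\<integral>\<^sup>+x. ennreal (f x * g x) \<partial>M) = 0"
    if h: "h \<in> borel_measurable M" "(\<integral>\<^sup>+x. ennreal (h x powr e) \<partial>M) \<le> 0" "\<And>x. h x = 0 \<Longrightarrow> f x * g x = 0" for h e
  proof -
    have "AE x in M. ennreal (h x powr e) = 0"
      using h(1,2) by (subst nn_integral_0_iff_AE[symmetric]) auto
    then have "AE x in M. ennreal (f x * g x) = 0"
    proof eventually_elim
      fix x assume "ennreal (h x powr e) = 0"
      then have "h x = 0" by (simp add: ennreal_eq_0_iff)
      then have "f x * g x = 0" by (rule h(3))
      then show "ennreal (f x * g x) = 0" by (metis ennreal_0)
    qed
    then show ?thesis using f g by (subst nn_integral_0_iff_AE) auto
  qed
  consider "a = 0" | "b = 0" | "0 < a" "0 < b" using ab by linarith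
  then show ?thesis
  proof cases
    case 1
    then show ?thesis using z[OF f(1), of q] fa by simp
  next
    case 2
    then show ?thesis using z[OF g(1), of q'] gb by simp
  next
    case 3
    have "(\<integral>\<^sup>+x. ennreal (f x * g x) \<partial>M) \<le>
        (\<integral>\<^sup>+x. ennreal (a * b / (q * a powr q)) * ennreal (f x powr q) + ennreal (a * b / (q' * b powr q')) * ennreal (g x powr q') \<partial>M)"
    proof (rule nn_integral_mono)
      fix x
      have "(f x / a) * (g x / b) \<le> (f x / a) powr q / q + (g x / b) powr q' / q'"
        using q 3 f(2) g(2) by (intro Youngs_inequality) auto
      then have "a * b * ((f x / a) * (g x / b)) \<le> a * b * ((f x / a) powr q / q + (g x / b) powr q' / q')"
        using 3 by (intro mult_left_mono) auto
      also have "\<dots> = a * b / (q * a powr q) * f x powr q + a * b / (q' * b powr q') * g x powr q'"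
        using 3 f(2) g(2) by (simp add: powr_divide algebra_simps)
      finally have "f x * g x \<le> a * b / (q * a powr q) * f x powr q + a * b / (q' * b powr q') * g x powr q'"
        using 3 by simp
      then show "ennreal (f x * g x) \<le> ennreal (a * b / (q * a powr q)) * ennreal (f x powr q)
          + ennreal (a * b / (q' * b powr q')) * ennreal (g x powr q')"
        using 3 q by (simp add: ennreal_leI flip: ennreal_mult ennreal_plus)
    qed
    also have "\<dots> = ennreal (a * b / (q * a powr q)) * (\<integral>\<^sup>+x. ennreal (f x powr q) \<partial>M)
        + ennreal (a * b / (q' * b powr q')) * (\<integral>\<^sup>+x. ennreal (g x powr q') \<partial>M)"
      using f(1) g(1) by (simp add: nn_integral_add nn_integral_cmult)
    also have "\<dots> \<le> ennreal (a * b / (q * a powr q)) * ennreal (a powr q) + ennreal (a * b / (q' * b powr q')) * ennreal (b powr q')"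
      by (intro add_mono mult_left_mono fa gb) auto
    also have "\<dots> = ennreal (a * b / (q * a powr q) * a powr q + a * b / (q' * b powr q') * b powr q')"
      using 3 q by (simp flip: ennreal_mult ennreal_plus)
    also have "a * b / (q * a powr q) * a powr q + a * b / (q' * b powr q') * b powr q' = a * b * (1 / q + 1 / q')"
      using 3 by (simp add: algebra_simps)
    finally show ?thesis using q by simp
  qed
qed

text \<open>
  Functions living on the cubes of \<open>S\<close>, with mean \<open>q\<close>-th power at most \<open>D powr q\<close>: this is all that is
  retained of the Carleson norm.
\<close>

definition carleson_functions ::
    "real \<Rightarrow> real \<Rightarrow> (real ^ 'n::finite) set set \<Rightarrow> ((real ^ 'n) set \<Rightarrow> real ^ 'n \<Rightarrow> real) \<Rightarrow> bool" where
  "carleson_functions q D S F \<longleftrightarrow>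
     (\<forall>Q\<in>S. F Q \<in> borel_measurable lebesgue \<and> (\<forall>x. 0 \<le> F Q x) \<and> (\<forall>x. x \<notin> Q \<longrightarrow> F Q x = 0) \<and>
       (\<integral>\<^sup>+x. ennreal (F Q x powr q) \<partial>lebesgue) \<le> ennreal (D powr q * vol Q))"

text \<open>
  Duality with the explicit test function \<open>g = f\<^sup>p\<^sup>-\<^sup>1\<close>. Hoelder's inequality on \<open>Q\<close> bounds \<open>\<integral> F\<^sub>Q g\<close> by
  \<open>D |Q|\<close> times the \<open>1 / q'\<close>-th power of the mean \<open>m Q\<close> of \<open>w = g\<^sup>q\<^sup>'\<close>. Young's inequality with exponents \<open>p\<close> and
  \<open>p'\<close> splits off \<open>\<Sum>\<^sub>Q c\<^sub>Q\<^sup>p |Q|\<close> and leaves a small multiple of \<open>\<Sum>\<^sub>Q m\<^sub>Q\<^sup>r |Q|\<close> with \<open>r = p' / q'\<close>. Since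
  \<open>q > p\<close>, this exponent is larger than \<open>1\<close>, and the embedding theorem bounds the second sum by
  \<open>B \<integral> w\<^sup>r = B \<integral> f\<^sup>p\<close>, which is absorbed by the left-hand side.
\<close>

lemma sparse_sum_bound:
  fixes p q :: real
  assumes p: "1 < p" and pq: "p < q"
  shows "\<exists>C>0. \<forall>S E (c :: (real ^ 'n::finite) set \<Rightarrow> real) D (F :: (real ^ 'n) set \<Rightarrow> real ^ 'n \<Rightarrow> real).
    sparse_family S E \<longrightarrow> (\<forall>Q\<in>S. 0 \<le> c Q) \<longrightarrow> 0 \<le> D \<longrightarrow> carleson_functions q D S F \<longrightarrow>
    (\<integral>\<^sup>+x. ennreal ((\<Sum>Q\<in>S. c Q * F Q x) powr p) \<partial>lebesgue)
      \<le> ennreal (C * D powr p * (\<Sum>Q\<in>S. c Q powr p * vol Q))"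
proof -
  define p' q' where "p' = p / (p - 1)" and "q' = q / (q - 1)"
  have q: "1 < q" using p pq by simp
  have p': "1 < p'" "1 / p + 1 / p' = 1" and q': "1 < q'" "1 / q + 1 / q' = 1"
    using p q by (auto simp: p'_def q'_def field_simps)
  define r where "r = p' / q'"
  have r: "1 < r" using p q pq by (simp add: r_def p'_def q'_def field_simps)
  obtain B where B: "0 < B" and emb: "\<And>S E (w :: real ^ 'n \<Rightarrow> real) (c :: (real ^ 'n) set \<Rightarrow> real).
    sparse_family S E \<Longrightarrow> w \<in> borel_measurable lebesgue \<Longrightarrow> \<forall>x. 0 \<le> w x \<Longrightarrow> \<forall>Q\<in>S. 0 \<le> c Q \<Longrightarrow>
    \<forall>Q\<in>S. ennreal (c Q * vol Q) \<le> (\<integral>\<^sup>+x\<in>Q. ennreal (w x) \<partial>lebesgue) \<Longrightarrow>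
    ennreal (\<Sum>Q\<in>S. c Q powr r * vol Q) \<le> ennreal B * (\<integral>\<^sup>+x. ennreal (w x powr r) \<partial>lebesgue)"
    using carleson_embedding[OF r, where 'n='n] by blast
  \<comment> \<open>The weight in Young's inequality, chosen such that the embedding constant \<open>B\<close> turns into \<open>1 / 2\<close>.\<close>
  define l where "l = (1 / (2 * B)) powr (1 / p')"
  have l: "0 < l" "l powr p' = 1 / (2 * B)" using B p' by (auto simp: l_def powr_powr)
  define K where "K = 2 * l powr (- p)"
  have K: "0 < K" using l by (simp add: K_def)
  show ?thesis
  proof (intro exI[of _ K] conjI K allI impI)
    fix S E D and c :: "(real ^ 'n) set \<Rightarrow> real" and F :: "(real ^ 'n) set \<Rightarrow> real ^ 'n \<Rightarrow> real"
    assume S: "sparse_family S E" and c: "\<forall>Q\<in>S. 0 \<le> c Q" and D: "0 \<le> D"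
      and "carleson_functions q D S F"
    then have F: "\<forall>Q\<in>S. F Q \<in> borel_measurable lebesgue \<and> (\<forall>x. 0 \<le> F Q x) \<and> (\<forall>x. x \<notin> Q \<longrightarrow> F Q x = 0) \<and>
       (\<integral>\<^sup>+x. ennreal (F Q x powr q) \<partial>lebesgue) \<le> ennreal (D powr q * vol Q)"
      by (simp only: carleson_functions_def)
    have finS: "finite S" "S \<subseteq> dyadic_cubes" using S by (auto simp: sparse_family_def)
    note Fm = F[rule_format, THEN conjunct1]
    have F0: "0 \<le> F Q x" "x \<notin> Q \<Longrightarrow> F Q x = 0" if "Q \<in> S" for Q x using F that by auto
    have Fq: "(\<integral>\<^sup>+x. ennreal (F Q x powr q) \<partial>lebesgue) \<le> ennreal (D powr q * vol Q)" if "Q \<in> S" for Q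
      using F that by blast
    define f where "f x = (\<Sum>Q\<in>S. c Q * F Q x)" for x
    have fm: "f \<in> borel_measurable lebesgue" unfolding f_def using Fm by measurable
    have f0: "0 \<le> f x" for x unfolding f_def using c F0 by (intro sum_nonneg) auto
    \<comment> \<open>Absorption needs a finite integral. It holds as \<open>f\<close> is a finite sum of functions in \<open>L\<^sup>q\<close> on sets of
      finite measure, each value of \<open>f\<close> being controlled by its largest summand.\<close>
    have ffin: "(\<integral>\<^sup>+x. ennreal (f x powr p) \<partial>lebesgue) < \<infinity>"
    proof -
      have pt: "ennreal (f x powr p) \<le> (\<Sum>Q\<in>S. ennreal ((real (card S) * c Q) powr p) * (indicator Q x + ennreal (F Q x powr q)))" for x
      proof (cases "S = {}")
        case True
        then show ?thesis by (simp add: f_def)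
      next
        case False
        obtain Q0 where Q0: "Q0 \<in> S" "\<And>Q. Q \<in> S \<Longrightarrow> c Q * F Q x \<le> c Q0 * F Q0 x"
        proof -
          have "Max ((\<lambda>Q. c Q * F Q x) ` S) \<in> (\<lambda>Q. c Q * F Q x) ` S" using finS False by (intro Max_in) auto
          then obtain Q0 where "Q0 \<in> S" "Max ((\<lambda>Q. c Q * F Q x) ` S) = c Q0 * F Q0 x" by blast
          moreover have "c Q * F Q x \<le> Max ((\<lambda>Q. c Q * F Q x) ` S)" if "Q \<in> S" for Q using finS that by auto
          ultimately show ?thesis using that[of Q0] by auto
        qed
        have "f x \<le> real (card S) * (c Q0 * F Q0 x)"
          unfolding f_def using Q0(2) by (rule sum_bounded_above)
        then have "f x powr p \<le> (real (card S) * c Q0 * F Q0 x) powr p"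
          using f0[of x] p by (intro powr_mono2) (auto simp: mult.assoc)
        also have "\<dots> = (real (card S) * c Q0) powr p * F Q0 x powr p"
          using c F0(1) Q0(1) by (intro powr_mult)
        also have "\<dots> \<le> (real (card S) * c Q0) powr p * (indicator Q0 x + F Q0 x powr q)"
        proof (rule mult_left_mono)
          show "F Q0 x powr p \<le> indicator Q0 x + F Q0 x powr q"
          proof (cases "x \<in> Q0")
            case True
            have "F Q0 x powr p \<le> 1 + F Q0 x powr q"
            proof (cases "F Q0 x \<le> 1")
              case True
              then have "F Q0 x powr p \<le> 1" using F0(1)[OF Q0(1)] p by (intro powr_le1) auto
              then show ?thesis by (simp add: add_increasing2)
            next
              case False
              then have "F Q0 x powr p \<le> F Q0 x powr q" using pq by (intro powr_mono) auto
              then show ?thesis by simp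
            qed
            then show ?thesis using True by simp
          qed (use F0(2)[OF Q0(1)] in auto)
        qed simp
        finally have "ennreal (f x powr p) \<le> ennreal ((real (card S) * c Q0) powr p) * (indicator Q0 x + ennreal (F Q0 x powr q))"
          by (cases "x \<in> Q0") (auto simp: ennreal_leI simp flip: ennreal_mult ennreal_plus ennreal_1)
        also have "\<dots> \<le> (\<Sum>Q\<in>S. ennreal ((real (card S) * c Q) powr p) * (indicator Q x + ennreal (F Q x powr q)))"
          using finS Q0(1) by (intro member_le_sum) auto
        finally show ?thesis .
      qed
      have "(\<integral>\<^sup>+x. ennreal (f x powr p) \<partial>lebesgue) \<le>
          (\<integral>\<^sup>+x. (\<Sum>Q\<in>S. ennreal ((real (card S) * c Q) powr p) * (indicator Q x + ennreal (F Q x powr q))) \<partial>lebesgue)"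
        by (rule nn_integral_mono) (rule pt)
      also have "\<dots> = (\<Sum>Q\<in>S. ennreal ((real (card S) * c Q) powr p) * (emeasure lebesgue Q + (\<integral>\<^sup>+x. ennreal (F Q x powr q) \<partial>lebesgue)))"
      proof -
        have m: "(\<lambda>x. ennreal (F Q x powr q)) \<in> borel_measurable lebesgue" "Q \<in> sets lebesgue" if "Q \<in> S" for Q
          using Fm[OF that] sets_dyadic finS that by (measurable, blast)
        show ?thesis
          using m by (subst nn_integral_sum) (auto simp: nn_integral_cmult nn_integral_add intro!: sum.cong)
      qed
      also have "\<dots> < \<infinity>"
      proof -
        have "emeasure lebesgue Q + (\<integral>\<^sup>+x. ennreal (F Q x powr q) \<partial>lebesgue) < \<infinity>" if "Q \<in> S" for Q
          using Fq[OF that] finS that by (subst emeasure_dyadic) (auto intro: le_less_trans)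
        then show ?thesis using finS(1) by (simp add: ennreal_mult_less_top)
      qed
      finally show ?thesis .
    qed
    define g where "g x = f x powr (p - 1)" for x
    have gm: "g \<in> borel_measurable lebesgue" unfolding g_def using fm by measurable
    have g0: "0 \<le> g x" for x by (simp add: g_def)
    define w where "w x = g x powr q'" for x
    have wm: "w \<in> borel_measurable lebesgue" unfolding w_def using gm by measurable
    have w0: "\<forall>x. 0 \<le> w x" by (simp add: w_def)
    have gp: "g x powr p' = f x powr p" for x
      using p by (simp add: g_def powr_powr p'_def)
    have wr: "w x powr r = f x powr p" for x
      using q' by (simp add: w_def powr_powr r_def gp)
    have wint: "(\<integral>\<^sup>+x\<in>Q. ennreal (w x) \<partial>lebesgue) < \<infinity>" if Q: "Q \<in> S" for Q
    proof -
      have "(\<integral>\<^sup>+x\<in>Q. ennreal (w x) \<partial>lebesgue) \<le> (\<integral>\<^sup>+x. indicator Q x + ennreal (f x powr p) \<partial>lebesgue)"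
      proof (rule nn_integral_mono)
        fix x
        have "w x \<le> 1 + w x powr r"
        proof (cases "w x \<le> 1")
          case False
          then have "w x powr 1 \<le> w x powr r" using r by (intro powr_mono) auto
          then show ?thesis using False by simp
        qed (simp add: add_increasing2)
        then have "ennreal (w x) \<le> ennreal (1 + f x powr p)" unfolding wr by (rule ennreal_leI)
        also have "\<dots> = 1 + ennreal (f x powr p)" by (simp add: ennreal_plus)
        finally show "ennreal (w x) * indicator Q x \<le> indicator Q x + ennreal (f x powr p)"
          by (cases "x \<in> Q") auto
      qed
      also have "\<dots> = emeasure lebesgue Q + (\<integral>\<^sup>+x. ennreal (f x powr p) \<partial>lebesgue)"
      proof -
        have "Q \<in> sets lebesgue" using finS Q sets_dyadic by blast
        then show ?thesis using fm by (subst nn_integral_add) auto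
      qed
      also have "\<dots> < \<infinity>" using ffin finS Q by (subst emeasure_dyadic) auto
      finally show ?thesis .
    qed
    define m where "m Q = enn2real (\<integral>\<^sup>+x\<in>Q. ennreal (w x) \<partial>lebesgue) / vol Q" for Q
    have m0: "0 \<le> m Q" for Q by (simp add: m_def)
    have mQ: "ennreal (m Q * vol Q) = (\<integral>\<^sup>+x\<in>Q. ennreal (w x) \<partial>lebesgue)" if "Q \<in> S" for Q
    proof -
      have "0 < vol Q" using that finS measure_dyadic_pos by blast
      then show ?thesis using wint[OF that] by (simp add: m_def)
    qed
    have dual: "(\<integral>\<^sup>+x. ennreal (F Q x * g x) \<partial>lebesgue) \<le> ennreal (D * m Q powr (1 / q') * vol Q)" if Q: "Q \<in> S" for Q
    proof -
      define v where "v = vol Q"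
      have v: "0 < v" unfolding v_def using Q finS measure_dyadic_pos by blast
      have Qs: "Q \<in> sets lebesgue" using Q finS sets_dyadic by blast
      have "(\<integral>\<^sup>+x. ennreal (F Q x * g x) \<partial>lebesgue) = (\<integral>\<^sup>+x. ennreal (F Q x * (g x * indicator Q x)) \<partial>lebesgue)"
        using F0(2)[OF Q] by (intro nn_integral_cong) (auto simp: indicator_def)
      also have "\<dots> \<le> ennreal ((D * v powr (1 / q)) * ((m Q * v) powr (1 / q')))"
      proof (rule nn_integral_Holder[OF Fm[OF Q] F0(1)[OF Q] _ _ q q'])
        show "(\<lambda>x. g x * indicator Q x) \<in> borel_measurable lebesgue" using gm Qs by measurable
        show "0 \<le> g x * indicator Q x" for x using g0 by simp
        show "0 \<le> D * v powr (1 / q)" "0 \<le> (m Q * v) powr (1 / q')" using D by auto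
        have "(D * v powr (1 / q)) powr q = D powr q * v" using D v q by (simp add: powr_mult powr_powr)
        then show "(\<integral>\<^sup>+x. ennreal (F Q x powr q) \<partial>lebesgue) \<le> ennreal ((D * v powr (1 / q)) powr q)"
          using Fq[OF Q] by (simp add: v_def)
        have "(\<integral>\<^sup>+x. ennreal ((g x * indicator Q x) powr q') \<partial>lebesgue) = (\<integral>\<^sup>+x\<in>Q. ennreal (w x) \<partial>lebesgue)"
          by (intro nn_integral_cong) (auto simp: indicator_def w_def)
        also have "\<dots> = ennreal (((m Q * v) powr (1 / q')) powr q')"
          using q' m0[of Q] v mQ[OF Q] by (simp add: powr_powr v_def)
        finally show "(\<integral>\<^sup>+x. ennreal ((g x * indicator Q x) powr q') \<partial>lebesgue) \<le> ennreal (((m Q * v) powr (1 / q')) powr q')"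
          by simp
      qed
      also have "(D * v powr (1 / q)) * ((m Q * v) powr (1 / q')) = D * m Q powr (1 / q') * (v powr (1 / q + 1 / q'))"
        using m0 v by (simp add: powr_mult powr_add)
      also have "\<dots> = D * m Q powr (1 / q') * vol Q" using q' v by (simp add: v_def)
      finally show ?thesis .
    qed
    have young: "c Q * (D * m Q powr (1 / q')) \<le> l powr (- p) * (D powr p * c Q powr p) + 1 / (2 * B) * m Q powr r" if "Q \<in> S" for Q
    proof -
      have cQ: "0 \<le> c Q" using c that by blast
      have "((c Q * D) / l) * (l * m Q powr (1 / q')) \<le> ((c Q * D) / l) powr p / p + (l * m Q powr (1 / q')) powr p' / p'"
        using p p' l cQ D by (intro Youngs_inequality) auto
      also have "\<dots> \<le> ((c Q * D) / l) powr p + (l * m Q powr (1 / q')) powr p'"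
        using p p' by (intro add_mono) (auto simp: divide_le_eq mult_left_mono mult_le_cancel_left1)
      also have "((c Q * D) / l) powr p = l powr (- p) * (D powr p * c Q powr p)"
        using cQ D l by (simp add: powr_divide powr_mult powr_minus field_simps)
      also have "(l * m Q powr (1 / q')) powr p' = 1 / (2 * B) * m Q powr r"
        using l m0[of Q] by (simp add: powr_mult powr_powr r_def)
      finally show ?thesis using l by simp
    qed
    obtain A where A: "0 \<le> A" "(\<integral>\<^sup>+x. ennreal (f x powr p) \<partial>lebesgue) = ennreal A"
      using ffin by (cases "\<integral>\<^sup>+x. ennreal (f x powr p) \<partial>lebesgue") auto
    have "ennreal A = (\<integral>\<^sup>+x. (\<Sum>Q\<in>S. ennreal (c Q) * ennreal (F Q x * g x)) \<partial>lebesgue)"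
      unfolding A(2)[symmetric]
    proof (rule nn_integral_cong)
      fix x
      have "f x powr p = f x * g x"
        using f0[of x] p by (cases "f x = 0") (auto simp: g_def powr_diff)
      also have "\<dots> = (\<Sum>Q\<in>S. c Q * (F Q x * g x))" by (simp add: f_def sum_distrib_right mult.assoc)
      finally show "ennreal (f x powr p) = (\<Sum>Q\<in>S. ennreal (c Q) * ennreal (F Q x * g x))"
        using c F0 g0 by (simp add: ennreal_mult[symmetric] sum_ennreal)
    qed
    also have "\<dots> = (\<Sum>Q\<in>S. ennreal (c Q) * (\<integral>\<^sup>+x. ennreal (F Q x * g x) \<partial>lebesgue))"
    proof -
      have "(\<lambda>x. ennreal (F Q x * g x)) \<in> borel_measurable lebesgue" if "Q \<in> S" for Q
        using Fm[OF that] gm by measurable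
      then show ?thesis by (subst nn_integral_sum) (auto simp: nn_integral_cmult intro!: sum.cong)
    qed
    also have "\<dots> \<le> (\<Sum>Q\<in>S. ennreal (c Q) * ennreal (D * m Q powr (1 / q') * vol Q))"
      by (intro sum_mono mult_left_mono dual) auto
    also have "\<dots> = ennreal (\<Sum>Q\<in>S. c Q * (D * m Q powr (1 / q')) * vol Q)"
    proof -
      have "ennreal (c Q) * ennreal (D * m Q powr (1 / q') * vol Q)
          = ennreal (c Q * (D * m Q powr (1 / q')) * vol Q)" if "Q \<in> S" for Q
        using c D that by (subst ennreal_mult[symmetric]) (auto simp: mult.assoc)
      then show ?thesis using c D by (simp add: sum_ennreal)
    qed
    finally have "A \<le> (\<Sum>Q\<in>S. c Q * (D * m Q powr (1 / q')) * vol Q)"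
      using c D by (subst (asm) ennreal_le_iff) (auto intro!: sum_nonneg)
    also have "\<dots> \<le> (\<Sum>Q\<in>S. (l powr (- p) * (D powr p * c Q powr p) + 1 / (2 * B) * m Q powr r) * vol Q)"
      using young by (intro sum_mono mult_right_mono) auto
    also have "\<dots> = l powr (- p) * D powr p * (\<Sum>Q\<in>S. c Q powr p * vol Q)
        + 1 / (2 * B) * (\<Sum>Q\<in>S. m Q powr r * vol Q)"
      by (simp add: distrib_right sum.distrib sum_distrib_left mult.assoc)
    finally have split: "A \<le> l powr (- p) * D powr p * (\<Sum>Q\<in>S. c Q powr p * vol Q)
        + 1 / (2 * B) * (\<Sum>Q\<in>S. m Q powr r * vol Q)" .
    have "(\<Sum>Q\<in>S. m Q powr r * vol Q) \<le> B * A"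
    proof -
      have "ennreal (\<Sum>Q\<in>S. m Q powr r * vol Q) \<le> ennreal B * ennreal A"
        using emb[OF S wm w0, of m] m0 mQ unfolding wr A(2) by simp
      then show ?thesis using A B by (subst (asm) ennreal_mult[symmetric]) (auto simp: ennreal_le_iff)
    qed
    then have "1 / (2 * B) * (\<Sum>Q\<in>S. m Q powr r * vol Q) \<le> 1 / (2 * B) * (B * A)"
      using B by (intro mult_left_mono) auto
    also have "\<dots> = A / 2" using B by simp
    finally have "A \<le> l powr (- p) * D powr p * (\<Sum>Q\<in>S. c Q powr p * vol Q) + A / 2"
      using split by linarith
    then have "A \<le> K * D powr p * (\<Sum>Q\<in>S. c Q powr p * vol Q)" by (simp add: K_def)
    then show "(\<integral>\<^sup>+x. ennreal ((\<Sum>Q\<in>S. c Q * F Q x) powr p) \<partial>lebesgue)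
        \<le> ennreal (K * D powr p * (\<Sum>Q\<in>S. c Q powr p * vol Q))"
      using A(2) unfolding f_def by (simp add: ennreal_leI)
  qed
qed

section \<open>The embedding inequality\<close>

lemma nn_integral_powr_Lp_space:
  fixes u :: "'a::euclidean_space \<Rightarrow> 'x::real_normed_vector"
  assumes u: "u \<in> Lp_space p" and p: "1 < p"
  obtains A where "0 \<le> A" "(\<integral>\<^sup>+x. ennreal (norm (u x) powr p) \<partial>lebesgue) = ennreal A"
    "Lp_norm p (\<lambda>x. ennreal (norm (u x))) = ennreal (A powr (1 / p))"
proof -
  let ?I = "\<integral>\<^sup>+x. ennreal (norm (u x) powr p) \<partial>lebesgue"
  have eq: "Lp_norm p (\<lambda>x. ennreal (norm (u x))) = enn_powr ?I (1 / p)"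
    by (simp add: Lp_norm_def enn_powr_ennreal)
  moreover have "Lp_norm p (\<lambda>x. ennreal (norm (u x))) < \<infinity>" using u by (simp add: Lp_space_def)
  ultimately have "?I \<noteq> \<infinity>" by (auto simp: enn_powr_def)
  then obtain A where "0 \<le> A" "?I = ennreal A" by (cases ?I) auto
  then show thesis using that[of A] eq by (simp add: enn_powr_ennreal)
qed

lemma Lp_space_loc_integrable:
  fixes u :: "real ^ 'n::finite \<Rightarrow> 'x::real_normed_vector"
  assumes u: "u \<in> Lp_space p" and p: "1 < p"
  shows "loc_integrable u"
  unfolding loc_integrable_def
proof (intro conjI ballI)
  show sm: "strongly_measurable lebesgue u" using u by (simp add: Lp_space_def)
  fix Q :: "(real ^ 'n) set" assume Q: "Q \<in> dyadic_cubes"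
  obtain A where A: "0 \<le> A" "(\<integral>\<^sup>+x. ennreal (norm (u x) powr p) \<partial>lebesgue) = ennreal A"
    using nn_integral_powr_Lp_space[OF u p] by blast
  have "(\<integral>\<^sup>+x\<in>Q. ennreal (norm (u x)) \<partial>lebesgue) \<le> (\<integral>\<^sup>+x. indicator Q x + ennreal (norm (u x) powr p) \<partial>lebesgue)"
  proof (rule nn_integral_mono)
    fix x
    have "norm (u x) \<le> 1 + norm (u x) powr p"
    proof (cases "norm (u x) \<le> 1")
      case False
      then have "norm (u x) powr 1 \<le> norm (u x) powr p" using p by (intro powr_mono) auto
      then show ?thesis using False by simp
    qed (simp add: add_increasing2)
    then have "ennreal (norm (u x)) \<le> ennreal (1 + norm (u x) powr p)" by (rule ennreal_leI)
    also have "\<dots> = 1 + ennreal (norm (u x) powr p)" by (simp add: ennreal_plus)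
    finally show "ennreal (norm (u x)) * indicator Q x \<le> indicator Q x + ennreal (norm (u x) powr p)"
      by (cases "x \<in> Q") auto
  qed
  also have "\<dots> = emeasure lebesgue Q + ennreal A"
    unfolding A(2)[symmetric] using borel_measurable_norm_strong[OF sm] sets_dyadic[OF Q]
    by (subst nn_integral_add) auto
  also have "\<dots> < \<infinity>" using Q by (subst emeasure_dyadic) auto
  finally show "(\<integral>\<^sup>+x\<in>Q. ennreal (norm (u x)) \<partial>lebesgue) < \<infinity>" .
qed

text \<open>
  For the case of an infinite Carleson norm, where the right-hand side of the embedding is finite only if
  \<open>u\<close> vanishes almost everywhere.
\<close>

lemma average_eq_0:
  fixes u :: "real ^ 'n::finite \<Rightarrow> 'x::banach"
  assumes u: "loc_integrable u" and z: "(\<integral>\<^sup>+x. ennreal (norm (u x) powr p) \<partial>lebesgue) = 0"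
    and Q: "Q \<in> dyadic_cubes"
  shows "average Q u = 0"
proof -
  note m = borel_measurable_norm_loc[OF u]
  have "AE x in lebesgue. ennreal (norm (u x) powr p) = 0"
    using z m by (subst (asm) nn_integral_0_iff_AE) auto
  then have "AE x in lebesgue. ennreal (norm (u x)) * indicator Q x = 0"
    by eventually_elim (simp add: ennreal_eq_0_iff)
  then have "(\<integral>\<^sup>+x\<in>Q. ennreal (norm (u x)) \<partial>lebesgue) = 0"
    using m sets_dyadic[OF Q] by (subst nn_integral_0_iff_AE) auto
  then have "mean_norm u Q = 0" by (simp add: mean_norm_def)
  then show ?thesis using norm_average_le[OF u Q] by simp
qed

definition support :: "((real ^ 'n::finite) set \<Rightarrow> real ^ 'n \<Rightarrow> 'k::zero) \<Rightarrow> (real ^ 'n) set set" where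
  "support b = {R \<in> dyadic_cubes. b R \<noteq> (\<lambda>_. 0)}"

lemma admissible_familyD:
  assumes "admissible_family b"
  shows "finite (support b)" "support b \<subseteq> dyadic_cubes"
    "R \<in> support b \<Longrightarrow> b R \<in> borel_measurable lebesgue"
    "R \<in> support b \<Longrightarrow> x \<notin> R \<Longrightarrow> b R x = 0"
  using assms by (auto simp: admissible_family_def support_def)

lemma paraproduct_norm_rad:
  fixes sc :: "'k::{real_normed_field, euclidean_space} \<Rightarrow> 'x::banach \<Rightarrow> 'x"
  assumes "admissible_family b"
  shows "paraproduct_norm sc p b u = enn_powr
    (\<integral>\<^sup>+x. ennreal (rad p (support b) (\<lambda>R. sc (b R x) (average R u))) \<partial>lebesgue) (1 / p)"
proof -
  have "(\<integral>\<^sup>+\<epsilon>. ennreal (norm (\<Sum>R\<in>support b. \<epsilon> R *\<^sub>R sc (b R x) (average R u)) powr p) \<partial>random_signs dyadic_cubes)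
      = ennreal (rad p (support b) (\<lambda>R. sc (b R x) (average R u)))" for x
    using admissible_familyD(1,2)[OF assms] by (intro nn_integral_rad) auto
  then show ?thesis unfolding paraproduct_norm_def by (simp add: support_def)
qed

lemma Car_norm_local:
  fixes b :: "(real ^ 'n::finite) set \<Rightarrow> real ^ 'n \<Rightarrow> 'k::{real_normed_field, euclidean_space}"
  assumes b: "admissible_family b" and q: "0 < q" and D: "Car_norm q b = ennreal D" "0 \<le> D"
    and Q: "Q \<in> dyadic_cubes"
  shows "(\<integral>\<^sup>+x\<in>Q. ennreal (rad q {R \<in> support b. R \<subseteq> Q} (\<lambda>R. b R x)) \<partial>lebesgue)
    \<le> ennreal (D powr q * vol Q)"
proof -
  let ?J = "{R \<in> support b. R \<subseteq> Q}"
  let ?I = "\<integral>\<^sup>+x\<in>Q. ennreal (rad q ?J (\<lambda>R. b R x)) \<partial>lebesgue"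
  have J: "{R \<in> dyadic_cubes. R \<subseteq> Q \<and> b R \<noteq> (\<lambda>_. 0)} = ?J" by (auto simp: support_def)
  have "(\<integral>\<^sup>+\<epsilon>. ennreal (norm (\<Sum>R\<in>?J. \<epsilon> R *\<^sub>R b R x) powr q) \<partial>random_signs dyadic_cubes)
      = ennreal (rad q ?J (\<lambda>R. b R x))" for x
    using admissible_familyD(1,2)[OF b] by (intro nn_integral_rad) auto
  then have "enn_powr (?I / emeasure lebesgue Q) (1 / q) \<le> Car_norm q b"
    unfolding Car_norm_def by (intro SUP_upper2[OF Q]) (simp add: J)
  then have le: "enn_powr (?I / emeasure lebesgue Q) (1 / q) \<le> ennreal D" using D by simp
  have v: "0 < vol Q" by (rule measure_dyadic_pos[OF Q])
  show ?thesis
  proof (cases ?I)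
    case (real m)
    have "?I / emeasure lebesgue Q = ennreal (m / vol Q)"
      unfolding real(2) emeasure_dyadic[OF Q] using real(1) v by (rule divide_ennreal)
    then have "ennreal ((m / vol Q) powr (1 / q)) \<le> ennreal D"
      using le real v by (simp add: enn_powr_ennreal)
    then have "(m / vol Q) powr (1 / q) \<le> D" using D by (simp add: ennreal_le_iff)
    then have "((m / vol Q) powr (1 / q)) powr q \<le> D powr q"
      using q by (intro powr_mono2) auto
    then have "m / vol Q \<le> D powr q" using q real v by (simp add: powr_powr)
    then have "m \<le> D powr q * vol Q" using v by (simp add: pos_divide_le_eq)
    then show ?thesis using real by (auto intro: ennreal_leI)
  next
    case top
    then have "?I / emeasure lebesgue Q = top"
      unfolding emeasure_dyadic[OF Q] by (simp add: ennreal_top_divide)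
    then show ?thesis using le by (simp add: enn_powr_def top_unique)
  qed
qed

text \<open>
  Passage from integrals of \<open>p\<close>-th powers with finite Carleson norm \<open>D\<close> to the extended-valued statement.
  If the Carleson norm is infinite, the right-hand side is infinite too, unless \<open>u\<close> vanishes almost
  everywhere and with it all averages.
\<close>

lemma embedding_from_integral_bound:
  fixes sc :: "'k::{real_normed_field, euclidean_space} \<Rightarrow> 'x::banach \<Rightarrow> 'x"
  assumes sc: "normed_space_over sc" and p: "1 < p" and K: "0 < K"
    and bound: "\<And>(u :: real ^ 'n::finite \<Rightarrow> 'x) (b :: (real ^ 'n) set \<Rightarrow> real ^ 'n \<Rightarrow> 'k) D A.
      loc_integrable u \<Longrightarrow> admissible_family b \<Longrightarrow> 0 \<le> D \<Longrightarrow> Car_norm q b = ennreal D \<Longrightarrow> 0 \<le> A \<Longrightarrow>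
      (\<integral>\<^sup>+x. ennreal (norm (u x) powr p) \<partial>lebesgue) = ennreal A \<Longrightarrow>
      (\<integral>\<^sup>+x. ennreal (rad p (support b) (\<lambda>R. sc (b R x) (average R u))) \<partial>lebesgue)
        \<le> ennreal (K * D powr p * A)"
  shows "\<exists>C::real. \<forall>(u :: real ^ 'n \<Rightarrow> 'x) (b :: (real ^ 'n) set \<Rightarrow> real ^ 'n \<Rightarrow> 'k).
        u \<in> Lp_space p \<longrightarrow> admissible_family b \<longrightarrow>
        paraproduct_norm sc p b u \<le> ennreal C * Car_norm q b * Lp_norm p (\<lambda>x. ennreal (norm (u x)))"
proof (intro exI[of _ "K powr (1 / p)"] allI impI)
  fix u :: "real ^ 'n \<Rightarrow> 'x" and b :: "(real ^ 'n) set \<Rightarrow> real ^ 'n \<Rightarrow> 'k"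
  assume u: "u \<in> Lp_space p" and b: "admissible_family b"
  note loc = Lp_space_loc_integrable[OF u p]
  obtain A where A: "0 \<le> A" "(\<integral>\<^sup>+x. ennreal (norm (u x) powr p) \<partial>lebesgue) = ennreal A"
    "Lp_norm p (\<lambda>x. ennreal (norm (u x))) = ennreal (A powr (1 / p))"
    using nn_integral_powr_Lp_space[OF u p] by blast
  show "paraproduct_norm sc p b u \<le> ennreal (K powr (1 / p)) * Car_norm q b * Lp_norm p (\<lambda>x. ennreal (norm (u x)))"
  proof (cases "Car_norm q b")
    case (real D)
    have "paraproduct_norm sc p b u \<le> enn_powr (ennreal (K * D powr p * A)) (1 / p)"
      unfolding paraproduct_norm_rad[OF b] using p real A(1,2)
      by (intro enn_powr_mono bound[OF loc b]) auto
    also have "\<dots> = ennreal (K powr (1 / p) * D * A powr (1 / p))"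
      using K A(1) real p by (simp add: enn_powr_ennreal powr_mult powr_powr)
    also have "\<dots> = ennreal (K powr (1 / p)) * Car_norm q b * Lp_norm p (\<lambda>x. ennreal (norm (u x)))"
      using real A(3) by (simp add: ennreal_mult)
    finally show ?thesis .
  next
    case top
    show ?thesis
    proof (cases "A = 0")
      case True
      have av: "average R u = 0" if "R \<in> dyadic_cubes" for R
        using average_eq_0[OF loc _ that] A(2) True by simp
      have "rad p (support b) (\<lambda>R. sc (b R x) (average R u)) = 0" for x
      proof -
        have "rad p (support b) (\<lambda>R. sc (b R x) (average R u)) = rad p {} (\<lambda>R. sc (b R x) (average R u))"
          using admissible_familyD(1,2)[OF b] av normed_space_overD(2)[OF sc] by (intro rad_neutral) auto
        then show ?thesis by (simp add: rad_def sign_mean_def)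
      qed
      then have "paraproduct_norm sc p b u = 0" unfolding paraproduct_norm_rad[OF b] by simp
      then show ?thesis by simp
    next
      case False
      then have "0 < A powr (1 / p)" using A(1) by simp
      then have "ennreal (K powr (1 / p)) * Car_norm q b * Lp_norm p (\<lambda>x. ennreal (norm (u x))) = top"
        using K unfolding top A(3) by (simp add: ennreal_mult_top ennreal_top_mult)
      then show ?thesis by simp
    qed
  qed
qed

text \<open>
  Only the cubes that contain \<open>x\<close> have nonzero coefficients. They form a chain, and its smallest member
  makes a good pair with \<open>Q\<close>, which bounds the sum over the chain.
\<close>

lemma rad_principal_le:
  fixes sc :: "'k::{real_normed_field, euclidean_space} \<Rightarrow> 'x::banach \<Rightarrow> 'x"
    and u :: "real ^ 'n::finite \<Rightarrow> 'x"
  assumes sc: "normed_space_over sc" and C: "0 \<le> C" and b: "admissible_family b"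
    and good: "\<And>R. R \<in> support b \<Longrightarrow> par R = Q \<Longrightarrow> R \<subseteq> Q \<and> \<not> bad_pair sc C u (support b) Q R"
  shows "rad 1 {R \<in> support b. par R = Q} (\<lambda>R. sc (b R x) (average R u))
    \<le> C * mean_norm u Q * L2_set (\<lambda>R. norm (b R x)) {R \<in> support b. R \<subseteq> Q}"
proof -
  have fin: "finite (support b)" by (rule admissible_familyD(1)[OF b])
  define J where "J = {R \<in> support b. par R = Q \<and> x \<in> R}"
  have J: "finite J" "J \<subseteq> {R \<in> support b. par R = Q}" using fin by (auto simp: J_def)
  have zero: "b R x = 0" if "R \<in> support b" "x \<notin> R" for R
    using admissible_familyD(4)[OF b that] .
  have r: "rad 1 {R \<in> support b. par R = Q} (\<lambda>R. sc (b R x) (average R u)) = rad 1 J (\<lambda>R. sc (b R x) (average R u))"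
    using fin J(2) zero normed_space_overD(1)[OF sc] by (intro rad_neutral) (auto simp: J_def)
  have cm: "0 \<le> C * mean_norm u Q" by (intro mult_nonneg_nonneg C mean_norm_nonneg)
  show ?thesis
  proof (cases "J = {}")
    case True
    then show ?thesis unfolding r using cm by (simp add: rad_1 sign_mean_def)
  next
    case False
    from finite_has_minimal[OF J(1) False] obtain R0 where R0: "R0 \<in> J" "\<forall>R\<in>J. R \<subseteq> R0 \<longrightarrow> R0 = R" ..
    have above: "R0 \<subseteq> R" if "R \<in> J" for R
    proof -
      have "R0 \<in> dyadic_cubes" "R \<in> dyadic_cubes" "x \<in> R0" "x \<in> R"
        using R0(1) that admissible_familyD(2)[OF b] by (auto simp: J_def)
      then have "R0 \<subseteq> R \<or> R \<subseteq> R0" by (rule dyadic_cubes_nested)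
      then show ?thesis using R0(2) that by auto
    qed
    let ?J = "{P \<in> support b. R0 \<subseteq> P \<and> P \<subseteq> Q}"
    have sub: "J \<subseteq> ?J" using above good by (auto simp: J_def)
    have fJ: "finite ?J" using fin by simp
    \<comment> \<open>Goodness refers to all cubes between \<open>R0\<close> and \<open>Q\<close>, also to those assigned elsewhere: extend by zero.\<close>
    define l where "l P = (if P \<in> J then b P x else 0)" for P
    have "\<not> bad_pair sc C u (support b) Q R0" using R0(1) good by (auto simp: J_def)
    then have le: "rad 1 ?J (\<lambda>P. sc (l P) (average P u)) \<le> C * mean_norm u Q * L2_set (\<lambda>P. norm (l P)) ?J"
      unfolding bad_pair_def not_ex not_less by blast
    have "rad 1 J (\<lambda>R. sc (b R x) (average R u)) = rad 1 J (\<lambda>P. sc (l P) (average P u))"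
      by (rule rad_cong) (simp add: l_def)
    also have "\<dots> = rad 1 ?J (\<lambda>P. sc (l P) (average P u))"
      using normed_space_overD(1)[OF sc] by (intro rad_neutral[symmetric] fJ sub) (auto simp: l_def)
    also note le
    also have "C * mean_norm u Q * L2_set (\<lambda>P. norm (l P)) ?J
        \<le> C * mean_norm u Q * L2_set (\<lambda>R. norm (b R x)) {R \<in> support b. R \<subseteq> Q}"
    proof (rule mult_left_mono[OF _ cm])
      have "(\<Sum>P\<in>?J. (norm (l P))\<^sup>2) \<le> (\<Sum>P\<in>?J. (norm (b P x))\<^sup>2)"
        by (intro sum_mono) (auto simp: l_def)
      also have "\<dots> \<le> (\<Sum>P | P \<in> support b \<and> P \<subseteq> Q. (norm (b P x))\<^sup>2)"
        using fin by (intro sum_mono2) auto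
      finally show "L2_set (\<lambda>P. norm (l P)) ?J \<le> L2_set (\<lambda>R. norm (b R x)) {R \<in> support b. R \<subseteq> Q}"
        by (simp add: L2_set_def)
    qed
    finally show ?thesis unfolding r .
  qed
qed

text \<open>
  \<open>par R\<close> is the principal cube to which \<open>R\<close> is assigned.
\<close>

definition sparse_control ::
    "('k::{real_normed_field, euclidean_space} \<Rightarrow> 'x::banach \<Rightarrow> 'x) \<Rightarrow> real \<Rightarrow> real \<Rightarrow> real \<Rightarrow>
     (real ^ 'n::finite \<Rightarrow> 'x) \<Rightarrow> ((real ^ 'n) set \<Rightarrow> real ^ 'n \<Rightarrow> 'k) \<Rightarrow> bool" where
  "sparse_control sc q M D u b \<longleftrightarrow>
     (\<exists>S E par F. sparse_family S E \<and> par ` support b \<subseteq> S \<and> carleson_functions q (M * D) S F \<and>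
       (\<forall>Q\<in>S. \<forall>x. rad 1 {R \<in> support b. par R = Q} (\<lambda>R. sc (b R x) (average R u))
          \<le> M * (mean_norm u Q * F Q x)))"

text \<open>
  The functions \<open>F Q\<close> are the square functions of the coefficients inside \<open>Q\<close>; Khintchine's inequality,
  applied for fixed \<open>x\<close>, compares them with the randomised sums in the Carleson norm.
\<close>

theorem sparse_domination:
  fixes sc :: "'k::{real_normed_field, euclidean_space} \<Rightarrow> 'x::banach \<Rightarrow> 'x" and q :: real
  assumes sc: "normed_space_over sc" and rmf: "RMF_property sc TYPE('n::finite)" and q: "1 < q"
  shows "\<exists>M>0. \<forall>(u :: real ^ 'n \<Rightarrow> 'x) (b :: (real ^ 'n) set \<Rightarrow> real ^ 'n \<Rightarrow> 'k) D.
    loc_integrable u \<longrightarrow> admissible_family b \<longrightarrow> 0 \<le> D \<longrightarrow> Car_norm q b = ennreal D \<longrightarrow>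
    sparse_control sc q M D u b"
proof -
  obtain K0 where K0: "\<And>u :: real ^ 'n \<Rightarrow> 'x. u \<in> Lp_space 2 \<Longrightarrow>
        Lp_norm 2 (rademacher_maximal sc u) \<le> ennreal K0 * Lp_norm 2 (\<lambda>x. ennreal (norm (u x)))"
    using rmf unfolding RMF_property_def by blast
  \<comment> \<open>The RMF constant may be negative, and \<open>principal_cubes\<close> uses that it is at least \<open>1\<close>.\<close>
  define K where "K = max 1 K0"
  have K: "1 \<le> K" by (simp add: K_def)
  have rmfK: "Lp_norm 2 (rademacher_maximal sc u) \<le> ennreal K * Lp_norm 2 (\<lambda>x. ennreal (norm (u x)))"
    if "u \<in> Lp_space 2" for u :: "real ^ 'n \<Rightarrow> 'x"
    by (rule order_trans[OF K0[OF that]]) (intro mult_right_mono ennreal_leI, auto simp: K_def)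
  define C where "C = 8 * 2 ^ CARD('n) * K"
  have C: "0 < C" using K by (simp add: C_def)
  obtain H where H: "0 < H" "\<And>J (x :: (real ^ 'n) set \<Rightarrow> 'k). finite J \<Longrightarrow>
    L2_set (\<lambda>i. norm (x i)) J powr q \<le> H * rad q J x"
    using khintchine[OF q, where 'i="(real ^ 'n) set" and 'k='k] by blast
  define M where "M = max C (H powr (1 / q))"
  have M: "0 < M" "C \<le> M" "H powr (1 / q) \<le> M" using C by (auto simp: M_def)
  show ?thesis
  proof (intro exI[of _ M] conjI M(1) allI impI)
    fix u :: "real ^ 'n \<Rightarrow> 'x" and b :: "(real ^ 'n) set \<Rightarrow> real ^ 'n \<Rightarrow> 'k" and D
    assume u: "loc_integrable u" and b: "admissible_family b" and D: "0 \<le> D" "Car_norm q b = ennreal D"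
    have fin: "finite (support b)" "support b \<subseteq> dyadic_cubes" by (fact admissible_familyD(1,2)[OF b])+
    obtain S E where S: "S \<subseteq> support b" "sparse_family S E"
      and good: "\<forall>R\<in>support b. \<exists>Q\<in>S. R \<subseteq> Q \<and> \<not> bad_pair sc C u (support b) Q R"
    proof -
      have "\<exists>S E. S \<subseteq> support b \<and> sparse_family S E \<and>
          (\<forall>R\<in>support b. \<exists>Q\<in>S. R \<subseteq> Q \<and> \<not> bad_pair sc C u (support b) Q R)"
        by (rule principal_cubes[OF sc rmfK K C_def u fin])
      then show ?thesis using that by (elim exE conjE)
    qed
    obtain par where par: "\<forall>R\<in>support b. par R \<in> S \<and> R \<subseteq> par R \<and> \<not> bad_pair sc C u (support b) (par R) R"
      using bchoice[OF good[unfolded Bex_def]] by (elim exE)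
    define F where "F Q x = L2_set (\<lambda>R. norm (b R x)) {R \<in> support b. R \<subseteq> Q}" for Q x
    have F: "F Q \<in> borel_measurable lebesgue \<and> (\<forall>x. 0 \<le> F Q x) \<and> (\<forall>x. x \<notin> Q \<longrightarrow> F Q x = 0) \<and>
        (\<integral>\<^sup>+x. ennreal (F Q x powr q) \<partial>lebesgue) \<le> ennreal ((M * D) powr q * vol Q)" if Q: "Q \<in> S" for Q
    proof (intro conjI allI impI)
      have Qd: "Q \<in> dyadic_cubes" using Q S(1) fin(2) by blast
      have bm: "b R \<in> borel_measurable lebesgue" if "R \<in> support b" for R
        using admissible_familyD(3)[OF b that] .
      have "(\<lambda>x. \<Sum>R | R \<in> support b \<and> R \<subseteq> Q. (norm (b R x))\<^sup>2) \<in> borel_measurable lebesgue"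
      proof (intro borel_measurable_sum borel_measurable_power)
        fix R assume "R \<in> {R \<in> support b. R \<subseteq> Q}"
        then have "b R \<in> borel_measurable lebesgue" using bm by simp
        then show "(\<lambda>x. norm (b R x)) \<in> borel_measurable lebesgue" by measurable
      qed
      then show "F Q \<in> borel_measurable lebesgue"
        unfolding F_def[abs_def] L2_set_def by measurable
      show "0 \<le> F Q x" for x by (simp add: F_def L2_set_nonneg)
      show zero: "F Q x = 0" if "x \<notin> Q" for x
      proof -
        have "b R x = 0" if "R \<in> support b" "R \<subseteq> Q" for R
          using admissible_familyD(4)[OF b that(1)] that(2) \<open>x \<notin> Q\<close> by blast
        then show ?thesis unfolding F_def by (simp add: L2_set_def)
      qed
      have "(\<integral>\<^sup>+x. ennreal (F Q x powr q) \<partial>lebesgue)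
          \<le> (\<integral>\<^sup>+x. ennreal H * (ennreal (rad q {R \<in> support b. R \<subseteq> Q} (\<lambda>R. b R x)) * indicator Q x) \<partial>lebesgue)"
      proof (rule nn_integral_mono)
        fix x
        have "F Q x powr q \<le> H * rad q {R \<in> support b. R \<subseteq> Q} (\<lambda>R. b R x)"
          unfolding F_def using fin(1) by (intro H(2)) simp
        then show "ennreal (F Q x powr q) \<le> ennreal H * (ennreal (rad q {R \<in> support b. R \<subseteq> Q} (\<lambda>R. b R x)) * indicator Q x)"
          using zero[of x] H(1) by (cases "x \<in> Q") (auto simp: ennreal_leI rad_nonneg simp flip: ennreal_mult)
      qed
      also have "\<dots> = ennreal H * (\<integral>\<^sup>+x\<in>Q. ennreal (rad q {R \<in> support b. R \<subseteq> Q} (\<lambda>R. b R x)) \<partial>lebesgue)"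
      proof (rule nn_integral_cmult)
        have "(\<lambda>x. rad q {R \<in> support b. R \<subseteq> Q} (\<lambda>R. b R x)) \<in> borel_measurable lebesgue"
        proof -
          have "(\<lambda>x. \<Sum>R | R \<in> support b \<and> R \<subseteq> Q. s R *\<^sub>R b R x) \<in> borel_measurable lebesgue" for s
          proof (intro borel_measurable_sum)
            fix R assume "R \<in> {R \<in> support b. R \<subseteq> Q}"
            then have "b R \<in> borel_measurable lebesgue" using bm by simp
            then show "(\<lambda>x. s R *\<^sub>R b R x) \<in> borel_measurable lebesgue" by measurable
          qed
          then show ?thesis unfolding rad_def sign_mean_def by measurable
        qed
        then show "(\<lambda>x. ennreal (rad q {R \<in> support b. R \<subseteq> Q} (\<lambda>R. b R x)) * indicator Q x) \<in> borel_measurable lebesgue"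
          using sets_dyadic[OF Qd] by measurable
      qed
      also have "\<dots> \<le> ennreal H * ennreal (D powr q * vol Q)"
        using q by (intro mult_left_mono Car_norm_local[OF b _ D(2,1) Qd]) auto
      also have "\<dots> = ennreal (H * D powr q * vol Q)"
        using H(1) by (simp add: ennreal_mult mult.assoc)
      also have "\<dots> \<le> ennreal ((M * D) powr q * vol Q)"
      proof (intro ennreal_leI mult_right_mono)
        have "H = (H powr (1 / q)) powr q" using H(1) q by (simp add: powr_powr)
        also have "\<dots> \<le> M powr q" using M(3) q by (intro powr_mono2) auto
        finally show "H * D powr q \<le> (M * D) powr q"
          using M(1) D(1) by (simp add: powr_mult mult_right_mono)
      qed simp
      finally show "(\<integral>\<^sup>+x. ennreal (F Q x powr q) \<partial>lebesgue) \<le> ennreal ((M * D) powr q * vol Q)" .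
    qed
    have R: "rad 1 {R \<in> support b. par R = Q} (\<lambda>R. sc (b R x) (average R u)) \<le> M * (mean_norm u Q * F Q x)" for Q x
    proof -
      have "rad 1 {R \<in> support b. par R = Q} (\<lambda>R. sc (b R x) (average R u)) \<le> C * mean_norm u Q * F Q x"
        unfolding F_def using C par by (intro rad_principal_le[OF sc _ b]) auto
      also have "\<dots> \<le> M * (mean_norm u Q * F Q x)"
        using M(2) by (simp add: mult.assoc mult_right_mono mean_norm_nonneg F_def L2_set_nonneg)
      finally show ?thesis .
    qed
    show "sparse_control sc q M D u b"
      unfolding sparse_control_def carleson_functions_def
      using S(2) par F R by (intro exI[of _ S] exI[of _ E] exI[of _ par] exI[of _ F]) auto
  qed
qed

lemma mean_norm_embedding:
  fixes p :: real
  assumes p: "1 < p"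
  shows "\<exists>B>0. \<forall>S E (u :: real ^ 'n::finite \<Rightarrow> 'x::real_normed_vector) A.
    sparse_family S E \<longrightarrow> loc_integrable u \<longrightarrow> 0 \<le> A \<longrightarrow>
    (\<integral>\<^sup>+x. ennreal (norm (u x) powr p) \<partial>lebesgue) = ennreal A \<longrightarrow>
    (\<Sum>Q\<in>S. mean_norm u Q powr p * vol Q) \<le> B * A"
proof -
  obtain B where B: "0 < B" and emb: "\<And>S E (w :: real ^ 'n \<Rightarrow> real) (c :: (real ^ 'n) set \<Rightarrow> real).
    sparse_family S E \<Longrightarrow> w \<in> borel_measurable lebesgue \<Longrightarrow> \<forall>x. 0 \<le> w x \<Longrightarrow> \<forall>Q\<in>S. 0 \<le> c Q \<Longrightarrow>
    \<forall>Q\<in>S. ennreal (c Q * vol Q) \<le> (\<integral>\<^sup>+x\<in>Q. ennreal (w x) \<partial>lebesgue) \<Longrightarrow>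
    ennreal (\<Sum>Q\<in>S. c Q powr p * vol Q) \<le> ennreal B * (\<integral>\<^sup>+x. ennreal (w x powr p) \<partial>lebesgue)"
    using carleson_embedding[OF p, where 'n='n] by blast
  show ?thesis
  proof (intro exI[of _ B] conjI B allI impI)
    fix S :: "(real ^ 'n) set set" and E and u :: "real ^ 'n \<Rightarrow> 'x" and A
    assume S: "sparse_family S E" and u: "loc_integrable u"
      and A: "0 \<le> A" "(\<integral>\<^sup>+x. ennreal (norm (u x) powr p) \<partial>lebesgue) = ennreal A"
    have "ennreal (\<Sum>Q\<in>S. mean_norm u Q powr p * vol Q)
        \<le> ennreal B * (\<integral>\<^sup>+x. ennreal (norm (u x) powr p) \<partial>lebesgue)"
      using S mean_norm_integral[OF u] unfolding sparse_family_def
      by (intro emb[OF S borel_measurable_norm_loc[OF u]]) (auto simp: mean_norm_nonneg)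
    also have "\<dots> = ennreal (B * A)" using A B by (simp add: ennreal_mult)
    finally show "(\<Sum>Q\<in>S. mean_norm u Q powr p * vol Q) \<le> B * A"
      using A B by (subst (asm) ennreal_le_iff) auto
  qed
qed

text \<open>
  After sparse domination and the scalar embedding theorem for \<open>norm u\<close>, all that remains is to
  reassemble the blocks of the Rademacher sum. The two parts of the theorem differ only in this step.
\<close>

lemma embedding_from_sparse_bound:
  fixes sc :: "'k::{real_normed_field, euclidean_space} \<Rightarrow> 'x::banach \<Rightarrow> 'x"
  assumes sc: "normed_space_over sc" and rmf: "RMF_property sc TYPE('n::finite)"
    and p: "1 < p" and q: "1 < q" and K: "0 < K"
    and bound: "\<And>(u :: real ^ 'n \<Rightarrow> 'x) (b :: (real ^ 'n) set \<Rightarrow> real ^ 'n \<Rightarrow> 'k) S E par F M D.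
      finite (support b) \<Longrightarrow> sparse_family S E \<Longrightarrow> par ` support b \<subseteq> S \<Longrightarrow>
      0 < M \<Longrightarrow> 0 \<le> D \<Longrightarrow> carleson_functions q D S F \<Longrightarrow>
      \<forall>Q\<in>S. \<forall>x. rad 1 {R \<in> support b. par R = Q} (\<lambda>R. sc (b R x) (average R u))
        \<le> M * (mean_norm u Q * F Q x) \<Longrightarrow>
      (\<integral>\<^sup>+x. ennreal (rad p (support b) (\<lambda>R. sc (b R x) (average R u))) \<partial>lebesgue)
        \<le> ennreal (K * (M * D) powr p * (\<Sum>Q\<in>S. mean_norm u Q powr p * vol Q))"
  shows "\<exists>C::real. \<forall>(u :: real ^ 'n \<Rightarrow> 'x) (b :: (real ^ 'n) set \<Rightarrow> real ^ 'n \<Rightarrow> 'k).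
        u \<in> Lp_space p \<longrightarrow> admissible_family b \<longrightarrow>
        paraproduct_norm sc p b u \<le> ennreal C * Car_norm q b * Lp_norm p (\<lambda>x. ennreal (norm (u x)))"
proof -
  obtain M where M: "0 < M" and dom: "\<And>(u :: real ^ 'n \<Rightarrow> 'x) (b :: (real ^ 'n) set \<Rightarrow> real ^ 'n \<Rightarrow> 'k) D.
    loc_integrable u \<Longrightarrow> admissible_family b \<Longrightarrow> 0 \<le> D \<Longrightarrow> Car_norm q b = ennreal D \<Longrightarrow>
    sparse_control sc q M D u b"
    using sparse_domination[OF sc rmf q] by blast
  obtain B where B: "0 < B" and emb: "\<And>S E (u :: real ^ 'n \<Rightarrow> 'x) A.
    sparse_family S E \<Longrightarrow> loc_integrable u \<Longrightarrow> 0 \<le> A \<Longrightarrow>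
    (\<integral>\<^sup>+x. ennreal (norm (u x) powr p) \<partial>lebesgue) = ennreal A \<Longrightarrow>
    (\<Sum>Q\<in>S. mean_norm u Q powr p * vol Q) \<le> B * A"
    using mean_norm_embedding[OF p, where 'n='n and 'x='x] by blast
  define T where "T = K * (M * M) powr p * B"
  have T: "0 < T" using K M B by (simp add: T_def)
  show ?thesis
  proof (rule embedding_from_integral_bound[OF sc p T])
    fix u :: "real ^ 'n \<Rightarrow> 'x" and b :: "(real ^ 'n) set \<Rightarrow> real ^ 'n \<Rightarrow> 'k" and D A
    assume u: "loc_integrable u" and b: "admissible_family b" and D: "0 \<le> D" "Car_norm q b = ennreal D"
      and A: "0 \<le> A" "(\<integral>\<^sup>+x. ennreal (norm (u x) powr p) \<partial>lebesgue) = ennreal A"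
    obtain S E par F where S: "sparse_family S E" "par ` support b \<subseteq> S"
      and F: "carleson_functions q (M * D) S F"
      and R: "\<forall>Q\<in>S. \<forall>x. rad 1 {R \<in> support b. par R = Q} (\<lambda>R. sc (b R x) (average R u))
        \<le> M * (mean_norm u Q * F Q x)"
      using dom[OF u b D] unfolding sparse_control_def by (elim exE conjE)
    have "(\<integral>\<^sup>+x. ennreal (rad p (support b) (\<lambda>R. sc (b R x) (average R u))) \<partial>lebesgue)
        \<le> ennreal (K * (M * (M * D)) powr p * (\<Sum>Q\<in>S. mean_norm u Q powr p * vol Q))"
      using M D by (intro bound[OF admissible_familyD(1)[OF b] S M _ F R]) simp
    also have "\<dots> \<le> ennreal (K * (M * (M * D)) powr p * (B * A))"
      using K emb[OF S(1) u A] by (intro ennreal_leI mult_left_mono) auto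
    also have "K * (M * (M * D)) powr p * (B * A) = T * D powr p * A"
      using M D by (simp add: T_def powr_mult)
    finally show "(\<integral>\<^sup>+x. ennreal (rad p (support b) (\<lambda>R. sc (b R x) (average R u))) \<partial>lebesgue)
        \<le> ennreal (T * D powr p * A)" .
  qed
qed

text \<open>
  The blocks are added by the triangle inequality for first moments; Kahane's inequality is applied to
  the whole sum.
\<close>

lemma embedding_larger_exponent:
  fixes sc :: "'k::{real_normed_field, euclidean_space} \<Rightarrow> 'x::banach \<Rightarrow> 'x" and p q :: real
  assumes sc: "normed_space_over sc" and rmf: "RMF_property sc TYPE('n::finite)" and p: "1 < p" "p < q"
  shows "\<exists>C::real. \<forall>(u :: real ^ 'n \<Rightarrow> 'x) (b :: (real ^ 'n) set \<Rightarrow> real ^ 'n \<Rightarrow> 'k).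
        u \<in> Lp_space p \<longrightarrow> admissible_family b \<longrightarrow>
        paraproduct_norm sc p b u \<le> ennreal C * Car_norm q b * Lp_norm p (\<lambda>x. ennreal (norm (u x)))"
proof -
  have q: "1 < q" using p by simp
  obtain C where C: "0 < C" and sum: "\<And>S E (c :: (real ^ 'n) set \<Rightarrow> real) D (F :: (real ^ 'n) set \<Rightarrow> real ^ 'n \<Rightarrow> real).
    sparse_family S E \<Longrightarrow> \<forall>Q\<in>S. 0 \<le> c Q \<Longrightarrow> 0 \<le> D \<Longrightarrow>
    carleson_functions q D S F \<Longrightarrow>
    (\<integral>\<^sup>+x. ennreal ((\<Sum>Q\<in>S. c Q * F Q x) powr p) \<partial>lebesgue)
      \<le> ennreal (C * D powr p * (\<Sum>Q\<in>S. c Q powr p * vol Q))"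
    using sparse_sum_bound[OF p, where 'n='n] by blast
  obtain K where K: "0 < K" "\<And>J (x :: (real ^ 'n) set \<Rightarrow> 'x). finite J \<Longrightarrow> rad p J x \<le> K * rad 1 J x powr p"
    using kahane[of p, where 'i="(real ^ 'n) set" and 'x='x] p by auto
  have KC: "0 < K * C" using K C by simp
  show ?thesis
  proof (rule embedding_from_sparse_bound[OF sc rmf p(1) q KC])
    fix u :: "real ^ 'n \<Rightarrow> 'x" and b :: "(real ^ 'n) set \<Rightarrow> real ^ 'n \<Rightarrow> 'k" and S E par F M D
    assume fin: "finite (support b)" and S: "sparse_family S E" "par ` support b \<subseteq> S"
      and M: "0 < M" and D: "0 \<le> D" and cF: "carleson_functions q D S F"
      and R: "\<forall>Q\<in>S. \<forall>x. rad 1 {R \<in> support b. par R = Q} (\<lambda>R. sc (b R x) (average R u))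
        \<le> M * (mean_norm u Q * F Q x)"
    note F = cF[unfolded carleson_functions_def]
    have finS: "finite S" using S(1) by (simp add: sparse_family_def)
    let ?f = "\<lambda>x. \<Sum>Q\<in>S. mean_norm u Q * F Q x"
    have pt: "rad p (support b) (\<lambda>R. sc (b R x) (average R u)) \<le> K * M powr p * ?f x powr p" for x
    proof -
      have f0: "0 \<le> mean_norm u Q * F Q x" if "Q \<in> S" for Q using F that by (simp add: mean_norm_nonneg)
      have "rad 1 (support b) (\<lambda>R. sc (b R x) (average R u))
          \<le> (\<Sum>Q\<in>par ` support b. rad 1 {R \<in> support b. par R = Q} (\<lambda>R. sc (b R x) (average R u)))"
        by (rule rad_1_sum_le[OF fin])
      also have "\<dots> \<le> (\<Sum>Q\<in>par ` support b. M * (mean_norm u Q * F Q x))"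
        using S(2) R by (intro sum_mono) auto
      also have "\<dots> \<le> (\<Sum>Q\<in>S. M * (mean_norm u Q * F Q x))"
        using S(2) finS f0 M by (intro sum_mono2) auto
      finally have "rad 1 (support b) (\<lambda>R. sc (b R x) (average R u)) powr p \<le> (M * ?f x) powr p"
        using p by (intro powr_mono2) (auto simp: rad_nonneg sum_distrib_left)
      also have "\<dots> = M powr p * ?f x powr p"
        using M f0 by (simp add: powr_mult sum_nonneg)
      finally have "K * rad 1 (support b) (\<lambda>R. sc (b R x) (average R u)) powr p \<le> K * (M powr p * ?f x powr p)"
        using K(1) by (intro mult_left_mono) auto
      then show ?thesis using K(2)[OF fin, of "\<lambda>R. sc (b R x) (average R u)"] by (simp add: mult.assoc)
    qed
    have "(\<integral>\<^sup>+x. ennreal (rad p (support b) (\<lambda>R. sc (b R x) (average R u))) \<partial>lebesgue)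
        \<le> (\<integral>\<^sup>+x. ennreal (K * M powr p) * ennreal (?f x powr p) \<partial>lebesgue)"
      using pt K(1) by (intro nn_integral_mono) (simp add: ennreal_leI flip: ennreal_mult)
    also have "\<dots> = ennreal (K * M powr p) * (\<integral>\<^sup>+x. ennreal (?f x powr p) \<partial>lebesgue)"
    proof (rule nn_integral_cmult)
      have "?f \<in> borel_measurable lebesgue"
        using F by (intro borel_measurable_sum borel_measurable_times) auto
      then show "(\<lambda>x. ennreal (?f x powr p)) \<in> borel_measurable lebesgue" by measurable
    qed
    also have "\<dots> \<le> ennreal (K * M powr p) * ennreal (C * D powr p * (\<Sum>Q\<in>S. mean_norm u Q powr p * vol Q))"
      using D by (intro mult_left_mono sum[OF S(1) _ _ cF]) (auto simp: mean_norm_nonneg)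
    also have "\<dots> = ennreal (K * M powr p * (C * D powr p * (\<Sum>Q\<in>S. mean_norm u Q powr p * vol Q)))"
      using K(1) C by (intro ennreal_mult[symmetric] mult_nonneg_nonneg sum_nonneg) auto
    finally show "(\<integral>\<^sup>+x. ennreal (rad p (support b) (\<lambda>R. sc (b R x) (average R u))) \<partial>lebesgue)
        \<le> ennreal (K * C * (M * D) powr p * (\<Sum>Q\<in>S. mean_norm u Q powr p * vol Q))"
      using M D by (simp add: powr_mult mult_ac)
  qed
qed

text \<open>
  The blocks are decoupled by the type inequality, after which their \<open>p\<close>-th moments are integrated
  separately; no exponent is lost.
\<close>

lemma embedding_type:
  fixes sc :: "'k::{real_normed_field, euclidean_space} \<Rightarrow> 'x::banach \<Rightarrow> 'x" and p :: real
  assumes sc: "normed_space_over sc" and rmf: "RMF_property sc TYPE('n::finite)" and p: "1 < p"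
    and type: "rademacher_type TYPE('x) p"
  shows "\<exists>C::real. \<forall>(u :: real ^ 'n \<Rightarrow> 'x) (b :: (real ^ 'n) set \<Rightarrow> real ^ 'n \<Rightarrow> 'k).
        u \<in> Lp_space p \<longrightarrow> admissible_family b \<longrightarrow>
        paraproduct_norm sc p b u \<le> ennreal C * Car_norm p b * Lp_norm p (\<lambda>x. ennreal (norm (u x)))"
proof -
  obtain K where K: "0 < K" "\<And>J (x :: (real ^ 'n) set \<Rightarrow> 'x). finite J \<Longrightarrow> rad p J x \<le> K * rad 1 J x powr p"
    using kahane[of p, where 'i="(real ^ 'n) set" and 'x='x] p by auto
  obtain C0 where C0: "0 \<le> C0" "\<And>J (x :: (real ^ 'n) set \<Rightarrow> 'x) (g :: (real ^ 'n) set \<Rightarrow> (real ^ 'n) set). finite J \<Longrightarrow>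
    rad p J x \<le> C0 * (\<Sum>Q\<in>g ` J. rad p {R\<in>J. g R = Q} x)"
    using type_decoupling[OF type, where 'i="(real ^ 'n) set" and 'j="(real ^ 'n) set"] by blast
  \<comment> \<open>The summand \<open>1\<close> only makes the constant positive.\<close>
  define L where "L = (C0 + 1) * K"
  have L: "0 < L" using C0 K by (simp add: L_def)
  show ?thesis
  proof (rule embedding_from_sparse_bound[OF sc rmf p p L])
    fix u :: "real ^ 'n \<Rightarrow> 'x" and b :: "(real ^ 'n) set \<Rightarrow> real ^ 'n \<Rightarrow> 'k" and S E par F M D
    assume fin: "finite (support b)" and S: "sparse_family S E" "par ` support b \<subseteq> S"
      and M: "0 < M" and D: "0 \<le> D" and "carleson_functions p D S F"
      and R: "\<forall>Q\<in>S. \<forall>x. rad 1 {R \<in> support b. par R = Q} (\<lambda>R. sc (b R x) (average R u))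
        \<le> M * (mean_norm u Q * F Q x)"
    then have F: "\<forall>Q\<in>S. F Q \<in> borel_measurable lebesgue \<and> (\<forall>x. 0 \<le> F Q x) \<and> (\<forall>x. x \<notin> Q \<longrightarrow> F Q x = 0) \<and>
        (\<integral>\<^sup>+x. ennreal (F Q x powr p) \<partial>lebesgue) \<le> ennreal (D powr p * vol Q)"
      by (simp only: carleson_functions_def)
    have finS: "finite S" using S(1) by (simp add: sparse_family_def)
    have pt: "rad p (support b) (\<lambda>R. sc (b R x) (average R u))
        \<le> (\<Sum>Q\<in>S. L * M powr p * mean_norm u Q powr p * F Q x powr p)" for x
    proof -
      let ?X = "\<lambda>R. sc (b R x) (average R u)"
      have one: "rad p {R \<in> support b. par R = Q} ?X \<le> K * M powr p * (mean_norm u Q powr p * F Q x powr p)" if "Q \<in> S" for Q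
      proof -
        have "rad p {R \<in> support b. par R = Q} ?X \<le> K * rad 1 {R \<in> support b. par R = Q} ?X powr p"
          using fin by (intro K(2)) simp
        also have "\<dots> \<le> K * (M * (mean_norm u Q * F Q x)) powr p"
          using K(1) R that p by (intro mult_left_mono powr_mono2) (auto simp: rad_nonneg)
        also have "\<dots> = K * M powr p * (mean_norm u Q powr p * F Q x powr p)"
          using M F that by (simp add: powr_mult mean_norm_nonneg)
        finally show ?thesis .
      qed
      have "rad p (support b) ?X \<le> C0 * (\<Sum>Q\<in>par ` support b. rad p {R \<in> support b. par R = Q} ?X)"
        by (rule C0(2)[OF fin])
      also have "\<dots> \<le> (C0 + 1) * (\<Sum>Q\<in>S. rad p {R \<in> support b. par R = Q} ?X)"
        using C0(1) S(2) finS by (intro mult_mono sum_mono2 sum_nonneg) (auto simp: rad_nonneg)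
      also have "\<dots> \<le> (C0 + 1) * (\<Sum>Q\<in>S. K * M powr p * (mean_norm u Q powr p * F Q x powr p))"
        using C0(1) one by (intro mult_left_mono sum_mono) auto
      also have "\<dots> = (\<Sum>Q\<in>S. L * M powr p * mean_norm u Q powr p * F Q x powr p)"
        by (simp add: L_def sum_distrib_left mult.assoc)
      finally show ?thesis .
    qed
    have "(\<integral>\<^sup>+x. ennreal (rad p (support b) (\<lambda>R. sc (b R x) (average R u))) \<partial>lebesgue)
        \<le> (\<integral>\<^sup>+x. (\<Sum>Q\<in>S. ennreal (L * M powr p * mean_norm u Q powr p) * ennreal (F Q x powr p)) \<partial>lebesgue)"
    proof (rule nn_integral_mono)
      fix x
      have "ennreal (rad p (support b) (\<lambda>R. sc (b R x) (average R u)))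
          \<le> ennreal (\<Sum>Q\<in>S. L * M powr p * mean_norm u Q powr p * F Q x powr p)"
        by (rule ennreal_leI[OF pt])
      also have "\<dots> = (\<Sum>Q\<in>S. ennreal (L * M powr p * mean_norm u Q powr p) * ennreal (F Q x powr p))"
        using L by (subst sum_ennreal[symmetric]) (auto simp: ennreal_mult)
      finally show "ennreal (rad p (support b) (\<lambda>R. sc (b R x) (average R u)))
          \<le> (\<Sum>Q\<in>S. ennreal (L * M powr p * mean_norm u Q powr p) * ennreal (F Q x powr p))" .
    qed
    also have "\<dots> = (\<Sum>Q\<in>S. ennreal (L * M powr p * mean_norm u Q powr p) * (\<integral>\<^sup>+x. ennreal (F Q x powr p) \<partial>lebesgue))"
    proof -
      have m: "(\<lambda>x. ennreal (F Q x powr p)) \<in> borel_measurable lebesgue" if "Q \<in> S" for Q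
      proof -
        have "F Q \<in> borel_measurable lebesgue" using F that by blast
        then show ?thesis by measurable
      qed
      then show ?thesis by (subst nn_integral_sum) (auto simp: nn_integral_cmult intro!: sum.cong)
    qed
    also have "\<dots> \<le> (\<Sum>Q\<in>S. ennreal (L * M powr p * mean_norm u Q powr p) * ennreal (D powr p * vol Q))"
      using F by (intro sum_mono mult_left_mono) auto
    also have "\<dots> = ennreal (\<Sum>Q\<in>S. L * (M * D) powr p * (mean_norm u Q powr p * vol Q))"
      using L M D by (subst sum_ennreal[symmetric])
        (auto simp: powr_mult mult.assoc mult.left_commute intro!: sum.cong simp flip: ennreal_mult)
    finally show "(\<integral>\<^sup>+x. ennreal (rad p (support b) (\<lambda>R. sc (b R x) (average R u))) \<partial>lebesgue)
        \<le> ennreal (L * (M * D) powr p * (\<Sum>Q\<in>S. mean_norm u Q powr p * vol Q))"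
      unfolding sum_distrib_left .
  qed
qed

theorem theorem8p2:
  fixes sc :: "'k::{real_normed_field, euclidean_space} \<Rightarrow> 'x::banach \<Rightarrow> 'x"
    and p \<epsilon> :: real
  assumes "normed_space_over sc"
    and "RMF_property sc TYPE('n::finite)"
    and "1 < p" and "0 < \<epsilon>"
  shows
    "(\<exists>C::real. \<forall>(u :: real ^ 'n \<Rightarrow> 'x) (b :: (real ^ 'n) set \<Rightarrow> real ^ 'n \<Rightarrow> 'k).
        u \<in> Lp_space p \<longrightarrow> admissible_family b \<longrightarrow>
        paraproduct_norm sc p b u
          \<le> ennreal C * Car_norm (p + \<epsilon>) b * Lp_norm p (\<lambda>x. ennreal (norm (u x)))) \<and>
     (rademacher_type TYPE('x) p \<longrightarrow>
      (\<exists>C::real. \<forall>(u :: real ^ 'n \<Rightarrow> 'x) (b :: (real ^ 'n) set \<Rightarrow> real ^ 'n \<Rightarrow> 'k).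
        u \<in> Lp_space p \<longrightarrow> admissible_family b \<longrightarrow>
        paraproduct_norm sc p b u
          \<le> ennreal C * Car_norm p b * Lp_norm p (\<lambda>x. ennreal (norm (u x)))))"
  using embedding_larger_exponent[OF assms(1,2,3), of "p + \<epsilon>"] embedding_type[OF assms(1,2,3)] assms(4)
  by auto

end
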